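(* Let $T$ be a centered, isotropic Gaussian random field on $\mathbb S^2$ with angular power spectrum $(A_\ell,\ell\in\mathbb N_0)$. If $\sum_{\ell=0}^\infty A_\ell\,\ell^{1+\beta}<+\infty$ for some $\beta>0$, then there exists a $C^\gamma(\mathbb S^2)$-valued modification of the corresponding lognormal random field $\exp(T)$ for all $\gamma<\beta/2$; that is, the modification is $k$-times continuously differentiable with $k=\lceil\beta/2\rceil-1$ and the $k$th derivatives are Hölder continuous with exponent $\gamma-k$ (for $k<\gamma<\beta/2$).
   Context: $\mathbb S^2$ is the unit sphere in $\mathbb R^3$. A centered isotropic Gaussian random field on $\mathbb S^2$ is a jointly measurable map $T:\Omega\times\mathbb S^2\to\mathbb R$ that is Gaussian (all finite-dimensional distributions are multivariate Gaussian), with mean zero and covariance invariant under rotations in $\mathrm{SO}(3)$. Its angular power spectrum is the sequence of nonnegative reals $(A_\ell,\ell\in\mathbb N_0)$ with $\mathbb E(T(x)T(y))=\sum_{\ell=0}^\infty A_\ell\frac{2\ell+1}{4\pi}P_\ell(\langle x,y\rangle_{\mathbb R^3})$, $P_\ell$ the Legendre polynomials. The lognormal random field $\exp(T)$ is $x\mapsto\exp(T(x))$. A modification of a random field $S$ is a random field $\tilde S$ with $\mathbb P(\tilde S(x)=S(x))=1$ for every $x\in\mathbb S^2$; regularity refers to its sample paths. $C^\gamma(\mathbb S^2)$ denotes the Hölder space of order $\gamma$. *)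

theory Defs
  imports "HOL-Probability.Probability" "HOL-Computational_Algebra.Polynomial"
begin

section \<open>Legendre polynomials\<close>

text \<open>Rodrigues' formula \<open>P\<^sub>l(t) = (2^l l!)\<inverse> d^l/dt^l (t^2 - 1)^l\<close>.\<close>

definition legendre_poly :: "nat \<Rightarrow> real poly" where
  "legendre_poly l = smult (1 / (2 ^ l * fact l)) ((pderiv ^^ l) ([:-1, 0, 1:] ^ l))"


section \<open>Isotropic Gaussian random fields on the sphere\<close>

text \<open>Fields are total functions in the second argument; only their values on
  the unit sphere \<open>sphere 0 1\<close> of \<open>real^3\<close> are ever used.\<close>

definition random_field :: "'w measure \<Rightarrow> ('w \<Rightarrow> real^3 \<Rightarrow> real) \<Rightarrow> bool" where
  "random_field M T \<longleftrightarrow>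
     (\<lambda>(w, x). T w x) \<in> borel_measurable (M \<Otimes>\<^sub>M restrict_space borel (sphere 0 1))"

text \<open>Univariate normal laws, including the point masses (variance 0).\<close>

definition gaussian_rv :: "'w measure \<Rightarrow> ('w \<Rightarrow> real) \<Rightarrow> bool" where
  "gaussian_rv M X \<longleftrightarrow> X \<in> borel_measurable M \<and>
     (\<exists>\<mu>. distr M borel X = return borel \<mu> \<or>
          (\<exists>\<sigma>>0. distributed M lborel X (\<lambda>t. ennreal (normal_density \<mu> \<sigma> t))))"

text \<open>A random vector \<open>(X i)\<^sub>i\<^sub>\<in>\<^sub>I\<close> is multivariate Gaussian (possibly degenerate) if every
  linear combination of its components is a univariate Gaussian.\<close>

definition multivariate_gaussian :: "'w measure \<Rightarrow> 'i set \<Rightarrow> ('i \<Rightarrow> 'w \<Rightarrow> real) \<Rightarrow> bool" where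
  "multivariate_gaussian M I X \<longleftrightarrow>
     (\<forall>c :: 'i \<Rightarrow> real. gaussian_rv M (\<lambda>w. \<Sum>i\<in>I. c i * X i w))"

definition gaussian_field :: "'w measure \<Rightarrow> ('w \<Rightarrow> real^3 \<Rightarrow> real) \<Rightarrow> bool" where
  "gaussian_field M T \<longleftrightarrow> random_field M T \<and>
     (\<forall>F. finite F \<and> F \<subseteq> sphere 0 1 \<longrightarrow> multivariate_gaussian M F (\<lambda>x w. T w x))"

definition centered :: "'w measure \<Rightarrow> ('w \<Rightarrow> real^3 \<Rightarrow> real) \<Rightarrow> bool" where
  "centered M T \<longleftrightarrow> (\<forall>x\<in>sphere 0 1. integral\<^sup>L M (\<lambda>w. T w x) = 0)"

definition field_cov :: "'w measure \<Rightarrow> ('w \<Rightarrow> real^3 \<Rightarrow> real) \<Rightarrow> real^3 \<Rightarrow> real^3 \<Rightarrow> real" where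
  "field_cov M T x y = integral\<^sup>L M (\<lambda>w.
     (T w x - integral\<^sup>L M (\<lambda>v. T v x)) * (T w y - integral\<^sup>L M (\<lambda>v. T v y)))"

definition isotropic :: "'w measure \<Rightarrow> ('w \<Rightarrow> real^3 \<Rightarrow> real) \<Rightarrow> bool" where
  "isotropic M T \<longleftrightarrow>
     (\<forall>Q. rotation_matrix Q \<longrightarrow>
        (\<forall>x\<in>sphere 0 1. \<forall>y\<in>sphere 0 1. field_cov M T (Q *v x) (Q *v y) = field_cov M T x y))"

definition angular_power_spectrum ::
    "'w measure \<Rightarrow> ('w \<Rightarrow> real^3 \<Rightarrow> real) \<Rightarrow> (nat \<Rightarrow> real) \<Rightarrow> bool" where
  "angular_power_spectrum M T A \<longleftrightarrow> (\<forall>l. 0 \<le> A l) \<and>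
     (\<forall>x\<in>sphere 0 1. \<forall>y\<in>sphere 0 1.
        (\<lambda>l. A l * ((2 * real l + 1) / (4 * pi)) * poly (legendre_poly l) (x \<bullet> y))
          sums integral\<^sup>L M (\<lambda>w. T w x * T w y))"

definition is_modification ::
    "'w measure \<Rightarrow> ('w \<Rightarrow> real^3 \<Rightarrow> real) \<Rightarrow> ('w \<Rightarrow> real^3 \<Rightarrow> real) \<Rightarrow> bool" where
  "is_modification M S' S \<longleftrightarrow> random_field M S' \<and>
     (\<forall>x\<in>sphere 0 1. measure M {w \<in> space M. S' w x = S w x} = 1)"


section \<open>Hoelder spaces on the sphere\<close>

fun iter_partial :: "2 list \<Rightarrow> (real^2 \<Rightarrow> real) \<Rightarrow> real^2 \<Rightarrow> real" where
  "iter_partial [] g = g"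
| "iter_partial (i # js) g = (\<lambda>u. frechet_derivative (iter_partial js g) (at u) (axis i 1))"

definition Ck_plane :: "nat \<Rightarrow> (real^2 \<Rightarrow> real) \<Rightarrow> bool" where
  "Ck_plane k g \<longleftrightarrow>
     (\<forall>js u. length js < k \<longrightarrow> iter_partial js g differentiable (at u)) \<and>
     (\<forall>js. length js \<le> k \<longrightarrow> continuous_on UNIV (iter_partial js g))"

definition locally_hoelder :: "real \<Rightarrow> (real^2 \<Rightarrow> real) \<Rightarrow> bool" where
  "locally_hoelder a g \<longleftrightarrow>
     (\<forall>r. \<exists>C. \<forall>u\<in>cball 0 r. \<forall>v\<in>cball 0 r. \<bar>g u - g v\<bar> \<le> C * dist u v powr a)"

text \<open>Inverse stereographic projections: for \<open>s = 1\<close> from the north pole \<open>(0,0,1)\<close>,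
  for \<open>s = -1\<close> from the south pole. The two form a smooth atlas of the sphere.\<close>

definition stereo :: "real \<Rightarrow> real^2 \<Rightarrow> real^3" where
  "stereo s u = inverse (1 + (norm u)\<^sup>2) *\<^sub>R
     vector [2 * (u $ 1), 2 * (u $ 2), s * ((norm u)\<^sup>2 - 1)]"

definition Ck_sphere :: "nat \<Rightarrow> (real^3 \<Rightarrow> real) \<Rightarrow> bool" where
  "Ck_sphere k f \<longleftrightarrow> (\<forall>s\<in>{1, -1}. Ck_plane k (f \<circ> stereo s))"

text \<open>Hoelder continuity of the derivatives of order \<open>k\<close>, expressed in the charts. Since the
  closed unit discs of the two charts already cover the sphere, Hoelder continuity on bounded sets
  of each chart amounts to a uniform Hoelder condition on the compact sphere.\<close>

definition hoelder_derivs_sphere :: "nat \<Rightarrow> real \<Rightarrow> (real^3 \<Rightarrow> real) \<Rightarrow> bool" where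
  "hoelder_derivs_sphere k a f \<longleftrightarrow>
     (\<forall>s\<in>{1, -1}. \<forall>js. length js = k \<longrightarrow> locally_hoelder a (iter_partial js (f \<circ> stereo s)))"

text \<open>For a natural number \<open>\<gamma>\<close> this is the space of \<open>\<gamma>\<close> times continuously differentiable
  functions: a Hoelder condition with exponent \<open>0\<close> is just local boundedness.\<close>

definition hoelder_space_sphere :: "real \<Rightarrow> (real^3 \<Rightarrow> real) set" where
  "hoelder_space_sphere \<gamma> = {f. Ck_sphere (nat \<lfloor>\<gamma>\<rfloor>) f \<and>
     hoelder_derivs_sphere (nat \<lfloor>\<gamma>\<rfloor>) (\<gamma> - real (nat \<lfloor>\<gamma>\<rfloor>)) f}"

end

theory Submission
  imports Defs "HOL-Complex_Analysis.Cauchy_Integral_Formula"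
begin

text \<open>
  Why the theorem holds. Stereographic projection turns the field into a Gaussian field
  \<open>X u = T (stereo s u)\<close> on the plane, and Hoelder regularity of order \<open>\<gamma>\<close> is visible in
  finite differences of high order \<open>m\<close> along the two coordinate directions: it suffices that on the
  grid \<open>2\<^sup>-\<^sup>n \<int>\<^sup>2\<close> these differences are locally of size \<open>2 powr - n \<gamma>\<close>, uniformly in the grid point.

  Variance of the differences. By the spectral expansion of the covariance, the variance of an \<open>m\<close>-th
  difference with step \<open>h\<close> is the sum over \<open>l\<close> of \<open>A l (2 l + 1) / (4 \<pi>)\<close> times a mixed
  difference, of order \<open>m\<close> in each of the two variables, of the kernel \<open>P\<^sub>l (stereo s u \<bullet> stereo s v)\<close>.
  The image of a coordinate line is a circle on the sphere. Laplace's representation writes \<open>P\<^sub>l\<close> as an average of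
  \<open>l\<close>-th powers; on this circle the bases of the powers are analytic functions of the two line parameters,
  have modulus at most 1 on the real line, and at most \<open>1 + 9 / l\<close> on a complex strip of width of
  order \<open>1 / l\<close>. Cauchy's inequality on this strip bounds the mixed difference by \<open>C (l h)\<^sup>2\<^sup>m\<close>
  (\<open>legendre_stereo_differences\<close>). Since it is also bounded by \<open>4\<^sup>m\<close>, and \<open>\<beta> \<le> 2 m\<close>, it is at most
  \<open>C (l h) powr \<beta>\<close>, and the hypothesis on the spectrum yields a variance of order \<open>h powr \<beta>\<close>
  (\<open>difference_variance\<close>). Gaussian moments of high order, Markov's inequality and the Borel-Cantelli
  lemma turn this into the almost sure bound \<open>2 powr - n \<gamma>\<close> for every \<open>\<gamma> < \<beta> / 2\<close>
  (\<open>AE_grid_difference_bound\<close>).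

  From differences to regularity. Fix a compactly supported function \<open>\<phi>\<close> of class \<open>C\<^sup>K\<close> whose integer
  translates reproduce all polynomials of degree below \<open>m\<close> from their integer values
  (\<open>cardinal_function_exists\<close>). The quasi-interpolants
  \<open>X\<^sub>n u = (\<Sum>i j. X (2\<^sup>-\<^sup>n (i, j)) \<phi> (2\<^sup>n u\<^sub>1 - i) \<phi> (2\<^sup>n u\<^sub>2 - j))\<close> are smooth. The increment
  \<open>X\<^sub>n\<^sub>+\<^sub>1 - X\<^sub>n\<close> annihilates polynomials of low degree in each variable, so it is controlled by the
  \<open>m\<close>-th differences of \<open>X\<close> on the grid; each partial derivative costs a factor \<open>2\<^sup>n\<close>
  (\<open>approximant_level_difference\<close>). Summing the telescoping series gives a limit of class \<open>C\<^sup>\<gamma>\<close>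
  (\<open>multiscale_limit\<close>). The covariance is continuous, hence \<open>X\<^sub>n u\<close> also tends to \<open>X u\<close> in
  quadratic mean, and the limit is a modification of \<open>X\<close> (\<open>chart_version_AE_eq\<close>).

  Conclusion. The limits obtained in the two charts agree almost surely on a countable dense set, hence by
  continuity everywhere on the overlap, so they define one function on the sphere
  (\<open>glued_version_stereo\<close>). Composition with \<open>exp\<close> preserves the Hoelder classes (\<open>holder_Ck_exp\<close>).
\<close>

section \<open>Legendre polynomials as averages of powers\<close>

lemma higher_pderiv_pcompose_shift:
  fixes p :: "real poly"
  shows "(pderiv ^^ n) (pcompose p [:t, 1:]) = pcompose ((pderiv ^^ n) p) [:t, 1:]"
  by (induction n) (simp_all add: pderiv_pcompose pderiv_pCons)

lemma pcompose_power_left: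
  fixes p q :: "'a :: comm_semiring_1 poly"
  shows "pcompose (p ^ n) q = pcompose p q ^ n"
  by (induction n) (simp_all add: pcompose_mult pcompose_1)

text \<open>Rodrigues' formula takes the \<open>l\<close>-th derivative of \<open>(x\<^sup>2 - 1)\<^sup>l\<close> at \<open>t\<close>; this is a Taylor coefficient, so it
  can be read off after the substitution \<open>x = t + z\<close>, which gives \<open>(t\<^sup>2 - 1 + 2 t z + z\<^sup>2)\<^sup>l\<close>.\<close>

lemma legendre_poly_eq_coeff:
  "poly (legendre_poly l) t = coeff ([:t\<^sup>2 - 1, 2 * t, 1:] ^ l) l / 2 ^ l"
proof -
  let ?p = "[:-1, 0, 1:] ^ l :: real poly"
  have shift: "pcompose ?p [:t, 1:] = [:t\<^sup>2 - 1, 2 * t, 1:] ^ l"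
    unfolding pcompose_power_left
    by (simp add: pcompose_pCons power2_eq_square algebra_simps)
  have "poly ((pderiv ^^ l) ?p) t = coeff (pcompose ((pderiv ^^ l) ?p) [:t, 1:]) 0"
    by (simp add: poly_0_coeff_0[symmetric] poly_pcompose)
  also have "\<dots> = coeff ((pderiv ^^ l) (pcompose ?p [:t, 1:])) 0"
    by (simp add: higher_pderiv_pcompose_shift)
  also have "\<dots> = fact l * coeff ([:t\<^sup>2 - 1, 2 * t, 1:] ^ l) l"
    unfolding shift by (simp add: coeff_higher_pderiv pochhammer_fact)
  finally show ?thesis
    by (simp add: legendre_poly_def)
qed

lemma coeff_pCons2_power_of_real:
  "coeff ([:complex_of_real a, of_real b, of_real c:] ^ l) k = of_real (coeff ([:a, b, c:] ^ l) k)"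
proof (induction l arbitrary: k)
  case (Suc l)
  have "coeff ([:x, y, z:] * q) k = x * coeff q k + (if k \<ge> 1 then y * coeff q (k - 1) else 0)
      + (if k \<ge> 2 then z * coeff q (k - 2) else 0)"
    for x y z :: "'a::comm_ring_1" and q
    by (auto simp: coeff_pCons split: nat.splits)
  note coeff_step = this
  show ?case
    unfolding power_Suc coeff_step by (simp add: Suc)
qed simp

lemma coeff_pCons2_scale:
  fixes a b c :: "'a :: comm_ring_1"
  shows "coeff ([:a, b * r, c * r\<^sup>2:] ^ l) k = r ^ k * coeff ([:a, b, c:] ^ l) k"
proof -
  have "[:a, b * r, c * r\<^sup>2:] = pcompose [:a, b, c:] [:0, r:]"
    by (simp add: pcompose_pCons power2_eq_square algebra_simps)
  then show ?thesis
    by (metis coeff_pcompose_linear pcompose_power_left mult.commute)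
qed

text \<open>The middle coefficient of \<open>(\<beta> + t z + \<alpha> z\<^sup>2)\<^sup>l\<close> depends on \<open>\<alpha>\<close> and \<open>\<beta>\<close> only through their product,
  because rescaling \<open>z\<close> multiplies it by an \<open>l\<close>-th power. This freedom allows the choice that makes
  \<open>t + \<alpha> w + \<beta> / w\<close> bounded by 1 on the unit circle.\<close>

lemma central_trinomial_coeff:
  fixes \<alpha> \<beta> t :: complex
  assumes "4 * \<alpha> * \<beta> = t\<^sup>2 - 1"
  shows "coeff ([:\<beta>, t, \<alpha>:] ^ l) l = coeff ([:t\<^sup>2 - 1, 2 * t, 1:] ^ l) l / 2 ^ l"
proof (cases "\<alpha> = 0")
  case True
  have *: "coeff ([:b, s:] ^ l) l = s ^ l" for b s :: complex
  proof -
    have "coeff ([:b, s:] ^ l) l = s ^ l * coeff ([:b, 1:] ^ l) l"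
      using coeff_pCons2_scale[of b 1 s 0 l l] by simp
    also have "coeff ([:b, 1:] ^ l) l = 1"
      using lead_coeff_power[of "[:b, 1:]" l] by (simp add: degree_power_eq)
    finally show ?thesis by simp
  qed
  have **: "coeff ([:0, 2 * t, 1:] ^ l) l = (2 * t) ^ l"
  proof -
    have "[:0, 2 * t, 1:] = [:2 * t, 1:] * [:0, 1:]" by simp
    then have "[:0, 2 * t, 1:] ^ l = monom 1 l * [:2 * t, 1:] ^ l"
      by (metis power_mult_distrib mult.commute monom_altdef smult_1_left)
    then show ?thesis
      by (simp add: coeff_monom_mult poly_0_coeff_0[symmetric] poly_power)
  qed
  from True assms show ?thesis
    using *[of \<beta> t] ** by (simp add: power_mult_distrib flip: power2_eq_square)
next
  case False
  let ?r = "1 / (2 * \<alpha>)"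
  have "[:\<beta>, t * ?r, \<alpha> * ?r\<^sup>2:] = smult (1 / (4 * \<alpha>)) [:t\<^sup>2 - 1, 2 * t, 1:]"
    using False assms by (simp add: field_simps power2_eq_square)
  then have "?r ^ l * coeff ([:\<beta>, t, \<alpha>:] ^ l) l = (1 / (4 * \<alpha>)) ^ l * coeff ([:t\<^sup>2 - 1, 2 * t, 1:] ^ l) l"
    by (metis coeff_pCons2_scale coeff_smult smult_power)
  moreover have "(1 / (4 * \<alpha>)) ^ l = ?r ^ l / 2 ^ l"
    by (simp add: power_divide power_mult_distrib flip: power_mult_distrib[of 2 2])
  ultimately show ?thesis
    using False by (simp add: field_simps)
qed

definition unity_root :: "nat \<Rightarrow> nat \<Rightarrow> complex" where
  "unity_root N j = cis (2 * pi * real j / real N)"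

lemma sum_unity_root_power:
  assumes "N > 0"
  shows "(\<Sum>j<N. unity_root N j ^ s) = (if N dvd s then of_nat N else 0)"
proof -
  define z where "z = cis (2 * pi * real s / real N)"
  have eq: "unity_root N j ^ s = z ^ j" for j
    by (simp add: unity_root_def z_def Complex.DeMoivre field_simps)
  have zN: "z ^ N = 1"
  proof -
    have "z ^ N = cis (2 * pi * real s)"
      using assms by (simp add: z_def Complex.DeMoivre)
    then show ?thesis
      by (metis cis_multiple_2pi Ints_of_nat)
  qed
  have z1: "z = 1 \<longleftrightarrow> N dvd s"
  proof
    assume "z = 1"
    then have "cos (2 * pi * real s / real N) = 1"
      by (simp add: z_def complex_eq_iff)
    then obtain x :: int where "2 * pi * real s / real N = of_int x * 2 * pi"
      using cos_one_2pi_int by blast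
    then have "real s = of_int x * real N"
      using assms by (simp add: field_simps)
    then have "int s = x * int N"
      by (metis of_int_eq_iff of_int_mult of_int_of_nat_eq)
    then show "N dvd s"
      by (metis dvd_triv_right int_dvd_int_iff)
  next
    assume "N dvd s"
    then obtain k where "s = N * k" by auto
    then have "2 * pi * real s / real N = 2 * pi * real k" using assms by simp
    then show "z = 1" by (simp only: z_def cis_multiple_2pi Ints_of_nat)
  qed
  show ?thesis
  proof (cases "z = 1")
    case True
    then show ?thesis using z1 by (simp add: eq)
  next
    case False
    then have "(\<Sum>j<N. z ^ j) = 0"
      by (simp add: geometric_sum zN)
    then show ?thesis using False z1 by (simp add: eq)
  qed
qed

text \<open>Laplace's integral over the circle, with the integral replaced by the mean over \<open>N > l\<close> equidistant
  nodes; for trigonometric polynomials of degree \<open>l\<close> the two agree. Each base has modulus at most 1, as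
  \<open>(p cos \<phi> + q sin \<phi>)\<^sup>2 \<le> p\<^sup>2 + q\<^sup>2\<close>; so the formula bounds \<open>P\<^sub>l\<close> and, since the bases
  extend analytically, its differences as well.\<close>

lemma discrete_laplace_formula:
  fixes t p q :: real
  assumes N: "l < N" and unit: "t\<^sup>2 + p\<^sup>2 + q\<^sup>2 = 1"
  defines "\<phi> \<equiv> \<lambda>j. 2 * pi * real j / real N"
  shows "complex_of_real (poly (legendre_poly l) t) =
    (\<Sum>j<N. (of_real t + \<i> * of_real (p * cos (\<phi> j) + q * sin (\<phi> j))) ^ l) / of_nat N"
proof -
  \<comment> \<open>chosen such that \<open>\<alpha> w + \<beta> / w = \<i> (p cos \<phi> + q sin \<phi>)\<close> for \<open>w = cis \<phi>\<close>\<close>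
  define \<alpha> where "\<alpha> = Complex (q / 2) (p / 2)"
  define \<beta> where "\<beta> = Complex (- q / 2) (p / 2)"
  let ?H = "[:\<beta>, of_real t, \<alpha>:] ^ l"
  have "4 * \<alpha> * \<beta> = of_real (t\<^sup>2 - 1)"
    using unit by (simp add: \<alpha>_def \<beta>_def complex_eq_iff power2_eq_square field_simps)
  then have c: "coeff ?H l = of_real (poly (legendre_poly l) t)"
    using central_trinomial_coeff[of \<alpha> \<beta> "of_real t" l]
      coeff_pCons2_power_of_real[of "t\<^sup>2 - 1" "2 * t" 1 l l]
    by (simp add: legendre_poly_eq_coeff)
  \<comment> \<open>the factor \<open>w\<^sup>-\<^sup>l\<close> that clears the denominator is written as \<open>w\<^sup>N\<^sup>-\<^sup>l\<close> to keep the exponents natural\<close>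
  have base: "(of_real t + \<i> * of_real (p * cos (\<phi> j) + q * sin (\<phi> j))) ^ l
      = (\<Sum>k\<le>2*l. coeff ?H k * unity_root N j ^ (k + (N - l)))" for j
  proof -
    let ?w = "unity_root N j"
    have wN: "?w ^ N = 1"
      using N cis_multiple_2pi[of "real j"] by (simp add: unity_root_def Complex.DeMoivre)
    have w: "?w = Complex (cos (\<phi> j)) (sin (\<phi> j))"
      by (simp add: unity_root_def \<phi>_def complex_eq_iff)
    have "(of_real t + \<i> * of_real (p * cos (\<phi> j) + q * sin (\<phi> j))) * ?w = poly [:\<beta>, of_real t, \<alpha>:] ?w"
    proof -
      have s: "sin (\<phi> j) * sin (\<phi> j) = 1 - cos (\<phi> j) * cos (\<phi> j)"
        using sin_cos_squared_add[of "\<phi> j"] by (simp add: power2_eq_square)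
      show ?thesis
        unfolding w by (simp add: complex_eq_iff \<alpha>_def \<beta>_def field_simps s)
    qed
    then have "(of_real t + \<i> * of_real (p * cos (\<phi> j) + q * sin (\<phi> j))) ^ l * ?w ^ l = poly ?H ?w"
      by (simp add: poly_power flip: power_mult_distrib)
    then have "(of_real t + \<i> * of_real (p * cos (\<phi> j) + q * sin (\<phi> j))) ^ l * (?w ^ l * ?w ^ (N - l))
        = poly ?H ?w * ?w ^ (N - l)"
      by (simp add: mult.assoc)
    moreover have "?w ^ l * ?w ^ (N - l) = 1"
      using N wN by (simp flip: power_add)
    moreover have "degree ?H \<le> 2 * l"
      by (rule order_trans[OF degree_power_le]) (auto simp: mult_le_mono)
    then have "poly ?H ?w = (\<Sum>k\<le>2*l. coeff ?H k * ?w ^ k)"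
      unfolding poly_altdef by (intro sum.mono_neutral_left) (auto simp: coeff_eq_0)
    ultimately show ?thesis
      by (simp add: sum_distrib_right power_add mult.assoc)
  qed
  have "(\<Sum>j<N. (of_real t + \<i> * of_real (p * cos (\<phi> j) + q * sin (\<phi> j))) ^ l)
     = (\<Sum>k\<le>2*l. coeff ?H k * (\<Sum>j<N. unity_root N j ^ (k + (N - l))))"
    unfolding base by (subst sum.swap) (simp add: sum_distrib_left)
  also have "\<dots> = (\<Sum>k\<le>2*l. if k = l then coeff ?H k * of_nat N else 0)"
  proof (rule sum.cong, goal_cases)
    case (2 k)
    \<comment> \<open>\<open>k + (N - l)\<close> lies strictly between \<open>0\<close> and \<open>2 N\<close>\<close>
    have "N dvd (k + (N - l)) \<longleftrightarrow> k = l"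
    proof
      assume "N dvd k + (N - l)"
      then obtain d where d: "k + (N - l) = N * d" by auto
      have "0 < N * d" "N * d < N * 2" unfolding d[symmetric] using N 2 by auto
      then have "0 < d" "d < 2" by (simp_all only: nat_0_less_mult_iff mult_less_cancel1)
      then have "d = 1" by simp
      with d N show "k = l" by auto
    qed (use N in auto)
    then show ?case using N by (simp add: sum_unity_root_power)
  qed auto
  also have "\<dots> = coeff ?H l * of_nat N"
    by simp
  finally show ?thesis
    using N by (simp add: c)
qed

section \<open>Finite differences of functions holomorphic on a strip\<close>

definition fdiff :: "'a \<Rightarrow> ('a::comm_ring_1 \<Rightarrow> 'b::comm_ring_1) \<Rightarrow> 'a \<Rightarrow> 'b" where
  "fdiff h g = (\<lambda>x. g (x + h) - g x)"

lemma fdiff_power_eq_sum: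
  "(fdiff h ^^ m) g x = (\<Sum>k\<le>m. (- 1) ^ (m - k) * of_nat (m choose k) * g (x + of_nat k * h))"
proof (induction m arbitrary: g x)
  case (Suc m)
  let ?c = "\<lambda>k. (- 1) ^ (m - k) * of_nat (m choose k)"
  have "(fdiff h ^^ Suc m) g x = (fdiff h ^^ m) (fdiff h g) x"
    by (simp only: funpow_Suc_right o_apply)
  also have "\<dots> = (\<Sum>k\<le>m. ?c k * g (x + of_nat (Suc k) * h)) - (\<Sum>k\<le>m. ?c k * g (x + of_nat k * h))"
    unfolding Suc by (simp add: fdiff_def algebra_simps sum_subtractf sum.distrib)
  also have "(\<Sum>k\<le>m. ?c k * g (x + of_nat (Suc k) * h))
      = (\<Sum>k\<le>Suc m. (if k = 0 then 0 else ?c (k - 1)) * g (x + of_nat k * h))"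
    by (subst sum.atMost_Suc_shift) simp
  also have "(\<Sum>k\<le>m. ?c k * g (x + of_nat k * h))
      = (\<Sum>k\<le>Suc m. (if k = Suc m then 0 else ?c k) * g (x + of_nat k * h))"
    by simp
  also have "(\<Sum>k\<le>Suc m. (if k = 0 then 0 else ?c (k - 1)) * g (x + of_nat k * h)) - \<dots>
     = (\<Sum>k\<le>Suc m. (- 1) ^ (Suc m - k) * of_nat (Suc m choose k) * g (x + of_nat k * h))"
    unfolding sum_subtractf[symmetric] left_diff_distrib[symmetric]
  proof (rule sum.cong[OF refl], rule arg_cong2[where f = "(*)", OF _ refl], goal_cases)
    case (1 k)
    show ?case
    proof (cases k)
      case 0 then show ?thesis by simp
    next
      case (Suc j)
      show ?thesis
      proof (cases "j = m")
        case False
        with 1 Suc have "j < m" by simp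
        then have "m - j = Suc (m - Suc j)" by simp
        then show ?thesis using Suc \<open>j < m\<close> by (simp add: algebra_simps)
      qed (simp add: Suc)
    qed
  qed
  finally show ?case .
qed simp

lemma open_strip: "open {z. \<bar>Im z\<bar> < r}"
  by (intro open_Collect_less continuous_intros)

text \<open>A difference is at most \<open>h\<close> times the derivative, and by Cauchy's inequality the derivative is bounded by \<open>B / \<delta>\<close>
  at distance \<open>\<delta>\<close> from the boundary of the strip.\<close>

lemma fdiff_strip_bound:
  fixes G :: "complex \<Rightarrow> complex"
  assumes hol: "G holomorphic_on {z. \<bar>Im z\<bar> < r}" and bnd: "\<And>z. \<bar>Im z\<bar> < r \<Longrightarrow> norm (G z) \<le> B"
    and "0 < \<delta>" "0 \<le> h" and z: "\<bar>Im z\<bar> < r - \<delta>"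
  shows "norm (fdiff (of_real h) G z) \<le> (h / \<delta>) * B"
proof -
  let ?S = "{z. \<bar>Im z\<bar> < r}"
  let ?K = "closed_segment z (z + of_real h)"
  have seg: "\<bar>Im w\<bar> < r - \<delta>" if "w \<in> ?K" for w
    using that z by (auto simp: in_segment algebra_simps)
  have d: "(G has_field_derivative deriv G w) (at w within ?K)" if "w \<in> ?K" for w
    using hol open_strip seg[OF that] \<open>0 < \<delta>\<close>
    by (intro has_field_derivative_at_within[OF holomorphic_derivI[OF hol open_strip]]) auto
  have c: "norm (deriv G w) \<le> B / \<delta>" if "w \<in> ?K" for w
  proof -
    have sub: "cball w \<delta> \<subseteq> ?S"
    proof
      fix x assume "x \<in> cball w \<delta>"
      then have "\<bar>Im (x - w)\<bar> \<le> \<delta>"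
        using abs_Im_le_cmod[of "x - w"] by (simp add: dist_norm norm_minus_commute)
      then show "x \<in> ?S" using seg[OF that] by auto
    qed
    have "norm ((deriv ^^ 1) G w) \<le> fact 1 * B / \<delta> ^ 1"
    proof (rule Cauchy_inequality)
      show "G holomorphic_on ball w \<delta>"
        using hol sub by (meson ball_subset_cball holomorphic_on_subset order_trans)
      show "continuous_on (cball w \<delta>) G"
        using hol sub by (meson holomorphic_on_imp_continuous_on holomorphic_on_subset)
      show "norm (G x) \<le> B" if "norm (w - x) = \<delta>" for x
        using sub that by (intro bnd) (auto simp: dist_norm)
    qed fact
    then show ?thesis by simp
  qed
  have "norm (G (z + of_real h) - G z) \<le> B / \<delta> * norm (z + of_real h - z)"
    by (rule field_differentiable_bound[OF _ d c]) auto
  then show ?thesis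
    using \<open>0 \<le> h\<close> by (simp add: fdiff_def mult.commute)
qed

lemma fdiff_holomorphic_strip:
  assumes "G holomorphic_on {z. \<bar>Im z\<bar> < r}"
  shows "fdiff (of_real h) G holomorphic_on {z. \<bar>Im z\<bar> < r}"
proof -
  have "(G \<circ> (\<lambda>z. z + of_real h)) holomorphic_on {z. \<bar>Im z\<bar> < r}"
    by (rule holomorphic_on_compose_gen[OF _ assms]) (auto intro!: holomorphic_intros)
  then show ?thesis
    unfolding fdiff_def using assms by (intro holomorphic_intros) (simp add: o_def)
qed

text \<open>Each difference costs a piece of width \<open>\<delta>\<close> of the strip and gains a factor \<open>h / \<delta>\<close>.\<close>

lemma fdiff_power_strip:
  fixes G :: "complex \<Rightarrow> complex"
  assumes hol: "G holomorphic_on {z. \<bar>Im z\<bar> < r}" and bnd: "\<And>z. \<bar>Im z\<bar> < r \<Longrightarrow> norm (G z) \<le> B"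
    and \<delta>: "0 < \<delta>" and h: "0 \<le> h"
  shows "(fdiff (of_real h) ^^ m) G holomorphic_on {z. \<bar>Im z\<bar> < r - of_nat m * \<delta>} \<and>
    (\<forall>z. \<bar>Im z\<bar> < r - of_nat m * \<delta> \<longrightarrow> norm ((fdiff (of_real h) ^^ m) G z) \<le> (h / \<delta>) ^ m * B)"
proof (induction m)
  case 0
  then show ?case using hol bnd by simp
next
  case (Suc m)
  let ?r = "r - of_nat m * \<delta>"
  let ?G = "(fdiff (of_real h) ^^ m) G"
  have r: "r - of_nat (Suc m) * \<delta> = ?r - \<delta>" by (simp add: algebra_simps)
  have "fdiff (of_real h) ?G holomorphic_on {z. \<bar>Im z\<bar> < ?r}"
    using Suc by (intro fdiff_holomorphic_strip) auto
  then have "fdiff (of_real h) ?G holomorphic_on {z. \<bar>Im z\<bar> < ?r - \<delta>}"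
    by (rule holomorphic_on_subset) (use \<delta> in auto)
  moreover have "norm (fdiff (of_real h) ?G z) \<le> (h / \<delta>) * ((h / \<delta>) ^ m * B)" if "\<bar>Im z\<bar> < ?r - \<delta>" for z
    using Suc \<delta> h that by (intro fdiff_strip_bound[where r = ?r]) auto
  ultimately show ?case
    unfolding r by (simp add: mult.assoc)
qed

lemma fdiff_power_strip_bound:
  fixes G :: "complex \<Rightarrow> complex"
  assumes "G holomorphic_on {z. \<bar>Im z\<bar> < r}" and "\<And>z. \<bar>Im z\<bar> < r \<Longrightarrow> norm (G z) \<le> B"
    and r: "0 < r" and h: "0 \<le> h" and "Im z = 0"
  shows "norm ((fdiff (of_real h) ^^ m) G z) \<le> (real (Suc m) * h / r) ^ m * B"
proof -
  \<comment> \<open>\<open>m\<close> steps of this size leave a strip of width \<open>\<delta>\<close> around the real axis\<close>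
  define \<delta> where "\<delta> = r / real (Suc m)"
  have "0 < \<delta>" "0 < r - of_nat m * \<delta>" "h / \<delta> = real (Suc m) * h / r"
    using r by (auto simp: \<delta>_def field_simps)
  then show ?thesis
    using fdiff_power_strip[of G r B \<delta> h m] assms by auto
qed

section \<open>The Legendre kernel on a circle\<close>

text \<open>Moving vertically from the real axis changes \<open>f\<close> by at most \<open>L\<close> times the height.\<close>

lemma strip_lipschitz:
  fixes f :: "complex \<Rightarrow> complex"
  assumes d: "\<And>w. \<bar>Im w\<bar> \<le> s \<Longrightarrow> (f has_field_derivative f' w) (at w)"
    and b: "\<And>w. \<bar>Im w\<bar> \<le> s \<Longrightarrow> norm (f' w) \<le> L" and z: "\<bar>Im z\<bar> \<le> s"
  shows "norm (f z - f (of_real (Re z))) \<le> L * \<bar>Im z\<bar>"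
proof -
  let ?K = "closed_segment (of_real (Re z)) z"
  have seg: "\<bar>Im w\<bar> \<le> s" if w: "w \<in> ?K" for w
  proof -
    from w obtain u where u: "0 \<le> u" "u \<le> 1" "Im w = u * Im z"
      by (auto simp: in_segment)
    then have "\<bar>Im w\<bar> \<le> 1 * \<bar>Im z\<bar>"
      unfolding u(3) abs_mult by (intro mult_right_mono) auto
    then show ?thesis using z by simp
  qed
  have "norm (f z - f (of_real (Re z))) \<le> L * norm (z - of_real (Re z))"
  proof (rule field_differentiable_bound[of ?K])
    show "(f has_field_derivative f' w) (at w within ?K)" if "w \<in> ?K" for w
      using d[OF seg[OF that]] by (rule has_field_derivative_at_within)
  qed (use b seg in auto)
  also have "z - of_real (Re z) = \<i> * of_real (Im z)"
    by (simp add: complex_eq_iff)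
  finally show ?thesis by (simp add: norm_mult)
qed

lemma norm_sin_cos_strip:
  assumes "\<bar>Im z\<bar> \<le> 1"
  shows "norm (sin z) \<le> exp 1" "norm (cos z) \<le> exp (1::real)"
proof -
  have e: "norm (exp (\<i> * z)) \<le> exp 1" "norm (exp (- (\<i> * z))) \<le> exp 1"
    using assms by (auto simp: norm_exp_eq_Re abs_le_iff)
  have "norm (sin z) = norm (exp (\<i> * z) - exp (- (\<i> * z))) / 2"
    by (simp add: sin_exp_eq norm_divide norm_mult)
  also have "\<dots> \<le> exp 1"
    using norm_triangle_ineq4[of "exp (\<i> * z)" "exp (- (\<i> * z))"] e by linarith
  finally show "norm (sin z) \<le> exp 1" .
  have "norm (cos z) = norm (exp (\<i> * z) + exp (- (\<i> * z))) / 2"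
    by (simp add: cos_exp_eq norm_divide)
  also have "\<dots> \<le> exp 1"
    using norm_triangle_ineq[of "exp (\<i> * z)" "exp (- (\<i> * z))"] e by linarith
  finally show "norm (cos z) \<le> exp 1" .
qed

lemma sin_cos_strip_lipschitz:
  assumes "\<bar>Im z\<bar> \<le> 1"
  shows "norm (sin z - of_real (sin (Re z))) \<le> 3 * \<bar>Im z\<bar>"
    and "norm (cos z - of_real (cos (Re z))) \<le> 3 * \<bar>Im z\<bar>"
proof -
  have "norm (sin z - sin (of_real (Re z))) \<le> 3 * \<bar>Im z\<bar>"
    using exp_le by (intro strip_lipschitz[where s = 1 and f' = cos])
      (auto intro!: derivative_eq_intros order_trans[OF norm_sin_cos_strip(2)] assms)
  then show "norm (sin z - of_real (sin (Re z))) \<le> 3 * \<bar>Im z\<bar>"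
    by (simp add: sin_of_real)
  have "norm (cos z - cos (of_real (Re z))) \<le> 3 * \<bar>Im z\<bar>"
    using exp_le by (intro strip_lipschitz[where s = 1 and f' = "\<lambda>w. - sin w"])
      (auto intro!: derivative_eq_intros order_trans[OF norm_sin_cos_strip(1)] assms)
  then show "norm (cos z - of_real (cos (Re z))) \<le> 3 * \<bar>Im z\<bar>"
    by (simp add: cos_of_real)
qed

text \<open>The base in Laplace's formula for two points at angular distance \<open>\<delta>\<close> on a circle of radius
  \<open>\<kappa>\<close> on the unit sphere: their inner product is \<open>t = 1 - \<kappa>\<^sup>2 (1 - cos \<delta>)\<close>, and \<open>p = \<kappa> sin \<delta>\<close>,
  \<open>q = \<eta> \<kappa> (1 - cos \<delta>)\<close> complete it to a unit vector when \<open>\<kappa>\<^sup>2 + \<eta>\<^sup>2 = 1\<close>. The angle is allowed to be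
  complex.\<close>

definition circle_base :: "real \<Rightarrow> real \<Rightarrow> real \<Rightarrow> complex \<Rightarrow> complex" where
  "circle_base \<kappa> \<eta> \<phi> \<delta> = 1 - of_real (\<kappa>\<^sup>2) * (1 - cos \<delta>)
     + \<i> * (of_real (\<kappa> * cos \<phi>) * sin \<delta> + of_real (\<eta> * \<kappa> * sin \<phi>) * (1 - cos \<delta>))"

lemma circle_unit:
  fixes \<kappa> \<eta> \<delta> :: real
  assumes "\<kappa>\<^sup>2 + \<eta>\<^sup>2 = 1"
  shows "(1 - \<kappa>\<^sup>2 * (1 - cos \<delta>))\<^sup>2 + (\<kappa> * sin \<delta>)\<^sup>2 + (\<eta> * \<kappa> * (1 - cos \<delta>))\<^sup>2 = 1"
proof -
  have s: "(sin \<delta>)\<^sup>2 = 1 - (cos \<delta>)\<^sup>2" by (rule sin_squared_eq)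
  have e: "\<eta>\<^sup>2 = 1 - \<kappa>\<^sup>2" using assms by simp
  show ?thesis
    unfolding power_mult_distrib s e by algebra
qed

lemma norm_circle_base_real:
  fixes x :: real
  assumes "\<kappa>\<^sup>2 + \<eta>\<^sup>2 = 1"
  shows "norm (circle_base \<kappa> \<eta> \<phi> (of_real x)) \<le> 1"
proof -
  define t where "t = 1 - \<kappa>\<^sup>2 * (1 - cos x)"
  define p where "p = \<kappa> * sin x"
  define q where "q = \<eta> * \<kappa> * (1 - cos x)"
  have eq: "circle_base \<kappa> \<eta> \<phi> (of_real x) = Complex t (p * cos \<phi> + q * sin \<phi>)"
    by (simp add: circle_base_def t_def p_def q_def complex_eq_iff sin_of_real cos_of_real flip: of_real_power)
  have "(p * cos \<phi> + q * sin \<phi>)\<^sup>2 + (p * sin \<phi> - q * cos \<phi>)\<^sup>2 = (p\<^sup>2 + q\<^sup>2) * ((sin \<phi>)\<^sup>2 + (cos \<phi>)\<^sup>2)"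
    by algebra
  then have "(p * cos \<phi> + q * sin \<phi>)\<^sup>2 \<le> p\<^sup>2 + q\<^sup>2"
    by (simp add: sin_cos_squared_add) (metis add_increasing2 order_refl zero_le_power2 add.commute le_add_same_cancel1)
  then have "t\<^sup>2 + (p * cos \<phi> + q * sin \<phi>)\<^sup>2 \<le> 1"
    using circle_unit[OF assms, of x] by (simp add: t_def p_def q_def)
  then show ?thesis
    unfolding eq complex_norm by simp
qed

text \<open>On the real line the modulus is at most 1; off the line each of the three trigonometric terms moves by at
  most \<open>3 \<bar>Im z\<bar>\<close>.\<close>

lemma norm_circle_base:
  assumes unit: "\<kappa>\<^sup>2 + \<eta>\<^sup>2 = 1" and z: "\<bar>Im z\<bar> \<le> 1"
  shows "norm (circle_base \<kappa> \<eta> \<phi> z) \<le> 1 + 9 * \<bar>Im z\<bar>"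
proof -
  have k: "\<bar>\<kappa>\<bar> \<le> 1" "\<bar>\<eta>\<bar> \<le> 1"
    using unit by (auto simp flip: abs_square_le_1) (smt (verit) zero_le_power2)+
  have k1: "\<bar>\<kappa>\<^sup>2\<bar> \<le> 1" "\<bar>\<kappa> * cos \<phi>\<bar> \<le> 1" "\<bar>\<eta> * \<kappa> * sin \<phi>\<bar> \<le> 1"
    using k by (auto simp: abs_mult power2_eq_square intro!: mult_le_one simp del: abs_mult_self_eq)
  let ?S = "sin z - of_real (sin (Re z))" and ?C = "cos z - of_real (cos (Re z))"
  have "circle_base \<kappa> \<eta> \<phi> z - circle_base \<kappa> \<eta> \<phi> (of_real (Re z))
     = of_real (\<kappa>\<^sup>2) * ?C + \<i> * (of_real (\<kappa> * cos \<phi>) * ?S) - \<i> * (of_real (\<eta> * \<kappa> * sin \<phi>) * ?C)"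
    by (simp add: circle_base_def sin_of_real cos_of_real algebra_simps)
  moreover have "norm (A + B - C) \<le> norm A + norm B + norm C" for A B C :: complex
    using norm_triangle_ineq4[of "A + B" C] norm_triangle_ineq[of A B] by linarith
  ultimately have "norm (circle_base \<kappa> \<eta> \<phi> z - circle_base \<kappa> \<eta> \<phi> (of_real (Re z)))
    \<le> norm (of_real (\<kappa>\<^sup>2) * ?C) + norm (\<i> * (of_real (\<kappa> * cos \<phi>) * ?S)) + norm (\<i> * (of_real (\<eta> * \<kappa> * sin \<phi>) * ?C))"
    by (simp only:)
  also have "\<dots> = \<bar>\<kappa>\<^sup>2\<bar> * norm ?C + \<bar>\<kappa> * cos \<phi>\<bar> * norm ?S + \<bar>\<eta> * \<kappa> * sin \<phi>\<bar> * norm ?C"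
    by (simp only: norm_mult norm_ii norm_of_real mult_1)
  also have "\<dots> \<le> 1 * (3 * \<bar>Im z\<bar>) + 1 * (3 * \<bar>Im z\<bar>) + 1 * (3 * \<bar>Im z\<bar>)"
    by (intro add_mono mult_mono k1 sin_cos_strip_lipschitz z) auto
  finally have "norm (circle_base \<kappa> \<eta> \<phi> z - circle_base \<kappa> \<eta> \<phi> (of_real (Re z))) \<le> 9 * \<bar>Im z\<bar>"
    by simp
  then show ?thesis
    using norm_circle_base_real[OF unit, of \<phi> "Re z"]
      norm_triangle_sub[of "circle_base \<kappa> \<eta> \<phi> z" "circle_base \<kappa> \<eta> \<phi> (of_real (Re z))"] by simp
qed

lemma circle_base_holomorphic: "circle_base \<kappa> \<eta> \<phi> holomorphic_on S"
  unfolding circle_base_def by (intro holomorphic_intros)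

text \<open>Inverse stereographic projection maps the line at signed distance \<open>y\<close> from the origin to a circle through
  the pole; with \<open>c = sqrt (1 + y\<^sup>2)\<close> this is the angle on that circle of the point with parameter \<open>a\<close>.\<close>

definition stereo_angle :: "real \<Rightarrow> complex \<Rightarrow> complex" where
  "stereo_angle c a = 2 * Arctan (a / of_real c)"

lemma Arctan_strip:
  assumes "\<bar>Im z\<bar> \<le> 1/2"
  shows "norm (Arctan z - of_real (arctan (Re z))) \<le> 3/2 * \<bar>Im z\<bar>"
proof -
  have d: "(Arctan has_field_derivative inverse (1 + w\<^sup>2)) (at w)" if "\<bar>Im w\<bar> \<le> 1/2" for w
    using that by (intro has_field_derivative_Arctan) auto
  have b: "norm (inverse (1 + w\<^sup>2)) \<le> 3/2" if "\<bar>Im w\<bar> \<le> 1/2" for w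
  proof -
    have "(Im w)\<^sup>2 \<le> (1/2)\<^sup>2"
      using that by (intro iffD1[OF abs_le_square_iff]) auto
    moreover have "Re (1 + w\<^sup>2) = 1 + (Re w)\<^sup>2 - (Im w)\<^sup>2" "(1/2)\<^sup>2 = (1/4 :: real)"
      by (simp_all add: power2_eq_square)
    ultimately have "3/4 \<le> Re (1 + w\<^sup>2)"
      using zero_le_power2[of "Re w"] by linarith
    then have "3/4 \<le> norm (1 + w\<^sup>2)"
      using complex_Re_le_cmod order_trans by blast
    then show ?thesis
      using le_imp_inverse_le[of "3/4" "norm (1 + w\<^sup>2)"] by (simp add: norm_inverse)
  qed
  show ?thesis
    using strip_lipschitz[of "1/2" Arctan "\<lambda>w. inverse (1 + w\<^sup>2)" "3/2" z] d b assms by (simp add: Arctan_of_real)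
qed

lemma stereo_angle_real: "stereo_angle c (of_real a) = of_real (2 * arctan (a / c))"
  by (simp add: stereo_angle_def Arctan_of_real flip: of_real_divide)

lemma Im_stereo_angle:
  assumes "c \<ge> 1" "\<bar>Im a\<bar> \<le> 1/2"
  shows "\<bar>Im (stereo_angle c a)\<bar> \<le> 3 * \<bar>Im a\<bar>"
proof -
  have i: "\<bar>Im (a / of_real c)\<bar> \<le> \<bar>Im a\<bar>"
    using assms by (simp add: divide_le_eq mult_left_le abs_divide)
      (metis abs_ge_zero mult_left_mono mult.right_neutral)
  then have "norm (Arctan (a / of_real c) - of_real (arctan (Re (a / of_real c)))) \<le> 3/2 * \<bar>Im (a / of_real c)\<bar>"
    using assms by (intro Arctan_strip) auto
  moreover have "\<bar>Im (Arctan (a / of_real c))\<bar> \<le> norm (Arctan (a / of_real c) - of_real (arctan (Re (a / of_real c))))"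
    using abs_Im_le_cmod[of "Arctan (a / of_real c) - of_real (arctan (Re (a / of_real c)))"] by simp
  ultimately show ?thesis
    using i by (simp add: stereo_angle_def)
qed

lemma stereo_angle_holomorphic:
  assumes "c \<ge> 1" "r \<le> 1/2"
  shows "stereo_angle c holomorphic_on {z. \<bar>Im z\<bar> < r}"
proof -
  have "(Arctan \<circ> (\<lambda>a. a / of_real c)) holomorphic_on {z. \<bar>Im z\<bar> < r}"
  proof (rule holomorphic_on_compose_gen)
    show "Arctan holomorphic_on {z. \<bar>Im z\<bar> < 1}"
      by (rule holomorphic_on_Arctan) auto
    show "(\<lambda>a. a / of_real c) ` {z. \<bar>Im z\<bar> < r} \<subseteq> {z. \<bar>Im z\<bar> < 1}"
      using assms by (auto simp: abs_divide divide_less_eq)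
  qed (use assms in \<open>auto intro!: holomorphic_intros\<close>)
  then show ?thesis
    unfolding stereo_angle_def by (intro holomorphic_intros) (simp add: o_def)
qed

abbreviation circle_kernel :: "real \<Rightarrow> real \<Rightarrow> real \<Rightarrow> real \<Rightarrow> nat \<Rightarrow> complex \<Rightarrow> complex \<Rightarrow> complex" where
  "circle_kernel c \<kappa> \<eta> \<phi> l a b \<equiv> circle_base \<kappa> \<eta> \<phi> (stereo_angle c a - stereo_angle c b) ^ l"

text \<open>The decisive estimate: the \<open>l\<close>-th power stays bounded, uniformly in \<open>l\<close>, on a strip whose width is
  of order \<open>1 / l\<close>. The angle map multiplies imaginary parts by at most 3, so the angle difference has
  imaginary part at most \<open>1 / l\<close>, and \<open>(1 + 9 / l)\<^sup>l \<le> exp 9\<close>.\<close>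

lemma norm_circle_kernel:
  assumes unit: "\<kappa>\<^sup>2 + \<eta>\<^sup>2 = 1" and c: "c \<ge> 1" and l: "l \<ge> 1"
    and a: "\<bar>Im a\<bar> < 1 / (6 * real l)" and b: "\<bar>Im b\<bar> < 1 / (6 * real l)"
  shows "norm (circle_kernel c \<kappa> \<eta> \<phi> l a b) \<le> exp 9"
proof -
  let ?\<delta> = "stereo_angle c a - stereo_angle c b"
  have l6: "1 / (6 * real l) \<le> 1 / 6" using l by (simp add: field_simps)
  have "\<bar>Im ?\<delta>\<bar> \<le> 3 * \<bar>Im a\<bar> + 3 * \<bar>Im b\<bar>"
    using Im_stereo_angle[OF c, of a] Im_stereo_angle[OF c, of b] a b l6 by simp
  also have "\<dots> \<le> 1 / real l" using a b by (simp add: field_simps)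
  finally have d: "\<bar>Im ?\<delta>\<bar> \<le> 1 / real l" .
  moreover have "1 / real l \<le> 1" using l by simp
  ultimately have "norm (circle_base \<kappa> \<eta> \<phi> ?\<delta>) \<le> 1 + 9 * \<bar>Im ?\<delta>\<bar>"
    by (intro norm_circle_base unit) linarith
  also have "\<dots> \<le> 1 + 9 / real l" using d by simp
  also have "\<dots> \<le> exp (9 / real l)" by (rule exp_ge_add_one_self)
  finally have "norm (circle_base \<kappa> \<eta> \<phi> ?\<delta>) ^ l \<le> exp (9 / real l) ^ l"
    by (rule power_mono) auto
  also have "\<dots> = exp 9" using l by (simp flip: exp_of_nat_mult)
  finally show ?thesis by (simp add: norm_power)
qed

text \<open>The coefficients of the \<open>m\<close>-th forward difference.\<close>

definition binom_sign :: "nat \<Rightarrow> nat \<Rightarrow> real" where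
  "binom_sign m k = (- 1) ^ (m - k) * of_nat (m choose k)"

text \<open>The strip estimate is applied twice: first in one variable for a fixed complex value of the other, then to
  the resulting differences as a holomorphic function of the second variable.\<close>

lemma circle_kernel_differences:
  assumes unit: "\<kappa>\<^sup>2 + \<eta>\<^sup>2 = 1" and c: "c \<ge> 1" and l: "l \<ge> 1" and h: "0 \<le> h"
  shows "norm (\<Sum>k\<le>m. \<Sum>k'\<le>m. of_real (binom_sign m k * binom_sign m k')
     * circle_kernel c \<kappa> \<eta> \<phi> l (of_real (a + real k * h)) (of_real (a + real k' * h)))
    \<le> exp 9 * (6 * real (Suc m) * real l * h) ^ (2 * m)"
proof -
  define r where "r = 1 / (6 * real l)"
  have r: "0 < r" "r \<le> 1/2" using l by (auto simp: r_def field_simps)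
  let ?K = "circle_kernel c \<kappa> \<eta> \<phi> l"
  let ?q = "(real (Suc m) * h / r) ^ m"
  note angle = stereo_angle_holomorphic[OF c r(2)]
  have comp: "(\<lambda>z. circle_base \<kappa> \<eta> \<phi> (f z)) holomorphic_on {z. \<bar>Im z\<bar> < r}"
    if "f holomorphic_on {z. \<bar>Im z\<bar> < r}" for f
    using holomorphic_on_compose[OF that circle_base_holomorphic] by (simp add: o_def)
  have inner: "norm ((fdiff (of_real h) ^^ m) (\<lambda>z. ?K z b) (of_real a)) \<le> ?q * exp 9" if "\<bar>Im b\<bar> < r" for b
  proof (rule fdiff_power_strip_bound[OF _ _ r(1) h])
    show "(\<lambda>z. ?K z b) holomorphic_on {z. \<bar>Im z\<bar> < r}"
      by (intro holomorphic_on_power comp holomorphic_intros angle)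
    show "norm (?K z b) \<le> exp 9" if "\<bar>Im z\<bar> < r" for z
      using that \<open>\<bar>Im b\<bar> < r\<close> norm_circle_kernel[OF unit c l] by (simp add: r_def)
  qed simp
  have "norm ((fdiff (of_real h) ^^ m) (\<lambda>b. (fdiff (of_real h) ^^ m) (\<lambda>z. ?K z b) (of_real a)) (of_real a))
     \<le> ?q * (?q * exp 9)"
  proof (rule fdiff_power_strip_bound[OF _ inner r(1) h])
    show "(\<lambda>b. (fdiff (of_real h) ^^ m) (\<lambda>z. ?K z b) (of_real a)) holomorphic_on {z. \<bar>Im z\<bar> < r}"
      unfolding fdiff_power_eq_sum
      by (intro holomorphic_intros comp angle)
  qed auto
  also have "?q * (?q * exp 9) = exp 9 * (6 * real (Suc m) * real l * h) ^ (2 * m)"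
  proof -
    have "real (Suc m) * h / r = 6 * real (Suc m) * real l * h"
      using l by (simp add: r_def)
    then show ?thesis
      by (metis (no_types) mult.commute mult.assoc mult_2 power_add)
  qed
  also have "(fdiff (of_real h) ^^ m) (\<lambda>b. (fdiff (of_real h) ^^ m) (\<lambda>z. ?K z b) (of_real a)) (of_real a)
    = (\<Sum>k'\<le>m. \<Sum>k\<le>m. of_real (binom_sign m k * binom_sign m k')
     * ?K (of_real (a + real k * h)) (of_real (a + real k' * h)))"
    unfolding fdiff_power_eq_sum by (simp add: binom_sign_def sum_distrib_left mult_ac)
  also have "\<dots> = (\<Sum>k\<le>m. \<Sum>k'\<le>m. of_real (binom_sign m k * binom_sign m k')
     * ?K (of_real (a + real k * h)) (of_real (a + real k' * h)))"
    by (rule sum.swap)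
  finally show ?thesis .
qed

section \<open>Differences of the Legendre kernel in stereographic coordinates\<close>

lemma norm_square_plane:
  fixes u :: "real^2" and i j :: 2
  assumes "i \<noteq> j"
  shows "(norm u)\<^sup>2 = (u $ i)\<^sup>2 + (u $ j)\<^sup>2"
proof -
  have "(norm u)\<^sup>2 = (u $ 1)\<^sup>2 + (u $ 2)\<^sup>2"
    unfolding power2_norm_eq_inner by (simp add: inner_vec_def sum_2 power2_eq_square)
  moreover have "(i = 1 \<and> j = 2) \<or> (i = 2 \<and> j = 1)"
    using exhaust_2[of i] exhaust_2[of j] assms by auto
  ultimately show ?thesis by auto
qed

text \<open>The chordal distance formula of stereographic projection. The sign \<open>s\<close> drops out, so both charts have the same
  covariance.\<close>

lemma inner_stereo:
  assumes s: "s \<in> {1, -1}"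
  shows "stereo s u \<bullet> stereo s v = 1 - 2 * (norm (u - v))\<^sup>2 / ((1 + (norm u)\<^sup>2) * (1 + (norm v)\<^sup>2))"
proof -
  have s2: "s * s = 1" using s by auto
  define U V where "U = 1 + (norm u)\<^sup>2" and "V = 1 + (norm v)\<^sup>2"
  have U: "U > 0" "V > 0" by (auto simp: U_def V_def add_pos_nonneg)
  have nU: "U = 1 + (u $ 1)\<^sup>2 + (u $ 2)\<^sup>2" "V = 1 + (v $ 1)\<^sup>2 + (v $ 2)\<^sup>2"
    by (simp_all add: U_def V_def norm_square_plane[of 1 2])
  have "stereo s u \<bullet> stereo s v
     = (4 * (u $ 1 * v $ 1) + 4 * (u $ 2 * v $ 2) + (s * s) * ((U - 2) * (V - 2))) / (U * V)"
  proof -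
    have "(vector [2 * (u $ 1), 2 * (u $ 2), s * ((norm u)\<^sup>2 - 1)] :: real^3)
        \<bullet> vector [2 * (v $ 1), 2 * (v $ 2), s * ((norm v)\<^sup>2 - 1)]
      = 4 * (u $ 1 * v $ 1) + 4 * (u $ 2 * v $ 2) + (s * s) * ((U - 2) * (V - 2))"
      by (simp add: inner_vec_def sum_3 U_def V_def)
    then show ?thesis
      by (simp add: stereo_def U_def V_def divide_inverse mult_ac)
  qed
  also have "\<dots> = (U * V - 2 * ((u $ 1 - v $ 1)\<^sup>2 + (u $ 2 - v $ 2)\<^sup>2)) / (U * V)"
    unfolding s2 nU by (simp add: power2_eq_square algebra_simps)
  also have "\<dots> = 1 - 2 * (norm (u - v))\<^sup>2 / (U * V)"
    using U by (simp add: norm_square_plane[of 1 2 "u - v"] diff_divide_distrib)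
  finally show ?thesis by (simp add: U_def V_def)
qed

lemma stereo_in_sphere: "s \<in> {1, -1} \<Longrightarrow> stereo s u \<in> sphere 0 1"
  using inner_stereo[of s u u] by (simp add: norm_eq_1)

text \<open>In terms of the angle on the circle, \<open>sin (A - B)\<^sup>2\<close> for \<open>A = arctan (a / c)\<close> and
  \<open>B = arctan (b / c)\<close> is the rational expression that \<open>inner_stereo\<close> gives for two points of the line.\<close>

lemma inner_stereo_on_line:
  fixes i j :: 2
  assumes s: "s \<in> {1, -1}" and ij: "i \<noteq> j" and y: "u $ j = y" "v $ j = y"
  defines "c \<equiv> sqrt (1 + y\<^sup>2)"
  shows "stereo s u \<bullet> stereo s v
    = 1 - (1 / c)\<^sup>2 * (1 - cos (2 * arctan (u $ i / c) - 2 * arctan (v $ i / c)))"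
proof -
  define a b where "a = u $ i" and "b = v $ i"
  have c2: "c\<^sup>2 = 1 + y\<^sup>2" and c0: "c > 0"
    by (auto simp: c_def add_pos_nonneg)
  define A B where "A = arctan (a / c)" and "B = arctan (b / c)"
  have pos: "1 + (x / c)\<^sup>2 > 0" for x by (simp add: add_pos_nonneg)
  have "sin (A - B) = (a / c - b / c) / (sqrt (1 + (a / c)\<^sup>2) * sqrt (1 + (b / c)\<^sup>2))"
    by (simp add: sin_diff A_def B_def sin_arctan cos_arctan diff_divide_distrib mult_ac)
  then have "(sin (A - B))\<^sup>2 = (a / c - b / c)\<^sup>2 / ((1 + (a / c)\<^sup>2) * (1 + (b / c)\<^sup>2))"
    using pos[of a] pos[of b] by (simp add: power_divide power_mult_distrib less_imp_le)
  moreover have "1 - cos (2 * A - 2 * B) = 2 * (sin (A - B))\<^sup>2"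
    using cos_double_sin[of "A - B"] by (simp add: algebra_simps)
  ultimately have "(1 / c)\<^sup>2 * (1 - cos (2 * A - 2 * B))
      = 2 * (1 / c\<^sup>2) * ((a / c - b / c)\<^sup>2 / ((1 + (a / c)\<^sup>2) * (1 + (b / c)\<^sup>2)))"
    by (simp add: power_divide)
  also have "(a / c - b / c)\<^sup>2 = (a - b)\<^sup>2 / c\<^sup>2"
    by (simp add: power_divide flip: diff_divide_distrib)
  also have "1 + (a / c)\<^sup>2 = (c\<^sup>2 + a\<^sup>2) / c\<^sup>2"
    using c0 by (simp add: field_simps)
  also have "1 + (b / c)\<^sup>2 = (c\<^sup>2 + b\<^sup>2) / c\<^sup>2"
    using c0 by (simp add: field_simps)
  also have "2 * (1 / c\<^sup>2) * ((a - b)\<^sup>2 / c\<^sup>2 / ((c\<^sup>2 + a\<^sup>2) / c\<^sup>2 * ((c\<^sup>2 + b\<^sup>2) / c\<^sup>2)))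
     = 2 * (a - b)\<^sup>2 / ((c\<^sup>2 + a\<^sup>2) * (c\<^sup>2 + b\<^sup>2))"
  proof -
    have "2 * (1 / C) * (d / C / ((C + p) / C * ((C + q) / C))) = 2 * d / ((C + p) * (C + q))"
      if "0 < C" for C d p q :: real
      using that by (simp add: divide_simps)
    then show ?thesis using c0 by simp
  qed
  also have "\<dots> = 2 * (norm (u - v))\<^sup>2 / ((1 + (norm u)\<^sup>2) * (1 + (norm v)\<^sup>2))"
    using y by (simp add: norm_square_plane[OF ij] c2 a_def b_def add_ac)
  finally show ?thesis
    by (simp add: inner_stereo[OF s] A_def B_def a_def b_def)
qed

lemma abs_legendre_poly_le_1:
  assumes "\<bar>t\<bar> \<le> 1"
  shows "\<bar>poly (legendre_poly l) t\<bar> \<le> 1"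
proof -
  define p where "p = sqrt (1 - t\<^sup>2)"
  have t2: "t\<^sup>2 \<le> 1" using assms by (simp add: abs_square_le_1)
  then have unit: "t\<^sup>2 + p\<^sup>2 + 0\<^sup>2 = 1" by (simp add: p_def)
  define f where "f = (\<lambda>j. of_real t + \<i> * of_real (p * cos (2 * pi * real j / real (Suc l)) + 0 * sin (2 * pi * real j / real (Suc l))))"
  have f: "norm (f j) \<le> 1" for j
  proof -
    have "f j = Complex t (p * cos (2 * pi * real j / real (Suc l)))"
      by (simp add: f_def complex_eq_iff)
    moreover have "t\<^sup>2 + (p * cos (2 * pi * real j / real (Suc l)))\<^sup>2 \<le> t\<^sup>2 + p\<^sup>2 * 1"
      unfolding power_mult_distrib by (intro add_left_mono mult_left_mono) (auto simp: abs_square_le_1)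
    ultimately show ?thesis using unit by (simp add: complex_norm)
  qed
  have "norm (complex_of_real (poly (legendre_poly l) t)) = norm (\<Sum>j<Suc l. f j ^ l) / real (Suc l)"
    using discrete_laplace_formula[of l "Suc l" t p 0] unit
    by (simp add: f_def norm_divide del: of_nat_Suc)
  also have "\<dots> \<le> (\<Sum>j<Suc l. 1) / real (Suc l)"
    by (intro divide_right_mono sum_norm_le) (auto simp: norm_power f intro: power_le_one)
  also have "\<dots> = 1" by simp
  finally show ?thesis by simp
qed

text \<open>Averaging \<open>circle_kernel_differences\<close> over the nodes of Laplace's formula. The constant depends
  neither on the line nor on the position on it.\<close>

lemma legendre_stereo_differences:
  fixes u :: "real^2" and i :: 2
  assumes s: "s \<in> {1, -1}" and l: "l \<ge> 1" and h: "0 \<le> h"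
  defines "x \<equiv> \<lambda>k. stereo s (u + (real k * h) *\<^sub>R axis i 1)"
  shows "\<bar>\<Sum>k\<le>m. \<Sum>k'\<le>m. binom_sign m k * binom_sign m k' * poly (legendre_poly l) (x k \<bullet> x k')\<bar>
    \<le> exp 9 * (6 * real (Suc m) * real l * h) ^ (2 * m)" (is "\<bar>?L\<bar> \<le> ?R")
proof -
  obtain j :: 2 where ij: "i \<noteq> j" using exhaust_2 by (metis zero_neq_one)
  define y where "y = u $ j"
  define c where "c = sqrt (1 + y\<^sup>2)"
  define \<kappa> \<eta> where "\<kappa> = 1 / c" and "\<eta> = y / c"
  have c1: "c \<ge> 1" by (simp add: c_def)
  have "1 + y\<^sup>2 > 0" by (simp add: add_pos_nonneg)
  then have unit: "\<kappa>\<^sup>2 + \<eta>\<^sup>2 = 1"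
    by (simp add: \<kappa>_def \<eta>_def c_def power_divide flip: add_divide_distrib)
  define a where "a k = u $ i + real k * h" for k
  define \<delta> where "\<delta> k k' = 2 * arctan (a k / c) - 2 * arctan (a k' / c)" for k k'
  define N where "N = Suc l"
  define \<phi> where "\<phi> q = 2 * pi * real q / real N" for q
  let ?K = "\<lambda>q k k'. circle_kernel c \<kappa> \<eta> (\<phi> q) l (of_real (a k)) (of_real (a k'))"
  have x: "x k \<bullet> x k' = 1 - \<kappa>\<^sup>2 * (1 - cos (\<delta> k k'))" for k k'
  proof -
    have "x k \<bullet> x k' = 1 - (1 / sqrt (1 + y\<^sup>2))\<^sup>2 * (1 - cos (2 * arctan ((u + (real k * h) *\<^sub>R axis i 1) $ i / sqrt (1 + y\<^sup>2))
       - 2 * arctan ((u + (real k' * h) *\<^sub>R axis i 1) $ i / sqrt (1 + y\<^sup>2))))"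
      unfolding x_def using ij by (intro inner_stereo_on_line[OF s ij]) (auto simp: y_def axis_def)
    then show ?thesis
      by (simp add: \<kappa>_def c_def \<delta>_def a_def axis_def)
  qed
  have P: "complex_of_real (poly (legendre_poly l) (x k \<bullet> x k')) = (\<Sum>q<N. ?K q k k') / of_nat N" for k k'
  proof -
    have "(of_real (1 - \<kappa>\<^sup>2 * (1 - cos (\<delta> k k'))) + \<i> * of_real (\<kappa> * sin (\<delta> k k') * cos (\<phi> q)
        + \<eta> * \<kappa> * (1 - cos (\<delta> k k')) * sin (\<phi> q))) = circle_base \<kappa> \<eta> (\<phi> q) (of_real (\<delta> k k'))" for q
      by (simp add: circle_base_def sin_of_real cos_of_real algebra_simps)
    moreover have "stereo_angle c (of_real (a k)) - stereo_angle c (of_real (a k')) = of_real (\<delta> k k')"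
      by (simp add: stereo_angle_real \<delta>_def)
    ultimately show ?thesis
      unfolding x by (subst discrete_laplace_formula[OF _ circle_unit[OF unit, of "\<delta> k k'"], of _ N])
        (simp_all add: N_def \<phi>_def)
  qed
  have "complex_of_real ?L = (\<Sum>k\<le>m. \<Sum>k'\<le>m. \<Sum>q<N. of_real (binom_sign m k * binom_sign m k') * ?K q k k') / of_nat N"
    by (simp add: P sum_divide_distrib sum_distrib_left)
  also have "\<dots> = (\<Sum>q<N. \<Sum>k\<le>m. \<Sum>k'\<le>m. of_real (binom_sign m k * binom_sign m k') * ?K q k k') / of_nat N"
    by (subst (2) sum.swap, subst sum.swap) (rule refl)
  finally have "norm (complex_of_real ?L)
     = norm (\<Sum>q<N. \<Sum>k\<le>m. \<Sum>k'\<le>m. of_real (binom_sign m k * binom_sign m k') * ?K q k k') / real N"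
    by (simp add: norm_divide)
  also have "\<dots> \<le> (\<Sum>q<N. ?R) / real N"
    unfolding a_def by (intro divide_right_mono sum_norm_le circle_kernel_differences unit c1 l h) auto
  also have "\<dots> = ?R" by (simp add: N_def)
  finally show ?thesis by (simp only: norm_of_real)
qed

lemma sum_binom_sign: "m \<ge> 1 \<Longrightarrow> (\<Sum>k\<le>m. binom_sign m k) = 0"
proof -
  assume "m \<ge> 1"
  then obtain n where m: "m = Suc n" by (cases m) auto
  have zero: "(fdiff (0::real) ^^ n) (\<lambda>_. 0 :: real) = (\<lambda>_. 0)" for n
    by (induction n) (simp_all add: fdiff_def)
  have "(\<Sum>k\<le>m. binom_sign m k) = (fdiff (0::real) ^^ m) (\<lambda>_. 1 :: real) 0"
    unfolding fdiff_power_eq_sum by (simp add: binom_sign_def)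
  also have "\<dots> = 0"
    unfolding m funpow_Suc_right by (simp add: zero fdiff_def)
  finally show ?thesis .
qed

lemma sum_abs_binom_sign: "(\<Sum>k\<le>m. \<bar>binom_sign m k\<bar>) = 2 ^ m"
  by (simp add: binom_sign_def abs_mult power_abs choose_row_sum flip: of_nat_sum)

lemma legendre_poly_0: "legendre_poly 0 = 1"
  by (simp add: legendre_poly_def)

text \<open>A single degree \<open>l\<close> contributes to the variance of a difference at most a multiple of \<open>min 1 ((l h)\<^sup>2\<^sup>m)\<close>, and
  \<open>min 1 ((l h)\<^sup>2\<^sup>m) \<le> (l h) powr \<beta>\<close> because \<open>0 < \<beta> \<le> 2 m\<close>. The factor \<open>2 l + 1\<close> supplies the
  remaining power of \<open>l\<close>.\<close>

lemma spectral_difference_bound: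
  fixes u :: "real^2" and i :: 2
  assumes s: "s \<in> {1, -1}" and h: "0 < h" and m: "m \<ge> 1" "\<beta> \<le> 2 * real m" and \<beta>: "0 < \<beta>" and A: "0 \<le> A"
  defines "x \<equiv> \<lambda>k. stereo s (u + (real k * h) *\<^sub>R axis i 1)"
  shows "\<bar>A * ((2 * real l + 1) / (4 * pi)) *
      (\<Sum>k\<le>m. \<Sum>k'\<le>m. binom_sign m k * binom_sign m k' * poly (legendre_poly l) (x k \<bullet> x k'))\<bar>
    \<le> (exp 9 * (6 * real (Suc m)) ^ (2 * m) + 4 ^ m) * h powr \<beta> * (A * real l powr (1 + \<beta>))"
   (is "\<bar>_ * ?D\<bar> \<le> ?C * _ * _")
proof (cases "l = 0")
  case True
  \<comment> \<open>differences annihilate the constant \<open>P\<^sub>0\<close>\<close>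
  have "?D = (\<Sum>k\<le>m. binom_sign m k) * (\<Sum>k'\<le>m. binom_sign m k')"
    using True by (simp add: legendre_poly_0 sum_product)
  then show ?thesis using m A by (simp add: sum_binom_sign)
next
  case False
  then have l: "l \<ge> 1" by simp
  have x: "\<bar>x k \<bullet> x k'\<bar> \<le> 1" for k k'
    using Cauchy_Schwarz_ineq2[of "x k" "x k'"] stereo_in_sphere[OF s] by (simp add: x_def)
  have D1: "\<bar>?D\<bar> \<le> 4 ^ m"
  proof -
    have "\<bar>?D\<bar> \<le> (\<Sum>k\<le>m. \<Sum>k'\<le>m. \<bar>binom_sign m k\<bar> * \<bar>binom_sign m k'\<bar> * 1)"
      by (intro order_trans[OF sum_abs] sum_mono)
        (simp add: abs_mult mult_left_le abs_legendre_poly_le_1[OF x])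
    also have "\<dots> = 4 ^ m"
      by (simp add: sum_product[symmetric] sum_abs_binom_sign flip: power_mult_distrib)
    finally show ?thesis .
  qed
  have D2: "\<bar>?D\<bar> \<le> exp 9 * (6 * real (Suc m)) ^ (2 * m) * (real l * h) ^ (2 * m)"
    using legendre_stereo_differences[OF s l, of h m u i] h
    by (simp add: x_def power_mult_distrib mult_ac)
  have lh: "0 < real l * h" using l h by simp
  have "\<bar>?D\<bar> \<le> ?C * (real l * h) powr \<beta>"
  proof (cases "real l * h \<le> 1")
    case True
    have "(real l * h) ^ (2 * m) = (real l * h) powr (2 * real m)"
      using lh powr_realpow[OF lh, of "2 * m"] by simp
    also have "\<dots> \<le> (real l * h) powr \<beta>"
      using True lh m by (intro powr_mono') auto
    finally have "exp 9 * (6 * real (Suc m)) ^ (2 * m) * (real l * h) ^ (2 * m)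
        \<le> exp 9 * (6 * real (Suc m)) ^ (2 * m) * (real l * h) powr \<beta>"
      by (intro mult_left_mono) auto
    also have "\<dots> \<le> ?C * (real l * h) powr \<beta>" by (intro mult_right_mono) auto
    finally show ?thesis using D2 by linarith
  next
    case False
    then have "1 \<le> (real l * h) powr \<beta>" using \<beta> by (intro ge_one_powr_ge_zero) auto
    then have "4 ^ m * 1 \<le> 4 ^ m * (real l * h) powr \<beta>" by (intro mult_left_mono) auto
    also have "\<dots> \<le> ?C * (real l * h) powr \<beta>" by (intro mult_right_mono) auto
    finally show ?thesis using D1 by linarith
  qed
  also have "\<dots> = ?C * h powr \<beta> * real l powr \<beta>"
    using h by (simp add: powr_mult)
  finally have D: "\<bar>?D\<bar> \<le> ?C * h powr \<beta> * real l powr \<beta>" .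
  have w: "(2 * real l + 1) / (4 * pi) \<le> real l"
  proof -
    have "2 * real l + 1 \<le> 3 * real l" using l by simp
    also have "\<dots> \<le> real l * (4 * pi)" using pi_gt3 l by (simp add: mult_mono)
    finally show ?thesis by (simp add: divide_le_eq)
  qed
  have "\<bar>A * ((2 * real l + 1) / (4 * pi)) * ?D\<bar> = A * ((2 * real l + 1) / (4 * pi)) * \<bar>?D\<bar>"
    using A by (simp add: abs_mult)
  also have "\<dots> \<le> A * real l * (?C * h powr \<beta> * real l powr \<beta>)"
    using A w D by (intro mult_mono mult_left_mono) auto
  also have "\<dots> = ?C * h powr \<beta> * (A * real l powr (1 + \<beta>))"
    using l by (simp add: powr_add)
  finally show ?thesis .
qed

section \<open>Hoelder classes in the plane\<close>

text \<open>The analogue in the plane of \<open>hoelder_space_sphere\<close> with the order of differentiation \<open>k\<close> and the exponent \<open>a\<close> kept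
  separate, as needed for inductions on \<open>k\<close>.\<close>

definition holder_Ck :: "nat \<Rightarrow> real \<Rightarrow> (real^2 \<Rightarrow> real) \<Rightarrow> bool" where
  "holder_Ck k a g \<longleftrightarrow> Ck_plane k g \<and> (\<forall>js. length js = k \<longrightarrow> locally_hoelder a (iter_partial js g))"

lemma iter_partial_append: "iter_partial (js @ is) g = iter_partial js (iter_partial is g)"
  by (induction js) auto

lemma has_derivative_imp_partial:
  "(g has_derivative g') (at u) \<Longrightarrow> iter_partial [i] g u = g' (axis i 1)"
  using frechet_derivative_at[of g g' u] by simp

lemma linear_axis_sum:
  fixes f :: "real^2 \<Rightarrow> real"
  assumes "linear f"
  shows "f h = (\<Sum>i\<in>UNIV. h $ i * f (axis i 1))"
proof -
  have "f h = f (\<Sum>i\<in>UNIV. (h $ i) *\<^sub>R axis i 1)"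
    using basis_expansion[of h] by (simp add: scalar_mult_eq_scaleR)
  then show ?thesis
    using assms by (simp add: linear_sum linear_cmul)
qed

lemma has_derivative_partials:
  assumes "g differentiable (at u)"
  shows "(g has_derivative (\<lambda>h. \<Sum>i\<in>UNIV. h $ i * iter_partial [i] g u)) (at u)"
proof -
  have d: "(g has_derivative frechet_derivative g (at u)) (at u)"
    using assms frechet_derivative_works by blast
  have "frechet_derivative g (at u) = (\<lambda>h. \<Sum>i\<in>UNIV. h $ i * iter_partial [i] g u)"
  proof
    fix h
    show "frechet_derivative g (at u) h = (\<Sum>i\<in>UNIV. h $ i * iter_partial [i] g u)"
      using linear_axis_sum[OF has_derivative_linear[OF d], of h] by simp
  qed
  with d show ?thesis by metis
qed

lemma Ck_plane_0: "Ck_plane 0 g \<longleftrightarrow> continuous_on UNIV g"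
  by (simp add: Ck_plane_def)

text \<open>Peeling off the innermost derivative (the last entry of the list) reduces statements about \<open>C\<^sup>k\<^sup>+\<^sup>1\<close>
  functions to their first partial derivatives.\<close>

lemma Ck_plane_Suc:
  "Ck_plane (Suc k) g \<longleftrightarrow> (\<forall>u. g differentiable (at u)) \<and> (\<forall>i. Ck_plane k (iter_partial [i] g))"
    (is "?L \<longleftrightarrow> ?R")
proof
  assume L: ?L
  show ?R
  proof (intro conjI allI)
    fix u show "g differentiable at u"
      using L unfolding Ck_plane_def by (metis iter_partial.simps(1) length_0_conv zero_less_Suc list.size(3))
  next
    fix i
    show "Ck_plane k (iter_partial [i] g)"
      using L unfolding Ck_plane_def iter_partial_append[symmetric] by auto
  qed
next
  assume R: ?R
  show ?L
    unfolding Ck_plane_def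
  proof (intro conjI allI impI)
    fix js :: "2 list" and u assume "length js < Suc k"
    then show "iter_partial js g differentiable at u"
      using R by (cases js rule: rev_cases) (auto simp: iter_partial_append Ck_plane_def simp del: iter_partial.simps(2))
  next
    fix js :: "2 list" assume len: "length js \<le> Suc k"
    show "continuous_on UNIV (iter_partial js g)"
    proof (cases js rule: rev_cases)
      case Nil
      then show ?thesis
        using R by (auto intro!: differentiable_imp_continuous_on simp: differentiable_on_def)
    next
      case (snoc js' i)
      then show ?thesis
        using R len by (auto simp: iter_partial_append Ck_plane_def simp del: iter_partial.simps(2))
    qed
  qed
qed

lemma Ck_plane_imp_continuous: "Ck_plane k g \<Longrightarrow> continuous_on UNIV g"
  unfolding Ck_plane_def by (metis iter_partial.simps(1) le0 list.size(3))

lemma Ck_plane_iter_partial: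
  "Ck_plane (k + n) g \<Longrightarrow> length js = n \<Longrightarrow> Ck_plane k (iter_partial js g)"
  unfolding Ck_plane_def iter_partial_append[symmetric] by auto

lemma holder_Ck_0: "holder_Ck 0 a g \<longleftrightarrow> continuous_on UNIV g \<and> locally_hoelder a g"
  by (simp add: holder_Ck_def Ck_plane_0)

lemma holder_Ck_Suc:
  "holder_Ck (Suc k) a g \<longleftrightarrow> (\<forall>u. g differentiable (at u)) \<and> (\<forall>i. holder_Ck k a (iter_partial [i] g))"
proof -
  have "(\<forall>js. length js = Suc k \<longrightarrow> locally_hoelder a (iter_partial js g))
    \<longleftrightarrow> (\<forall>i js. length js = k \<longrightarrow> locally_hoelder a (iter_partial js (iter_partial [i] g)))" (is "?L \<longleftrightarrow> ?R")
  proof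
    assume ?R
    show ?L
    proof (intro allI impI)
      fix js :: "2 list" assume "length js = Suc k"
      then show "locally_hoelder a (iter_partial js g)"
        using \<open>?R\<close> by (cases js rule: rev_cases) (auto simp: iter_partial_append simp del: iter_partial.simps(2))
    qed
  qed (auto simp: iter_partial_append[symmetric] simp del: iter_partial.simps(2))
  then show ?thesis
    unfolding holder_Ck_def Ck_plane_Suc by blast
qed

lemma lipschitz_imp_powr_bound:
  fixes d a L D :: real
  assumes "0 \<le> d" "d \<le> D" "0 \<le> a" "a \<le> 1" "0 \<le> L" "1 \<le> D" "0 < d"
  shows "L * d \<le> (L * D) * d powr a"
proof (cases "d \<le> 1")
  case True
  have "d = d powr 1" using assms by simp
  also have "\<dots> \<le> d powr a" using assms True by (intro powr_mono') auto
  also have "\<dots> \<le> D * d powr a" using assms by simp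
  finally show ?thesis using assms by (simp add: mult_left_mono mult.assoc)
next
  case False
  have "1 \<le> d powr a" using False assms by (intro ge_one_powr_ge_zero) auto
  then have "d * 1 \<le> D * d powr a" using assms by (intro mult_mono) auto
  then show ?thesis using assms by (simp add: mult_left_mono mult.assoc)
qed

lemma locally_hoelder_of_lipschitz:
  assumes "\<And>r. 0 < r \<Longrightarrow> \<exists>L. \<forall>u\<in>cball 0 r. \<forall>v\<in>cball 0 r. \<bar>g u - g v\<bar> \<le> L * dist u v" and a: "0 \<le> a" "a \<le> 1"
  shows "locally_hoelder a g"
  unfolding locally_hoelder_def
proof
  fix r :: real
  define R where "R = max r 1"
  have "0 < R" by (simp add: R_def)
  then obtain L where L: "\<forall>u\<in>cball 0 R. \<forall>v\<in>cball 0 R. \<bar>g u - g v\<bar> \<le> L * dist u v"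
    using assms(1) by blast
  have "\<bar>g u - g v\<bar> \<le> (\<bar>L\<bar> * (2 * R)) * dist u v powr a" if "u \<in> cball 0 r" "v \<in> cball 0 r" for u v
  proof (cases "u = v")
    case False
    have uv: "norm u \<le> R" "norm v \<le> R" using that by (auto simp: R_def)
    have d: "dist u v \<le> 2 * R"
      using uv norm_triangle_ineq4[of u v] by (simp add: dist_norm)
    have "\<bar>g u - g v\<bar> \<le> L * dist u v" using uv L by auto
    also have "\<dots> \<le> \<bar>L\<bar> * dist u v" by (intro mult_right_mono) auto
    also have "\<dots> \<le> (\<bar>L\<bar> * (2 * R)) * dist u v powr a"
      using False d a by (intro lipschitz_imp_powr_bound) (auto simp: R_def)
    finally show ?thesis .
  qed simp
  then show "\<exists>C. \<forall>u\<in>cball 0 r. \<forall>v\<in>cball 0 r. \<bar>g u - g v\<bar> \<le> C * dist u v powr a"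
    by blast
qed

lemma partials_bound_imp_lipschitz:
  fixes g :: "real^2 \<Rightarrow> real"
  assumes "convex S" "\<And>u. u \<in> S \<Longrightarrow> g differentiable (at u)"
    and b: "\<And>u i. u \<in> S \<Longrightarrow> \<bar>iter_partial [i] g u\<bar> \<le> B" and uv: "u \<in> S" "v \<in> S"
  shows "\<bar>g u - g v\<bar> \<le> 2 * B * dist u v"
proof -
  have "norm (g u - g v) \<le> (2 * B) * norm (u - v)"
  proof (rule differentiable_bound[OF \<open>convex S\<close> _ _ uv])
    fix x assume x: "x \<in> S"
    show "(g has_derivative (\<lambda>h. \<Sum>i\<in>UNIV. h $ i * iter_partial [i] g x)) (at x within S)"
      using assms(2)[OF x] has_derivative_partials has_derivative_at_withinI by blast
    show "onorm (\<lambda>h. \<Sum>i\<in>UNIV. h $ i * iter_partial [i] g x) \<le> 2 * B"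
    proof (rule onorm_le)
      fix h :: "real^2"
      have "norm (\<Sum>i\<in>UNIV. h $ i * iter_partial [i] g x) \<le> (\<Sum>i\<in>(UNIV::2 set). norm h * B)"
        using b[OF x] component_le_norm_cart[of h]
        by (intro sum_norm_le) (auto simp: abs_mult intro!: mult_mono simp del: iter_partial.simps(2))
      then show "norm (\<Sum>i\<in>UNIV. h $ i * iter_partial [i] g x) \<le> 2 * B * norm h"
        by (simp add: mult_ac del: iter_partial.simps(2))
    qed
  qed
  then show ?thesis by (simp add: dist_norm)
qed

text \<open>On a ball the gradient is bounded, so the function is Lipschitz there, and on a bounded set a Lipschitz bound
  implies every Hoelder bound with exponent in \<open>[0, 1]\<close>.\<close>

lemma locally_hoelder_of_C1:
  assumes "Ck_plane (Suc 0) g" and a: "0 \<le> a" "a \<le> 1"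
  shows "locally_hoelder a g"
proof (rule locally_hoelder_of_lipschitz[OF _ a])
  fix r :: real assume "0 < r"
  have C: "\<And>u. g differentiable (at u)" "\<And>i. continuous_on UNIV (iter_partial [i] g)"
    using assms(1) by (simp_all add: Ck_plane_Suc Ck_plane_0 del: iter_partial.simps(2))
  have "\<exists>B. \<forall>u\<in>cball 0 r. \<bar>iter_partial [i] g u\<bar> \<le> B" for i
  proof -
    have "bounded (iter_partial [i] g ` cball 0 r)"
      by (intro compact_imp_bounded compact_continuous_image continuous_on_subset[OF C(2)]) auto
    then show ?thesis
      unfolding bounded_iff by (auto simp del: iter_partial.simps(2))
  qed
  then obtain B where B: "\<And>i u. u \<in> cball 0 r \<Longrightarrow> \<bar>iter_partial [i] g u\<bar> \<le> B i"
    by metis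
  have "\<bar>iter_partial [i] g u\<bar> \<le> max (B 1) (B 2)" if "u \<in> cball 0 r" for i u
    using B[OF that, of i] exhaust_2[of i] by (auto simp del: iter_partial.simps(2))
  then have "\<forall>u\<in>cball 0 r. \<forall>v\<in>cball 0 r. \<bar>g u - g v\<bar> \<le> 2 * max (B 1) (B 2) * dist u v"
    using C(1) by (intro ballI partials_bound_imp_lipschitz[of "cball 0 r"]) auto
  then show "\<exists>L. \<forall>u\<in>cball 0 r. \<forall>v\<in>cball 0 r. \<bar>g u - g v\<bar> \<le> L * dist u v" by blast
qed

lemma holder_Ck_SucD:
  assumes a: "0 \<le> a" "a \<le> 1"
  shows "holder_Ck (Suc k) a g \<Longrightarrow> holder_Ck k a g"
proof (induction k arbitrary: g)
  case 0
  have C: "Ck_plane (Suc 0) g" using 0 by (simp add: holder_Ck_def)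
  then show ?case
    using locally_hoelder_of_C1[OF C a] Ck_plane_imp_continuous[OF C] by (simp add: holder_Ck_0)
next
  case (Suc k)
  then show ?case by (subst (asm) holder_Ck_Suc, subst holder_Ck_Suc) blast
qed

lemma continuous_bounded_cball:
  fixes g :: "real^2 \<Rightarrow> real"
  assumes "continuous_on UNIV g"
  obtains B where "0 \<le> B" "\<And>u. u \<in> cball 0 r \<Longrightarrow> \<bar>g u\<bar> \<le> B"
proof -
  have "bounded (g ` cball 0 r)"
    by (intro compact_imp_bounded compact_continuous_image continuous_on_subset[OF assms]) auto
  then obtain B where "\<forall>u\<in>cball 0 r. \<bar>g u\<bar> \<le> B"
    unfolding bounded_iff by auto
  then show ?thesis by (intro that[of "\<bar>B\<bar>"]) force+
qed

lemma locally_hoelder_add: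
  assumes "locally_hoelder a f" "locally_hoelder a g"
  shows "locally_hoelder a (\<lambda>u. f u + g u)"
  unfolding locally_hoelder_def
proof
  fix r
  obtain C D where C: "\<forall>u\<in>cball 0 r. \<forall>v\<in>cball 0 r. \<bar>f u - f v\<bar> \<le> C * dist u v powr a"
    and D: "\<forall>u\<in>cball 0 r. \<forall>v\<in>cball 0 r. \<bar>g u - g v\<bar> \<le> D * dist u v powr a"
    using assms unfolding locally_hoelder_def by meson
  have "\<bar>f u + g u - (f v + g v)\<bar> \<le> (C + D) * dist u v powr a" if "u\<in>cball 0 r" "v \<in> cball 0 r" for u v
    using C[rule_format, OF that] D[rule_format, OF that] by (simp add: distrib_right)
  then show "\<exists>C. \<forall>u\<in>cball 0 r. \<forall>v\<in>cball 0 r. \<bar>f u + g u - (f v + g v)\<bar> \<le> C * dist u v powr a"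
    by blast
qed

lemma locally_hoelder_mult:
  assumes "locally_hoelder a f" "locally_hoelder a g" "continuous_on UNIV f" "continuous_on UNIV g"
  shows "locally_hoelder a (\<lambda>u. f u * g u)"
  unfolding locally_hoelder_def
proof
  fix r
  obtain C D where C: "\<forall>u\<in>cball 0 r. \<forall>v\<in>cball 0 r. \<bar>f u - f v\<bar> \<le> C * dist u v powr a"
    and D: "\<forall>u\<in>cball 0 r. \<forall>v\<in>cball 0 r. \<bar>g u - g v\<bar> \<le> D * dist u v powr a"
    using assms unfolding locally_hoelder_def by meson
  obtain F where F: "0 \<le> F" "\<And>u. u \<in> cball 0 r \<Longrightarrow> \<bar>f u\<bar> \<le> F"
    using continuous_bounded_cball[OF assms(3)] by metis
  obtain G where G: "0 \<le> G" "\<And>u. u \<in> cball 0 r \<Longrightarrow> \<bar>g u\<bar> \<le> G"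
    using continuous_bounded_cball[OF assms(4)] by metis
  have "\<bar>f u * g u - f v * g v\<bar> \<le> (F * D + C * G) * dist u v powr a" if uv: "u\<in>cball 0 r" "v \<in> cball 0 r" for u v
  proof -
    have "f u * g u - f v * g v = f u * (g u - g v) + (f u - f v) * g v" by (simp add: algebra_simps)
    then have "\<bar>f u * g u - f v * g v\<bar> \<le> \<bar>f u\<bar> * \<bar>g u - g v\<bar> + \<bar>f u - f v\<bar> * \<bar>g v\<bar>"
      by (metis abs_mult abs_triangle_ineq)
    also have "\<dots> \<le> F * (D * dist u v powr a) + (C * dist u v powr a) * G"
      using F G C[rule_format, OF uv] D[rule_format, OF uv] uv
      by (intro add_mono mult_mono) (auto intro: order_trans[OF abs_ge_zero])
    finally show ?thesis by (simp add: algebra_simps)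
  qed
  then show "\<exists>C. \<forall>u\<in>cball 0 r. \<forall>v\<in>cball 0 r. \<bar>f u * g u - f v * g v\<bar> \<le> C * dist u v powr a"
    by blast
qed

lemma locally_hoelder_exp:
  assumes "locally_hoelder a f" "continuous_on UNIV f"
  shows "locally_hoelder a (\<lambda>u. exp (f u))"
  unfolding locally_hoelder_def
proof
  fix r
  obtain C where C: "\<forall>u\<in>cball 0 r. \<forall>v\<in>cball 0 r. \<bar>f u - f v\<bar> \<le> C * dist u v powr a"
    using assms unfolding locally_hoelder_def by meson
  obtain F where F: "0 \<le> F" "\<And>u. u \<in> cball 0 r \<Longrightarrow> \<bar>f u\<bar> \<le> F"
    using continuous_bounded_cball[OF assms(2)] by metis
  have lip: "\<bar>exp x - exp y\<bar> \<le> exp F * \<bar>x - y\<bar>" if "\<bar>x\<bar> \<le> F" "\<bar>y\<bar> \<le> F" for x y :: real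
  proof -
    have "norm (exp x - exp y) \<le> exp F * norm (x - y)"
      by (rule field_differentiable_bound[of "{-F..F}" _ exp])
        (use that in \<open>auto intro!: derivative_eq_intros\<close>)
    then show ?thesis by simp
  qed
  have "\<bar>exp (f u) - exp (f v)\<bar> \<le> (exp F * C) * dist u v powr a" if uv: "u\<in>cball 0 r" "v \<in> cball 0 r" for u v
  proof -
    have "\<bar>exp (f u) - exp (f v)\<bar> \<le> exp F * \<bar>f u - f v\<bar>" by (intro lip F uv)
    also have "\<dots> \<le> exp F * (C * dist u v powr a)" using C uv by (intro mult_left_mono) auto
    finally show ?thesis by (simp add: mult.assoc)
  qed
  then show "\<exists>C. \<forall>u\<in>cball 0 r. \<forall>v\<in>cball 0 r. \<bar>exp (f u) - exp (f v)\<bar> \<le> C * dist u v powr a"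
    by blast
qed

lemma holder_Ck_add:
  "holder_Ck k a f \<Longrightarrow> holder_Ck k a g \<Longrightarrow> holder_Ck k a (\<lambda>u. f u + g u)"
proof (induction k arbitrary: f g)
  case 0
  then show ?case by (auto simp: holder_Ck_0 intro!: continuous_intros locally_hoelder_add)
next
  case (Suc k)
  have d: "f differentiable at u" "g differentiable at u" for u
    using Suc.prems by (auto simp: holder_Ck_Suc)
  have "iter_partial [i] (\<lambda>u. f u + g u) = (\<lambda>u. iter_partial [i] f u + iter_partial [i] g u)" for i
    by (rule ext, subst has_derivative_imp_partial[OF has_derivative_add[OF d[THEN frechet_derivative_works[THEN iffD1]]]]) simp
  then show ?case
    using Suc d unfolding holder_Ck_Suc by auto
qed

text \<open>Induction by the product rule; the factors that are not differentiated are covered since the classes decrease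
  in \<open>k\<close>.\<close>

lemma holder_Ck_mult:
  assumes a: "0 \<le> a" "a \<le> 1"
  shows "holder_Ck k a f \<Longrightarrow> holder_Ck k a g \<Longrightarrow> holder_Ck k a (\<lambda>u. f u * g u)"
proof (induction k arbitrary: f g)
  case 0
  then show ?case by (auto simp: holder_Ck_0 intro!: continuous_intros locally_hoelder_mult)
next
  case (Suc k)
  have d: "f differentiable at u" "g differentiable at u" for u
    using Suc.prems by (auto simp: holder_Ck_Suc)
  have "iter_partial [i] (\<lambda>u. f u * g u) = (\<lambda>u. f u * iter_partial [i] g u + iter_partial [i] f u * g u)" for i
    by (rule ext, subst has_derivative_imp_partial[OF has_derivative_mult[OF d[THEN frechet_derivative_works[THEN iffD1]]]]) simp
  moreover have "holder_Ck k a f" "holder_Ck k a g"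
    using Suc.prems holder_Ck_SucD[OF a] by blast+
  ultimately show ?case
    using Suc d unfolding holder_Ck_Suc by (auto intro!: holder_Ck_add simp del: iter_partial.simps(2))
qed

lemma holder_Ck_exp:
  assumes a: "0 \<le> a" "a \<le> 1"
  shows "holder_Ck k a f \<Longrightarrow> holder_Ck k a (\<lambda>u. exp (f u))"
proof (induction k arbitrary: f)
  case 0
  then show ?case by (auto simp: holder_Ck_0 intro!: continuous_intros locally_hoelder_exp)
next
  case (Suc k)
  have d: "f differentiable at u" for u
    using Suc.prems by (auto simp: holder_Ck_Suc)
  have dexp: "((\<lambda>u. exp (f u)) has_derivative (\<lambda>h. exp (f u) * frechet_derivative f (at u) h)) (at u)" for u
    using d[THEN frechet_derivative_works[THEN iffD1]] by (auto intro!: derivative_eq_intros)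
  then have "iter_partial [i] (\<lambda>u. exp (f u)) = (\<lambda>u. exp (f u) * iter_partial [i] f u)" for i
    by (intro ext, subst has_derivative_imp_partial[OF dexp]) simp
  moreover have "holder_Ck k a f"
    using Suc.prems holder_Ck_SucD[OF a] by blast
  ultimately show ?case
    using Suc dexp unfolding holder_Ck_Suc
    by (auto intro!: holder_Ck_mult[OF a] simp: differentiable_def simp del: iter_partial.simps(2))
qed

lemma holder_Ck_const: "holder_Ck k a (\<lambda>_. c)"
proof (induction k arbitrary: c)
  case 0
  then show ?case by (auto simp: holder_Ck_0 locally_hoelder_def intro!: exI[of _ 0])
next
  case (Suc k)
  have "iter_partial [i] (\<lambda>_. c) = (\<lambda>_. 0)" for i
    by (rule ext, subst has_derivative_imp_partial[OF has_derivative_const]) simp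
  then show ?case using Suc by (simp add: holder_Ck_Suc del: iter_partial.simps(2))
qed

section \<open>Limits of multiscale approximations\<close>

lemma geometric_increments_tail:
  fixes x :: "nat \<Rightarrow> real"
  assumes inc: "\<And>n. n \<ge> N \<Longrightarrow> \<bar>x (Suc n) - x n\<bar> \<le> C * q ^ n"
    and q: "0 \<le> q" "q < 1" and C: "0 \<le> C" and lim: "x \<longlonglongrightarrow> L" and n: "n \<ge> N"
  shows "\<bar>x n - L\<bar> \<le> C * q ^ n / (1 - q)"
proof -
  have *: "\<bar>x (n + j) - x n\<bar> \<le> C * q ^ n * (\<Sum>i<j. q ^ i)" for j
  proof (induction j)
    case (Suc j)
    have "\<bar>x (n + Suc j) - x n\<bar> \<le> \<bar>x (Suc (n + j)) - x (n + j)\<bar> + \<bar>x (n + j) - x n\<bar>"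
      by simp
    also have "\<dots> \<le> C * q ^ (n + j) + C * q ^ n * (\<Sum>i<j. q ^ i)"
      using Suc n by (intro add_mono inc) auto
    finally show ?case by (simp add: power_add algebra_simps)
  qed simp
  have "\<bar>x (n + j) - x n\<bar> \<le> C * q ^ n / (1 - q)" for j
  proof -
    have "(\<Sum>i<j. q ^ i) \<le> 1 / (1 - q)"
      using q by (simp add: sum_gp_strict divide_right_mono)
    then have "C * q ^ n * (\<Sum>i<j. q ^ i) \<le> C * q ^ n * (1 / (1 - q))"
      using C q by (intro mult_left_mono) auto
    then show ?thesis using *[of j] by simp
  qed
  moreover have "(\<lambda>j. \<bar>x (n + j) - x n\<bar>) \<longlonglongrightarrow> \<bar>L - x n\<bar>"
    using LIMSEQ_ignore_initial_segment[OF lim, of n] by (intro tendsto_intros) (simp add: add.commute)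
  ultimately have "\<bar>L - x n\<bar> \<le> C * q ^ n / (1 - q)"
    by (intro LIMSEQ_le_const2) auto
  then show ?thesis by (simp add: abs_minus_commute)
qed

lemma geometric_increments_convergent:
  fixes x :: "nat \<Rightarrow> real"
  assumes inc: "\<And>n. n \<ge> N \<Longrightarrow> \<bar>x (Suc n) - x n\<bar> \<le> C * q ^ n"
    and q: "0 \<le> q" "q < 1"
  shows "convergent x"
proof -
  have "summable (\<lambda>n. x (Suc n) - x n)"
  proof (rule summable_comparison_test')
    show "summable (\<lambda>n. C * q ^ n)"
      using q by (intro summable_mult summable_geometric) auto
    show "norm (x (Suc n) - x n) \<le> C * q ^ n" if "n \<ge> N" for n
      using inc[OF that] by simp
  qed
  then have "convergent (\<lambda>n. x n - x 0)"
    unfolding summable_iff_convergent sum_lessThan_telescope .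
  then show ?thesis by (simp add: convergent_diff_const_right_iff)
qed

text \<open>Interpolation between a bound for the size and a bound for the slope: \<open>min 1 y \<le> y powr a\<close>.\<close>

lemma min_le_powr:
  fixes X a p q :: real
  assumes "\<bar>X\<bar> \<le> A" "\<bar>X\<bar> \<le> A * y" "0 < y" "0 \<le> a" "a \<le> 1"
  shows "\<bar>X\<bar> \<le> A * y powr a"
proof -
  have A: "0 \<le> A" using assms(1) by (rule order_trans[OF abs_ge_zero])
  show ?thesis
  proof (cases "y \<le> 1")
    case True
    then have "y powr 1 \<le> y powr a" using assms by (intro powr_mono') auto
    then have "A * y \<le> A * y powr a" using A assms by (intro mult_left_mono) auto
    then show ?thesis using assms by linarith
  next
    case False
    then have "A * 1 \<le> A * y powr a"
      using A assms by (intro mult_left_mono ge_one_powr_ge_zero) auto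
    then show ?thesis using assms by linarith
  qed
qed

text \<open>A Littlewood-Paley type criterion. If the increments live at scale \<open>2\<^sup>-\<^sup>n\<close> and have size \<open>2 powr - n \<gamma>\<close>,
  with a loss of \<open>2\<^sup>n\<close> for each derivative, the derivatives up to order \<open>k < \<gamma>\<close> converge locally
  uniformly. For those of order \<open>k\<close> the increment between two points at distance \<open>d\<close> is at most a multiple of
  \<open>2 powr (n (k - \<gamma>))\<close> and of \<open>2 powr (n (k + 1 - \<gamma>)) d\<close>; interpolation with exponent
  \<open>\<gamma>' - k\<close> leaves a convergent geometric series times \<open>d powr (\<gamma>' - k)\<close>.\<close>

theorem multiscale_limit:
  fixes f :: "nat \<Rightarrow> real^2 \<Rightarrow> real"
  assumes Ck: "\<And>n. Ck_plane (Suc k) (f n)"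
    and bnd: "\<And>r. \<exists>C N. \<forall>n\<ge>N. \<forall>js. length js \<le> Suc k \<longrightarrow> (\<forall>u\<in>ball 0 r.
       \<bar>iter_partial js (f (Suc n)) u - iter_partial js (f n) u\<bar> \<le> C * 2 powr (real n * (real (length js) - \<gamma>)))"
    and \<gamma>: "real k \<le> \<gamma>'" "\<gamma>' < \<gamma>" "\<gamma>' \<le> real k + 1"
    and lim: "\<And>u. (\<lambda>n. f n u) \<longlonglongrightarrow> F u"
  shows "holder_Ck k (\<gamma>' - real k) F"
proof -
  let ?d = "\<lambda>js n. iter_partial js (f n)"
  define a where "a = \<gamma>' - real k"
  have a: "0 \<le> a" "a \<le> 1" using \<gamma> by (auto simp: a_def)
  define q where "q = 2 powr (real k - \<gamma>)"
  have q: "0 \<le> q" "q < 1" using \<gamma> powr_less_mono[of "real k - \<gamma>" 0 2] by (auto simp: q_def)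
  define L where "L js u = lim (\<lambda>n. ?d js n u)" for js u
  have diffable: "?d js n differentiable (at u)" if "length js \<le> k" for js n u
    using Ck[of n] that by (auto simp: Ck_plane_def)

  have contf: "continuous_on UNIV (?d js n)" if "length js \<le> k" for js n
    using Ck[of n] that by (auto simp: Ck_plane_def)

  have unif: "\<exists>C N. 0 \<le> C \<and> (\<forall>n\<ge>N. \<forall>u\<in>ball 0 r. \<bar>?d js n u - L js u\<bar> \<le> C * q ^ n)"
    and conv: "(\<lambda>n. ?d js n u) \<longlonglongrightarrow> L js u"
    if js: "length js \<le> k" for js r u
  proof -
    have inc: "\<exists>C N. 0 \<le> C \<and> (\<forall>n\<ge>N. \<forall>u\<in>ball 0 r. \<bar>?d js (Suc n) u - ?d js n u\<bar> \<le> C * q ^ n)"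
      for r
    proof -
      obtain C N where C: "\<forall>n\<ge>N. \<forall>js. length js \<le> Suc k \<longrightarrow> (\<forall>u\<in>ball 0 r.
         \<bar>?d js (Suc n) u - ?d js n u\<bar> \<le> C * 2 powr (real n * (real (length js) - \<gamma>)))"
        using bnd[of r] by blast
      have "\<bar>?d js (Suc n) u - ?d js n u\<bar> \<le> \<bar>C\<bar> * q ^ n" if "n \<ge> N" "u \<in> ball 0 r" for n u
      proof -
        have "\<bar>?d js (Suc n) u - ?d js n u\<bar> \<le> C * 2 powr (real n * (real (length js) - \<gamma>))"
          using C js that by auto
        also have "\<dots> \<le> \<bar>C\<bar> * 2 powr (real n * (real k - \<gamma>))"
          using js by (intro mult_mono powr_mono mult_left_mono) auto
        also have "2 powr (real n * (real k - \<gamma>)) = q ^ n"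
          by (simp add: q_def powr_power mult.commute)
        finally show ?thesis .
      qed
      then show ?thesis by (intro exI[of _ "\<bar>C\<bar>"] exI[of _ N]) auto
    qed
    have conv': "(\<lambda>n. ?d js n u) \<longlonglongrightarrow> L js u" for u
    proof -
      obtain C N where "\<forall>n\<ge>N. \<forall>v\<in>ball 0 (norm u + 1). \<bar>?d js (Suc n) v - ?d js n v\<bar> \<le> C * q ^ n"
        using inc by blast
      then have "convergent (\<lambda>n. ?d js n u)"
        by (intro geometric_increments_convergent[OF _ q, of N _ C]) auto
      then show ?thesis by (simp add: L_def convergent_LIMSEQ_iff)
    qed
    then show "(\<lambda>n. ?d js n u) \<longlonglongrightarrow> L js u" .
    obtain C N where C: "0 \<le> C" "\<forall>n\<ge>N. \<forall>v\<in>ball 0 r. \<bar>?d js (Suc n) v - ?d js n v\<bar> \<le> C * q ^ n"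
      using inc by blast
    have "\<bar>?d js n v - L js v\<bar> \<le> (C / (1 - q)) * q ^ n" if "n \<ge> N" "v \<in> ball 0 r" for n v
      using geometric_increments_tail[of N "\<lambda>n. ?d js n v", OF _ q C(1) conv' that(1)] C(2) that(2) by simp
    then show "\<exists>C N. 0 \<le> C \<and> (\<forall>n\<ge>N. \<forall>u\<in>ball 0 r. \<bar>?d js n u - L js u\<bar> \<le> C * q ^ n)"
      using C(1) q by (intro exI[of _ "C / (1 - q)"] exI[of _ N]) auto
  qed

  have ulim: "\<forall>\<^sub>F n in sequentially. \<forall>u\<in>ball 0 r. \<bar>?d js n u - L js u\<bar> < e"
    if js: "length js \<le> k" and e: "0 < e" for js r e
  proof -
    obtain C N where C: "\<forall>n\<ge>N. \<forall>u\<in>ball 0 r. \<bar>?d js n u - L js u\<bar> \<le> C * q ^ n"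
      using unif[OF js] by blast
    have "(\<lambda>n. C * q ^ n) \<longlonglongrightarrow> C * 0"
      using q by (intro tendsto_intros LIMSEQ_power_zero) auto
    then have "\<forall>\<^sub>F n in sequentially. C * q ^ n < e"
      using e by (simp add: order_tendstoD(2))
    with eventually_ge_at_top[of N] show ?thesis
      by eventually_elim (use C in \<open>auto intro: le_less_trans\<close>)
  qed

  have cont: "continuous_on UNIV (L js)" if js: "length js \<le> k" for js
  proof -
    have "isCont (L js) u" for u
    proof -
      have "continuous_on (ball 0 (norm u + 1)) (L js)"
      proof (rule uniform_limit_theorem)
        show "uniform_limit (ball 0 (norm u + 1)) (\<lambda>n. ?d js n) (L js) sequentially"
          using ulim[OF js] by (intro uniform_limitI) (simp add: dist_real_def)
        show "\<forall>\<^sub>F n in sequentially. continuous_on (ball 0 (norm u + 1)) (?d js n)"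
          using js by (intro always_eventually allI continuous_on_subset[OF contf]) auto
      qed simp
      then show ?thesis by (simp add: continuous_on_eq_continuous_at)
    qed
    then show ?thesis by (simp add: continuous_on_eq_continuous_at)
  qed

  have deriv: "(L js has_derivative (\<lambda>h. \<Sum>i\<in>UNIV. h $ i * L (i # js) u)) (at u)" if js: "length js < k" for js u
  proof -
    define r where "r = norm u + 1"
    have "\<exists>g. \<forall>x\<in>ball 0 r. (\<lambda>n. ?d js n x) \<longlonglongrightarrow> g x \<and>
        (g has_derivative (\<lambda>h. \<Sum>i\<in>UNIV. h $ i * L (i # js) x)) (at x within ball 0 r)"
    proof (rule has_derivative_sequence)
      show "(?d js n has_derivative (\<lambda>h. \<Sum>i\<in>UNIV. h $ i * ?d (i # js) n x)) (at x within ball 0 r)" for n x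
        using has_derivative_at_withinI[OF has_derivative_partials[OF diffable[of js n x]]] js by simp
      show "\<forall>\<^sub>F n in sequentially. \<forall>x\<in>ball 0 r. \<forall>h::real^2.
          norm ((\<Sum>i\<in>UNIV. h $ i * ?d (i # js) n x) - (\<Sum>i\<in>UNIV. h $ i * L (i # js) x)) \<le> e * norm h"
        if e: "0 < e" for e
      proof -
        have "\<forall>\<^sub>F n in sequentially. \<forall>i\<in>UNIV. \<forall>x\<in>ball 0 r. \<bar>?d (i # js) n x - L (i # js) x\<bar> < e / 2"
          using e js by (intro eventually_ball_finite ballI ulim) auto
        then show ?thesis
        proof eventually_elim
          case (elim n)
          show ?case
          proof (intro ballI allI)
            fix x :: "real^2" and h :: "real^2" assume x: "x \<in> ball 0 r"
            have "norm (\<Sum>i\<in>UNIV. h $ i * (?d (i # js) n x - L (i # js) x)) \<le> (\<Sum>i\<in>(UNIV::2 set). norm h * (e / 2))"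
            proof (rule sum_norm_le)
              fix i :: 2
              have "\<bar>?d (i # js) n x - L (i # js) x\<bar> \<le> e / 2"
                using elim x by (meson UNIV_I less_imp_le)
              then show "norm (h $ i * (?d (i # js) n x - L (i # js) x)) \<le> norm h * (e / 2)"
                unfolding real_norm_def abs_mult using component_le_norm_cart[of h i] by (intro mult_mono) auto
            qed
            then show "norm ((\<Sum>i\<in>UNIV. h $ i * ?d (i # js) n x) - (\<Sum>i\<in>UNIV. h $ i * L (i # js) x)) \<le> e * norm h"
              by (simp add: right_diff_distrib sum_subtractf mult.commute del: iter_partial.simps(2))
          qed
        qed
      qed
      show "0 \<in> ball 0 r" by (simp add: r_def add_nonneg_pos)
      show "(\<lambda>n. ?d js n 0) \<longlonglongrightarrow> L js 0" using js by (intro conv) simp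
    qed simp
    then obtain g where g: "\<And>x. x \<in> ball 0 r \<Longrightarrow> (\<lambda>n. ?d js n x) \<longlonglongrightarrow> g x"
      "\<And>x. x \<in> ball 0 r \<Longrightarrow> (g has_derivative (\<lambda>h. \<Sum>i\<in>UNIV. h $ i * L (i # js) x)) (at x within ball 0 r)"
      by blast
    have gL: "g x = L js x" if "x \<in> ball 0 r" for x
      using g(1)[OF that] conv[of js x] js by (intro LIMSEQ_unique) auto
    have u: "u \<in> ball 0 r" by (simp add: r_def)
    have "(L js has_derivative (\<lambda>h. \<Sum>i\<in>UNIV. h $ i * L (i # js) u)) (at u within ball 0 r)"
      by (rule has_derivative_transform[OF u _ g(2)[OF u]]) (simp add: gL)
    then show ?thesis by (simp only: at_within_open[OF u open_ball])
  qed

  have eq: "length js \<le> k \<Longrightarrow> iter_partial js F = L js" for js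
  proof (induction js)
    case Nil
    show ?case using limI[OF lim] by (simp add: L_def fun_eq_iff)
  next
    case (Cons i js)
    then have IH: "iter_partial js F = L js" by simp
    show ?case
    proof
      fix u
      have "iter_partial (i # js) F u = iter_partial [i] (L js) u" by (simp add: IH)
      also have "\<dots> = (\<Sum>j\<in>UNIV. axis i 1 $ j * L (j # js) u)"
        using Cons.prems by (intro has_derivative_imp_partial deriv) simp
      also have "\<dots> = (\<Sum>j\<in>UNIV. if j = i then L (j # js) u else 0)"
        by (intro sum.cong) (auto simp: axis_def)
      finally show "iter_partial (i # js) F u = L (i # js) u" by simp
    qed
  qed

  have "Ck_plane k F"
    unfolding Ck_plane_def using eq cont deriv by (auto simp: differentiable_def simp del: iter_partial.simps(2)) blast
  moreover have "locally_hoelder a (L js)" if js: "length js = k" for js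
    unfolding locally_hoelder_def
  proof
    fix r0 :: real
    define r where "r = \<bar>r0\<bar> + 1"
    obtain C N where C: "\<forall>n\<ge>N. \<forall>js. length js \<le> Suc k \<longrightarrow> (\<forall>u\<in>ball 0 r.
       \<bar>?d js (Suc n) u - ?d js n u\<bar> \<le> C * 2 powr (real n * (real (length js) - \<gamma>)))"
      using bnd[of r] by blast
    define p where "p = 2 powr (\<gamma>' - \<gamma>)"
    have p: "0 \<le> p" "p < 1" using \<gamma> powr_less_mono[of "\<gamma>' - \<gamma>" 0 2] by (auto simp: p_def)
    have "Ck_plane (Suc 0) (?d js N)"
      using Ck[of N] js by (intro Ck_plane_iter_partial[of _ k]) auto
    then obtain C0 where C0: "\<And>u v. u \<in> cball 0 r0 \<Longrightarrow> v \<in> cball 0 r0 \<Longrightarrow>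
        \<bar>?d js N u - ?d js N v\<bar> \<le> C0 * dist u v powr a"
      using locally_hoelder_of_C1[OF _ a] unfolding locally_hoelder_def by meson
    have main: "\<bar>L js u - L js v\<bar> \<le> (C0 + 2 * \<bar>C\<bar> * p ^ N / (1 - p)) * dist u v powr a"
      if uv: "u \<in> cball 0 r0" "v \<in> cball 0 r0" "u \<noteq> v" for u v
    proof -
      define d where "d = dist u v"
      have d: "0 < d" using uv by (simp add: d_def)
      have uvr: "u \<in> ball 0 r" "v \<in> ball 0 r" using uv by (auto simp: r_def)
      define D where "D n w = ?d js (Suc n) w - ?d js n w" for n w
      have inc: "\<bar>D n u - D n v\<bar> \<le> (2 * \<bar>C\<bar> * d powr a) * p ^ n" if n: "n \<ge> N" for n
      proof -
        let ?A = "2 * \<bar>C\<bar> * 2 powr (real n * (real k - \<gamma>))"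
        have "\<bar>D n w\<bar> \<le> \<bar>C\<bar> * 2 powr (real n * (real k - \<gamma>))" if "w \<in> ball 0 r" for w
        proof -
          have "\<bar>D n w\<bar> \<le> C * 2 powr (real n * (real k - \<gamma>))"
            using C n js that by (auto simp: D_def)
          also have "\<dots> \<le> \<bar>C\<bar> * 2 powr (real n * (real k - \<gamma>))" by (intro mult_right_mono) auto
          finally show ?thesis .
        qed
        from this[OF uvr(1)] this[OF uvr(2)] have 1: "\<bar>D n u - D n v\<bar> \<le> ?A" by linarith
        have "\<bar>D n u - D n v\<bar> \<le> 2 * (\<bar>C\<bar> * 2 powr (real n * (real k + 1 - \<gamma>))) * dist u v"
        proof (rule partials_bound_imp_lipschitz[of "ball 0 r"])
          have dd: "?d js n differentiable (at w)" for n w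
            using js by (intro diffable) auto
          show "D n differentiable (at w)" for w
            unfolding D_def by (intro differentiable_diff dd)
          show "\<bar>iter_partial [i] (D n) w\<bar> \<le> \<bar>C\<bar> * 2 powr (real n * (real k + 1 - \<gamma>))" if w: "w \<in> ball 0 r" for i w
          proof -
            have "iter_partial [i] (D n) w = ?d (i # js) (Suc n) w - ?d (i # js) n w"
              unfolding D_def
              by (subst has_derivative_imp_partial[OF has_derivative_diff[OF dd[THEN frechet_derivative_works[THEN iffD1]] dd[THEN frechet_derivative_works[THEN iffD1]]]]) simp
            then have "\<bar>iter_partial [i] (D n) w\<bar> \<le> C * 2 powr (real n * (real (length (i # js)) - \<gamma>))"
              using C n js w by (metis length_Cons order_refl)
            also have "real (length (i # js)) = real k + 1" using js by simp
            also have "C * 2 powr (real n * (real k + 1 - \<gamma>)) \<le> \<bar>C\<bar> * 2 powr (real n * (real k + 1 - \<gamma>))"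
              by (intro mult_right_mono) auto
            finally show ?thesis .
          qed
        qed (use uvr in auto)
        also have "2 powr (real n * (real k + 1 - \<gamma>)) = 2 powr (real n * (real k - \<gamma>)) * 2 powr real n"
          by (simp add: algebra_simps flip: powr_add)
        finally have 2: "\<bar>D n u - D n v\<bar> \<le> ?A * (2 powr real n * d)" by (simp add: d_def mult_ac)
        have "\<bar>D n u - D n v\<bar> \<le> ?A * (2 powr real n * d) powr a"
          by (rule min_le_powr[OF 1 2]) (use d a in auto)
        also have "(2 powr real n * d) powr a = 2 powr (real n * a) * d powr a"
          using d by (simp add: powr_mult powr_powr)
        also have "?A * (2 powr (real n * a) * d powr a) = (2 * \<bar>C\<bar> * d powr a) * 2 powr (real n * (real k - \<gamma>) + real n * a)"
          by (simp add: powr_add mult_ac)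
        also have "2 powr (real n * (real k - \<gamma>) + real n * a) = p ^ n"
          by (simp add: p_def a_def powr_power algebra_simps)
        finally show ?thesis .
      qed
      have "\<bar>(?d js N u - ?d js N v) - (L js u - L js v)\<bar>
          \<le> (2 * \<bar>C\<bar> * d powr a) * p ^ N / (1 - p)"
      proof (rule geometric_increments_tail[where x = "\<lambda>n. ?d js n u - ?d js n v" and N = N])
        show "(\<lambda>n. ?d js n u - ?d js n v) \<longlonglongrightarrow> L js u - L js v"
          using js by (intro tendsto_diff conv) auto
        show "\<bar>?d js (Suc n) u - ?d js (Suc n) v - (?d js n u - ?d js n v)\<bar>
           \<le> 2 * \<bar>C\<bar> * d powr a * p ^ n" if "n \<ge> N" for n
          using inc[OF that] by (simp add: D_def algebra_simps)
      qed (use p in auto)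
      then have "\<bar>L js u - L js v\<bar> \<le> C0 * d powr a + (2 * \<bar>C\<bar> * d powr a) * p ^ N / (1 - p)"
        using C0[OF uv(1,2)] unfolding d_def by linarith
      then show ?thesis by (simp add: d_def algebra_simps)
    qed
    have "\<bar>L js u - L js v\<bar> \<le> (C0 + 2 * \<bar>C\<bar> * p ^ N / (1 - p)) * dist u v powr a"
      if "u \<in> cball 0 r0" "v \<in> cball 0 r0" for u v
      using main[OF that] by (cases "u = v") auto
    then show "\<exists>C. \<forall>u\<in>cball 0 r0. \<forall>v\<in>cball 0 r0. \<bar>L js u - L js v\<bar> \<le> C * dist u v powr a"
      by blast
  qed
  ultimately show ?thesis
    unfolding holder_Ck_def a_def[symmetric] using eq by auto
qed

section \<open>A smooth compactly supported cardinal function\<close>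

text \<open>Differentiability of order \<open>k\<close> through the existence of successive derivatives, so that no derivative has to be
  computed.\<close>

fun real_Ck :: "nat \<Rightarrow> (real \<Rightarrow> real) \<Rightarrow> bool" where
  "real_Ck 0 f \<longleftrightarrow> continuous_on UNIV f"
| "real_Ck (Suc k) f \<longleftrightarrow> (\<exists>f'. (\<forall>t. (f has_real_derivative f' t) (at t)) \<and> real_Ck k f')"

lemma real_Ck_imp_continuous: "real_Ck k f \<Longrightarrow> continuous_on UNIV f"
  by (cases k) (auto intro!: continuous_at_imp_continuous_on intro: DERIV_isCont)

lemma real_Ck_SucD: "real_Ck (Suc k) f \<Longrightarrow> real_Ck k f"
proof (induction k arbitrary: f)
  case 0
  then show ?case using real_Ck_imp_continuous[of "Suc 0" f] by simp
next
  case (Suc k)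
  then show ?case by (metis real_Ck.simps(2))
qed

lemma real_Ck_const: "real_Ck k (\<lambda>_. c)"
proof (induction k arbitrary: c)
  case (Suc k)
  then show ?case by (auto intro!: exI[of _ "\<lambda>_. 0"])
qed simp

lemma real_Ck_add: "real_Ck k f \<Longrightarrow> real_Ck k g \<Longrightarrow> real_Ck k (\<lambda>t. f t + g t)"
proof (induction k arbitrary: f g)
  case 0
  then show ?case by (simp add: continuous_on_add continuous_on_mult)
next
  case (Suc k)
  then obtain f' g' where "\<forall>t. (f has_real_derivative f' t) (at t)" "real_Ck k f'"
    "\<forall>t. (g has_real_derivative g' t) (at t)" "real_Ck k g'" by auto
  then show ?case using Suc.IH[of f' g'] by (auto intro!: exI[of _ "\<lambda>t. f' t + g' t"] DERIV_add)
qed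

lemma real_Ck_mult: "real_Ck k f \<Longrightarrow> real_Ck k g \<Longrightarrow> real_Ck k (\<lambda>t. f t * g t)"
proof (induction k arbitrary: f g)
  case 0
  then show ?case by (simp add: continuous_on_add continuous_on_mult)
next
  case (Suc k)
  then obtain f' g' where fg: "\<forall>t. (f has_real_derivative f' t) (at t)" "real_Ck k f'"
    "\<forall>t. (g has_real_derivative g' t) (at t)" "real_Ck k g'" by auto
  moreover have "real_Ck k f" "real_Ck k g" using Suc.prems real_Ck_SucD by blast+
  ultimately have "real_Ck k (\<lambda>t. f' t * g t + g' t * f t)"
    using Suc.IH by (intro real_Ck_add) auto
  then show ?case using fg by (auto intro!: exI[of _ "\<lambda>t. f' t * g t + g' t * f t"] DERIV_mult)
qed

lemma real_Ck_sum: "(\<And>i. i \<in> I \<Longrightarrow> real_Ck k (f i)) \<Longrightarrow> real_Ck k (\<lambda>t. \<Sum>i\<in>I. f i t)"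
  by (induction I rule: infinite_finite_induct) (auto intro: real_Ck_add real_Ck_const)

lemma real_Ck_shift: "real_Ck k f \<Longrightarrow> real_Ck k (\<lambda>t. f (t + c))"
proof (induction k arbitrary: f)
  case 0
  then have "continuous_on UNIV (f \<circ> (\<lambda>t. t + c))"
    by (intro continuous_on_compose continuous_on_add continuous_on_id continuous_on_const)
      (auto intro: continuous_on_subset)
  then show ?case by (simp add: o_def)
next
  case (Suc k)
  then obtain f' where f': "\<forall>t. (f has_real_derivative f' t) (at t)" "real_Ck k f'" by auto
  then show ?case using Suc.IH[of f'] by (auto intro!: exI[of _ "\<lambda>t. f' (t + c)"] DERIV_shift[THEN iffD1])
qed

lemma real_Ck_poly: "real_Ck k (poly p)"
proof (induction k arbitrary: p)
  case (Suc k)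
  then show ?case by (auto intro!: exI[of _ "poly (pderiv p)"] poly_DERIV)
qed (simp add: continuous_on_poly)

lemma real_Ck_diff: "real_Ck k f \<Longrightarrow> real_Ck k g \<Longrightarrow> real_Ck k (\<lambda>t. f t - g t)"
  using real_Ck_add[OF _ real_Ck_mult[OF real_Ck_const[of k "-1"]], of f g] by simp

text \<open>Convolving a step with the indicator of \<open>[0, 1]\<close> gains one derivative and widens the step by 1.\<close>

lemma smooth_step_exists:
  "\<exists>\<psi>. real_Ck k \<psi> \<and> (\<forall>t\<le>0. \<psi> t = 0) \<and> (\<forall>t\<ge>real (Suc k). \<psi> t = 1)"
proof (induction k)
  case 0
  show ?case
    by (rule exI[of _ "\<lambda>t. max 0 (min 1 t)"]) (auto intro!: continuous_intros)
next
  case (Suc k)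
  then obtain \<psi> where psi: "real_Ck k \<psi>" "\<And>t. t \<le> 0 \<Longrightarrow> \<psi> t = 0" "\<And>t. t \<ge> real (Suc k) \<Longrightarrow> \<psi> t = 1"
    by blast
  have cont: "continuous_on S \<psi>" for S
    using real_Ck_imp_continuous[OF psi(1)] continuous_on_subset by blast
  \<comment> \<open>starting at \<open>-1\<close>, to the left of the support, makes \<open>t = 0\<close> an interior point\<close>
  define P where "P t = integral {-1..t} \<psi>" for t
  have P0: "P t = 0" if "t \<le> 0" for t
  proof -
    have "integral {-1..t} \<psi> = integral {-1..t} (\<lambda>_. 0)"
      using that by (intro Henstock_Kurzweil_Integration.integral_cong) (auto simp: psi)
    then show ?thesis by (simp add: P_def)
  qed
  have dP: "(P has_real_derivative \<psi> t) (at t)" for t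
  proof (cases "t < 0")
    case True
    have "((\<lambda>_. 0) has_real_derivative \<psi> t) (at t)" using True by (simp add: psi)
    then show ?thesis
      by (rule has_field_derivative_transform_within_open[where S = "{..<0}"]) (use True P0 in auto)
  next
    case False
    have "(P has_real_derivative \<psi> t) (at t within {-1..t+1})"
      unfolding P_def using False by (intro integral_has_real_derivative cont) auto
    moreover have "t \<in> interior {-1..t+1}" using False by simp
    ultimately show ?thesis using at_within_interior by metis
  qed
  define \<psi>' where "\<psi>' t = P t - P (t - 1)" for t
  have dsh: "((\<lambda>t. P (t - 1)) has_real_derivative \<psi> (t - 1)) (at t)" for t
    using DERIV_shift[of P "\<psi> (t - 1)" t "-1"] dP[of "t - 1"] by simp
  have "real_Ck k (\<lambda>t. \<psi> t - \<psi> (t - 1))"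
    using real_Ck_diff[OF psi(1) real_Ck_shift[OF psi(1), of "-1"]] by simp
  then have "real_Ck (Suc k) \<psi>'"
    unfolding \<psi>'_def using dP dsh by (auto intro!: exI[of _ "\<lambda>t. \<psi> t - \<psi> (t - 1)"] DERIV_diff)
  moreover have "\<psi>' t = 0" if "t \<le> 0" for t
    using that P0 by (simp add: \<psi>'_def)
  moreover have "\<psi>' t = 1" if t: "t \<ge> real (Suc (Suc k))" for t
  proof -
    obtain z where "t - 1 < z" "z < t" "P t - P (t - 1) = (t - (t - 1)) * \<psi> z"
      using MVT2[of "t - 1" t P \<psi>] dP by auto
    then show ?thesis using t psi(3)[of z] by (simp add: \<psi>'_def)
  qed
  ultimately show ?case by blast
qed

definition lagrange_poly :: "nat \<Rightarrow> nat \<Rightarrow> real poly" where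
  "lagrange_poly m e = smult (inverse (\<Prod>j\<in>{..<m} - {e}. real e - real j)) (\<Prod>j\<in>{..<m} - {e}. [:- real j, 1:])"

lemma lagrange_poly_node:
  assumes "e < m" "i < m"
  shows "poly (lagrange_poly m e) (real i) = (if i = e then 1 else 0)"
proof (cases "i = e")
  case True
  have "(\<Prod>j\<in>{..<m} - {e}. real e - real j) \<noteq> 0" by auto
  then show ?thesis using True by (simp add: lagrange_poly_def poly_prod)
next
  case False
  then show ?thesis using assms by (auto simp: lagrange_poly_def poly_prod)
qed

lemma degree_lagrange_poly:
  assumes "e < m"
  shows "degree (lagrange_poly m e) < m"
proof -
  have "degree (\<Prod>j\<in>{..<m} - {e}. [:- real j, 1:]) \<le> sum (degree \<circ> (\<lambda>j. [:- real j, 1:])) ({..<m} - {e})"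
    by (rule degree_prod_sum_le) simp
  also have "\<dots> = m - 1" using assms by simp
  finally show ?thesis using assms unfolding lagrange_poly_def
    by (intro le_less_trans[OF degree_smult_le]) simp
qed

lemma lagrange_interpolation:
  assumes p: "degree p < m"
  shows "(\<Sum>e<m. poly p (c + real e) * poly (lagrange_poly m e) x) = poly p (c + x)"
proof -
  let ?q = "pcompose p [:c, 1:]"
  have "(\<Sum>e<m. smult (poly p (c + real e)) (lagrange_poly m e)) = ?q"
  proof (rule poly_eqI_degree[where A = "real ` {..<m}"])
    fix x assume "x \<in> real ` {..<m}"
    then obtain i where i: "i < m" "x = real i" by auto
    have "poly (\<Sum>e<m. smult (poly p (c + real e)) (lagrange_poly m e)) x
       = (\<Sum>e<m. if e = i then poly p (c + real e) else 0)"
      unfolding poly_sum using i by (intro sum.cong) (auto simp: lagrange_poly_node)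
    then show "poly (\<Sum>e<m. smult (poly p (c + real e)) (lagrange_poly m e)) x = poly ?q x"
      using i by (simp add: poly_pcompose)
  next
    have c: "card (real ` {..<m}) = m" by (simp add: card_image)
    show "degree (\<Sum>e<m. smult (poly p (c + real e)) (lagrange_poly m e)) < card (real ` {..<m})"
      unfolding c using p by (intro degree_sum_less) (auto intro: le_less_trans[OF degree_smult_le] degree_lagrange_poly)
    show "degree ?q < card (real ` {..<m})" unfolding c using p by (simp add: degree_pcompose)
  qed
  then have "poly (\<Sum>e<m. smult (poly p (c + real e)) (lagrange_poly m e)) x = poly ?q x" by simp
  then show ?thesis by (simp add: poly_sum poly_pcompose)
qed

lemma sum_telescope_int:
  fixes f :: "int \<Rightarrow> real"
  shows "(\<Sum>i\<in>{a..<a + int n}. f i - f (i + 1)) = f a - f (a + int n)"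
proof (induction n)
  case (Suc n)
  have "{a..<a + int (Suc n)} = insert (a + int n) {a..<a + int n}" by auto
  then show ?case using Suc by (simp add: add_ac)
qed simp

lemma finite_int_near:
  fixes t d :: real
  shows "finite {i::int. \<bar>t - of_int i\<bar> < d}"
proof (rule finite_subset)
  show "{i::int. \<bar>t - of_int i\<bar> < d} \<subseteq> {\<lfloor>t - d\<rfloor>..\<lceil>t + d\<rceil>}"
    by (auto simp: abs_less_iff floor_le_iff le_ceiling_iff)
qed simp

text \<open>Let \<open>\<zeta>\<close> be a smooth bump whose integer translates sum to 1, obtained as the difference of a smooth
  step and its translate. Blending with these weights the Lagrange interpolants on the nodes \<open>i, \<dots>, i + m - 1\<close>
  reproduces every polynomial of degree below \<open>m\<close>, because each interpolant does. Collecting the contributions of one node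
  gives the function \<open>\<phi>\<close>.\<close>

lemma blended_lagrange_exists:
  "\<exists>\<phi> D. real_Ck K \<phi> \<and> (\<forall>t. real D \<le> \<bar>t\<bar> \<longrightarrow> \<phi> t = 0) \<and>
    (\<forall>p t I. degree p < m \<longrightarrow> finite I \<longrightarrow> {i::int. \<bar>t - of_int i\<bar> < real D} \<subseteq> I \<longrightarrow>
       (\<Sum>i\<in>I. poly p (of_int i) * \<phi> (t - of_int i)) = poly p t)"
proof -
  obtain \<psi> where psi: "real_Ck K \<psi>" "\<And>t. t \<le> 0 \<Longrightarrow> \<psi> t = 0" "\<And>t. t \<ge> real (Suc K) \<Longrightarrow> \<psi> t = 1"
    using smooth_step_exists by blast
  define E where "E = real (Suc K)"
  define \<zeta> where "\<zeta> t = \<psi> t - \<psi> (t - 1)" for t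
  have zeta: "real_Ck K \<zeta>"
    unfolding \<zeta>_def using real_Ck_diff[OF psi(1) real_Ck_shift[OF psi(1), of "-1"]] by simp
  have zeta0: "\<zeta> t = 0" if "t \<le> 0 \<or> E + 1 \<le> t" for t
    using that psi(2)[of t] psi(2)[of "t - 1"] psi(3)[of t] psi(3)[of "t - 1"] by (auto simp: \<zeta>_def E_def)
  define \<phi> where "\<phi> t = (\<Sum>e<m. \<zeta> (t + real e) * poly (lagrange_poly m e) (t + real e))" for t
  define D where "D = m + K + 2"
  have "real_Ck K (\<lambda>t. \<zeta> (t + real e) * poly (lagrange_poly m e) (t + real e))" for e
    by (intro real_Ck_mult real_Ck_shift[of K \<zeta>] real_Ck_shift[of K "poly (lagrange_poly m e)"] zeta real_Ck_poly)
  then have "real_Ck K \<phi>"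
    unfolding \<phi>_def by (intro real_Ck_sum)
  moreover have "\<phi> t = 0" if "real D \<le> \<bar>t\<bar>" for t
  proof -
    have "t + real e \<le> 0 \<or> E + 1 \<le> t + real e" if "e < m" for e
      using \<open>real D \<le> \<bar>t\<bar>\<close> that by (auto simp: D_def E_def abs_if split: if_splits)
    then show ?thesis by (auto simp: \<phi>_def zeta0)
  qed
  moreover have "(\<Sum>i\<in>I. poly p (of_int i) * \<phi> (t - of_int i)) = poly p t"
    if p: "degree p < m" and I: "finite I" "{i::int. \<bar>t - of_int i\<bar> < real D} \<subseteq> I" for p t I
  proof -
    \<comment> \<open>contains all \<open>i\<close> for which \<open>\<zeta> (t - i)\<close> can be nonzero\<close>
  define V where "V = {\<lfloor>t\<rfloor> - int (K + 2)..<\<lfloor>t\<rfloor> + 2}"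
    have part: "(\<Sum>i\<in>V. \<zeta> (t - of_int i)) = 1"
    proof -
      have V: "V = {\<lfloor>t\<rfloor> - int (K + 2)..<(\<lfloor>t\<rfloor> - int (K + 2)) + int (K + 4)}" by (auto simp: V_def)
      have "(\<Sum>i\<in>V. \<zeta> (t - of_int i)) = (\<Sum>i\<in>V. \<psi> (t - of_int i) - \<psi> (t - of_int (i + 1)))"
        by (simp add: \<zeta>_def algebra_simps)
      also have "\<dots> = \<psi> (t - of_int (\<lfloor>t\<rfloor> - int (K + 2))) - \<psi> (t - of_int (\<lfloor>t\<rfloor> - int (K + 2) + int (K + 4)))"
        unfolding V by (rule sum_telescope_int)
      also have "\<psi> (t - of_int (\<lfloor>t\<rfloor> - int (K + 2))) = 1"
        by (rule psi(3)) (use of_int_floor_le[of t] in simp)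
      also have "\<psi> (t - of_int (\<lfloor>t\<rfloor> - int (K + 2) + int (K + 4))) = 0"
        by (rule psi(2)) (simp, linarith)
      finally show ?thesis by simp
    qed
    have shift: "(\<Sum>i\<in>I. poly p (of_int i) * (\<zeta> (t - of_int i + real e) * poly (lagrange_poly m e) (t - of_int i + real e)))
       = (\<Sum>i\<in>V. poly p (of_int i + real e) * (\<zeta> (t - of_int i) * poly (lagrange_poly m e) (t - of_int i)))"
      (is "sum ?g I = _") if e: "e < m" for e
    proof -
      let ?W = "{i \<in> (\<lambda>i. i + int e) ` V. \<zeta> (t - of_int i + real e) \<noteq> 0}"
      have W: "i \<in> ?W" if nz: "\<zeta> (t - of_int i + real e) \<noteq> 0" for i
      proof -
        have "0 < t - of_int i + real e" "t - of_int i + real e < E + 1"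
          using zeta0 nz by (meson not_le)+
        then have "i - int e \<in> V"
          unfolding V_def E_def by (auto simp: le_floor_iff floor_less_iff) linarith+
        then show ?thesis using nz by (auto intro!: image_eqI[of _ _ "i - int e"])
      qed
      have W2: "i \<in> I" if nz: "\<zeta> (t - of_int i + real e) \<noteq> 0" for i
      proof -
        have "0 < t - of_int i + real e" "t - of_int i + real e < E + 1"
          using zeta0 nz by (meson not_le)+
        then have "\<bar>t - of_int i\<bar> < real D" using e by (auto simp: D_def E_def)
        then show ?thesis using I by auto
      qed
      have "sum ?g I = sum ?g ?W"
        using I W W2 by (intro sum.mono_neutral_right) auto
      also have "\<dots> = sum ?g ((\<lambda>i. i + int e) ` V)"
        using W by (intro sum.mono_neutral_left) (auto simp: V_def)
      also have "\<dots> = (\<Sum>i\<in>V. ?g (i + int e))"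
        by (subst sum.reindex) (auto simp: inj_on_def)
      finally show ?thesis by simp
    qed
    have "(\<Sum>i\<in>I. poly p (of_int i) * \<phi> (t - of_int i))
       = (\<Sum>e<m. \<Sum>i\<in>I. poly p (of_int i) * (\<zeta> (t - of_int i + real e) * poly (lagrange_poly m e) (t - of_int i + real e)))"
      unfolding \<phi>_def sum_distrib_left by (rule sum.swap)
    also have "\<dots> = (\<Sum>e<m. \<Sum>i\<in>V. poly p (of_int i + real e) * (\<zeta> (t - of_int i) * poly (lagrange_poly m e) (t - of_int i)))"
      by (intro sum.cong shift) auto
    also have "\<dots> = (\<Sum>i\<in>V. \<zeta> (t - of_int i) * (\<Sum>e<m. poly p (of_int i + real e) * poly (lagrange_poly m e) (t - of_int i)))"
      unfolding sum_distrib_left by (subst sum.swap) (simp add: mult_ac)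
    also have "\<dots> = (\<Sum>i\<in>V. \<zeta> (t - of_int i)) * poly p t"
      unfolding lagrange_interpolation[OF p] sum_distrib_right by simp
    finally show ?thesis using part by simp
  qed
  ultimately show ?thesis by blast
qed

lemma real_Ck_derivative_sequence:
  "real_Ck k f \<Longrightarrow> \<exists>ds. ds 0 = f \<and> (\<forall>r<k. \<forall>t. (ds r has_real_derivative ds (Suc r) t) (at t)) \<and>
     (\<forall>r\<le>k. continuous_on UNIV (ds r))"
proof (induction k arbitrary: f)
  case 0
  then show ?case by (intro exI[of _ "\<lambda>_. f"]) auto
next
  case (Suc k)
  then obtain f' where f': "\<forall>t. (f has_real_derivative f' t) (at t)" "real_Ck k f'" by auto
  obtain ds where ds: "ds 0 = f'" "\<forall>r<k. \<forall>t. (ds r has_real_derivative ds (Suc r) t) (at t)"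
    "\<forall>r\<le>k. continuous_on UNIV (ds r)"
    using Suc.IH[OF f'(2)] by blast
  show ?case
    using f' ds real_Ck_imp_continuous[OF Suc.prems]
    by (intro exI[of _ "case_nat f ds"]) (auto split: nat.splits)
qed

text \<open>The function \<open>\<phi> 0\<close> together with its derivatives \<open>\<phi> r\<close> up to order \<open>K\<close>. The reproduction of
  polynomials is required for all derivatives, which are obtained by differentiating the identity for \<open>r = 0\<close>. The
  index sets \<open>I\<close> may be any finite sets that contain the nodes near \<open>t\<close>.\<close>

locale cardinal_function =
  fixes K m :: nat and \<phi> :: "nat \<Rightarrow> real \<Rightarrow> real" and D :: nat and B :: real
  assumes deriv: "\<And>r t. r < K \<Longrightarrow> (\<phi> r has_real_derivative \<phi> (Suc r) t) (at t)"
    and cont: "\<And>r. r \<le> K \<Longrightarrow> continuous_on UNIV (\<phi> r)"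
    and supp: "\<And>r t. r \<le> K \<Longrightarrow> real D \<le> \<bar>t\<bar> \<Longrightarrow> \<phi> r t = 0"
    and repro: "\<And>r p t I. r \<le> K \<Longrightarrow> degree p < m \<Longrightarrow> finite I \<Longrightarrow> {i::int. \<bar>t - of_int i\<bar> < real D} \<subseteq> I \<Longrightarrow>
       (\<Sum>i\<in>I. poly p (of_int i) * \<phi> r (t - of_int i)) = poly ((pderiv ^^ r) p) t"
    and bound: "\<And>r t. r \<le> K \<Longrightarrow> \<bar>\<phi> r t\<bar> \<le> B"

theorem cardinal_function_exists: "\<exists>\<phi> D B. cardinal_function K m \<phi> D B"
proof -
  obtain f D where f: "real_Ck K f" "\<And>t. real D \<le> \<bar>t\<bar> \<Longrightarrow> f t = 0"
    and frep: "\<And>p t I. degree p < m \<Longrightarrow> finite I \<Longrightarrow> {i::int. \<bar>t - of_int i\<bar> < real D} \<subseteq> I \<Longrightarrow>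
       (\<Sum>i\<in>I. poly p (of_int i) * f (t - of_int i)) = poly p t"
    using blended_lagrange_exists[of K m] by blast
  obtain ds where ds0: "ds 0 = f" and ds: "\<And>r t. r < K \<Longrightarrow> (ds r has_real_derivative ds (Suc r) t) (at t)"
    and dsc: "\<And>r. r \<le> K \<Longrightarrow> continuous_on UNIV (ds r)"
    using real_Ck_derivative_sequence[OF f(1)] by blast
  \<comment> \<open>the enlarged support leaves room to differentiate the reproduction identity in an open set\<close>
  define D' where "D' = D + 1"
  have supp': "\<forall>t. real D < \<bar>t\<bar> \<longrightarrow> ds r t = 0" if "r \<le> K" for r
    using that
  proof (induction r)
    case 0
    then show ?case using f(2) by (simp add: ds0)
  next
    case (Suc r)
    have "ds (Suc r) t = 0" if t: "real D < \<bar>t\<bar>" for t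
    proof -
      have o: "open {t::real. real D < \<bar>t\<bar>}" by (intro open_Collect_less continuous_intros)
      have "((\<lambda>_. 0) has_real_derivative ds (Suc r) t) (at t)"
        using Suc by (intro has_field_derivative_transform_within_open[OF ds[of r t] o]) (auto simp: t)
      then show ?thesis using DERIV_unique DERIV_const by blast
    qed
    then show ?case by blast
  qed
  then have supp: "ds r t = 0" if "r \<le> K" "real D' \<le> \<bar>t\<bar>" for r t
    using that by (simp add: D'_def)
  have extend: "(\<Sum>i\<in>I. poly p (of_int i) * ds r (t - of_int i)) = (\<Sum>i\<in>J. poly p (of_int i) * ds r (t - of_int i))"
    if "r \<le> K" "finite J" "I \<subseteq> J" "{i::int. \<bar>t - of_int i\<bar> < real D'} \<subseteq> I" for r p t I J
  proof (intro sum.mono_neutral_left ballI)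
    fix i assume "i \<in> J - I"
    then have "\<not> \<bar>t - of_int i\<bar> < real D'" using that by blast
    then show "poly p (of_int i) * ds r (t - of_int i) = 0" using supp[OF that(1)] by simp
  qed (use that in auto)
  have rep: "(\<Sum>i\<in>I. poly p (of_int i) * ds r (t - of_int i)) = poly ((pderiv ^^ r) p) t"
    if "r \<le> K" "degree p < m" "finite I" "{i::int. \<bar>t - of_int i\<bar> < real D'} \<subseteq> I" for r p t I
    using that
  proof (induction r arbitrary: t I)
    case 0
    have "{i::int. \<bar>t - of_int i\<bar> < real D} \<subseteq> I" using 0(4) by (auto simp: D'_def subset_iff)
    then show ?case using frep 0 by (simp add: ds0)
  next
    case (Suc r)
    define J where "J = I \<union> {i::int. \<bar>t - of_int i\<bar> < real D' + 1}"
    have J: "finite J" "I \<subseteq> J" using Suc.prems finite_int_near by (auto simp: J_def)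
    have "((\<lambda>s. \<Sum>i\<in>J. poly p (of_int i) * ds r (s - of_int i)) has_real_derivative
       (\<Sum>i\<in>J. poly p (of_int i) * ds (Suc r) (t - of_int i))) (at t)"
    proof (rule DERIV_sum)
      fix i assume "i \<in> J"
      have "((\<lambda>s. ds r (s - of_int i)) has_real_derivative ds (Suc r) (t - of_int i)) (at t)"
        using DERIV_shift[of "ds r" "ds (Suc r) (t - of_int i)" t "- of_int i"] ds[of r "t - of_int i"] Suc.prems by simp
      then show "((\<lambda>s. poly p (of_int i) * ds r (s - of_int i)) has_real_derivative
         poly p (of_int i) * ds (Suc r) (t - of_int i)) (at t)" by (rule DERIV_cmult)
    qed
    moreover have "((\<lambda>s. \<Sum>i\<in>J. poly p (of_int i) * ds r (s - of_int i)) has_real_derivative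
       poly (pderiv ((pderiv ^^ r) p)) t) (at t)"
    proof (rule has_field_derivative_transform_within_open[OF poly_DERIV, of "ball t 1"])
      fix s assume "s \<in> ball t 1"
      then have "{i::int. \<bar>s - of_int i\<bar> < real D'} \<subseteq> J" by (auto simp: J_def dist_real_def)
      then show "poly ((pderiv ^^ r) p) s = (\<Sum>i\<in>J. poly p (of_int i) * ds r (s - of_int i))"
        using Suc.IH[of J s] Suc.prems J by simp
    qed auto
    ultimately have "(\<Sum>i\<in>J. poly p (of_int i) * ds (Suc r) (t - of_int i)) = poly ((pderiv ^^ Suc r) p) t"
      using DERIV_unique by fastforce
    then show ?case using extend[OF Suc.prems(1) J Suc.prems(4)] by simp
  qed
  have "\<exists>b. \<forall>t. \<bar>ds r t\<bar> \<le> b" if "r \<le> K" for r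
  proof -
    have "bounded (ds r ` {-real D'..real D'})"
      by (intro compact_imp_bounded compact_continuous_image continuous_on_subset[OF dsc[OF that]]) auto
    then obtain b where b: "\<forall>t\<in>{-real D'..real D'}. \<bar>ds r t\<bar> \<le> b" by (auto simp: bounded_iff)
    have "\<bar>ds r t\<bar> \<le> \<bar>b\<bar>" for t
    proof (cases "t \<in> {-real D'..real D'}")
      case True then show ?thesis using b by force
    next
      case False then show ?thesis using supp[OF that, of t] by (auto simp: abs_if split: if_splits)
    qed
    then show ?thesis by blast
  qed
  then obtain b where b: "\<And>r t. r \<le> K \<Longrightarrow> \<bar>ds r t\<bar> \<le> b r" by metis
  define B where "B = (\<Sum>r\<le>K. \<bar>b r\<bar>)"
  have "\<bar>ds r t\<bar> \<le> B" if "r \<le> K" for r t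
  proof -
    have "\<bar>b r\<bar> \<le> B" unfolding B_def using that by (intro member_le_sum) auto
    then show ?thesis using b[OF that, of t] by linarith
  qed
  then have "cardinal_function K m ds D' B"
    using ds dsc supp rep by unfold_locales auto
  then show ?thesis by blast
qed

section \<open>Quasi-interpolation on dyadic grids\<close>

text \<open>A forward difference lowers the degree of a polynomial.\<close>

lemma fdiff_power_poly:
  "degree p < m \<Longrightarrow> (fdiff 1 ^^ m) (\<lambda>e::int. poly p (of_int e) :: real) = (\<lambda>_. 0)"
proof (induction m arbitrary: p)
  case (Suc m)
  define q where "q = pcompose p [:1, 1:] - p"
  have fd: "fdiff 1 (\<lambda>e::int. poly p (of_int e)) = (\<lambda>e. poly q (of_int e) :: real)"
    by (simp add: fdiff_def q_def poly_pcompose add.commute)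
  have "coeff (pcompose p [:1, 1:]) (degree p) = lead_coeff p"
    using lead_coeff_comp[of "[:1, 1:]" p] by (simp add: degree_pcompose)
  then have "coeff q (degree p) = 0" by (simp add: q_def)
  moreover have "degree q \<le> degree p" unfolding q_def by (intro degree_diff_le) (auto simp: degree_pcompose)
  ultimately have "q = 0 \<or> degree q < degree p" using eq_zero_or_degree_less by blast
  then have q: "q = 0 \<or> degree q < m" using Suc.prems by auto
  have zero: "(fdiff 1 ^^ m) (\<lambda>e::int. 0 :: real) = (\<lambda>_. 0)" for m
    by (induction m) (simp_all add: fdiff_def)
  show ?case
    unfolding funpow_Suc_right o_apply fd using q Suc.IH[of q] zero by auto
qed simp

lemma fdiff_power_diff:
  "(fdiff h ^^ m) (\<lambda>x. f x - g x) x = (fdiff h ^^ m) f x - (fdiff h ^^ m) g x"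
  by (simp add: fdiff_power_eq_sum right_diff_distrib sum_subtractf)

lemma fdiff_power_binom_sign:
  "(fdiff 1 ^^ m) g (x::int) = (\<Sum>k\<le>m. binom_sign m k * g (x + int k))"
  by (simp add: fdiff_power_eq_sum binom_sign_def)

text \<open>The recursion \<open>r (i + m) = (fdiff 1 ^^ m) r i - (\<Sum>k<m. binom_sign m k * r (i + k))\<close> propagates the vanishing at the
  first \<open>m\<close> nodes, with a growing constant.\<close>

lemma vanishing_nodes_bound:
  fixes r :: "int \<Rightarrow> real"
  assumes z: "\<And>j. j < m \<Longrightarrow> r (c + int j) = 0" and \<delta>: "0 \<le> \<delta>"
    and d: "\<And>j. j + m < N \<Longrightarrow> \<bar>(fdiff 1 ^^ m) r (c + int j)\<bar> \<le> \<delta>" and j: "j < N"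
  shows "\<bar>r (c + int j)\<bar> \<le> \<delta> * (1 + 2 ^ m) ^ j"
  using j
proof (induction j rule: less_induct)
  case (less j)
  show ?case
  proof (cases "j < m")
    case True
    then show ?thesis using z \<delta> by simp
  next
    case False
    define i where "i = j - m"
    have ij: "j = i + m" using False by (simp add: i_def)
    show ?thesis
    proof (cases "m = 0")
      case True
      have "\<bar>r (c + int j)\<bar> \<le> \<delta> * 1" using d[of j] less.prems True by simp
      also have "\<dots> \<le> \<delta> * (1 + 2 ^ m) ^ j" using \<delta> by (intro mult_left_mono one_le_power) auto
      finally show ?thesis .
    next
      case m: False
      have "(fdiff 1 ^^ m) r (c + int i) = (\<Sum>k<m. binom_sign m k * r (c + int (i + k))) + r (c + int j)"
        unfolding fdiff_power_binom_sign lessThan_Suc_atMost[symmetric]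
        by (simp add: binom_sign_def ij add.assoc)
      then have "\<bar>r (c + int j)\<bar> \<le> \<bar>(fdiff 1 ^^ m) r (c + int i)\<bar> + \<bar>\<Sum>k<m. binom_sign m k * r (c + int (i + k))\<bar>"
        by linarith
      also have "\<dots> \<le> \<delta> + (\<Sum>k<m. \<bar>binom_sign m k\<bar> * (\<delta> * (1 + 2 ^ m) ^ (j - 1)))"
      proof (intro add_mono order_trans[OF sum_abs] sum_mono)
        show "\<bar>(fdiff 1 ^^ m) r (c + int i)\<bar> \<le> \<delta>" using d[of i] less.prems ij by simp
        fix k assume k: "k \<in> {..<m}"
        have "\<bar>r (c + int (i + k))\<bar> \<le> \<delta> * (1 + 2 ^ m) ^ (i + k)"
          using less.IH[of "i + k"] less.prems ij k by simp
        also have "\<dots> \<le> \<delta> * (1 + 2 ^ m) ^ (j - 1)"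
          using \<delta> ij k by (intro mult_left_mono power_increasing) auto
        finally show "\<bar>binom_sign m k * r (c + int (i + k))\<bar> \<le> \<bar>binom_sign m k\<bar> * (\<delta> * (1 + 2 ^ m) ^ (j - 1))"
          unfolding abs_mult by (intro mult_left_mono) auto
      qed
      also have "\<dots> \<le> \<delta> * (1 + 2 ^ m) ^ (j - 1) + 2 ^ m * (\<delta> * (1 + 2 ^ m) ^ (j - 1))"
      proof (intro add_mono)
        have "\<delta> * 1 \<le> \<delta> * (1 + 2 ^ m) ^ (j - 1)" using \<delta> by (intro mult_left_mono one_le_power) auto
        then show "\<delta> \<le> \<delta> * (1 + 2 ^ m) ^ (j - 1)" by simp
        have "(\<Sum>k<m. \<bar>binom_sign m k\<bar>) \<le> (\<Sum>k\<le>m. \<bar>binom_sign m k\<bar>)"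
          by (intro sum_mono2) auto
        then show "(\<Sum>k<m. \<bar>binom_sign m k\<bar> * (\<delta> * (1 + 2 ^ m) ^ (j - 1))) \<le> 2 ^ m * (\<delta> * (1 + 2 ^ m) ^ (j - 1))"
          unfolding sum_distrib_right[symmetric] sum_abs_binom_sign using \<delta> by (intro mult_right_mono) auto
      qed
      also have "\<dots> = \<delta> * (1 + 2 ^ m) ^ (Suc (j - 1))" by (simp add: algebra_simps)
      also have "Suc (j - 1) = j" using m ij by simp
      finally show ?thesis .
    qed
  qed
qed

text \<open>A functional that annihilates polynomials of degree below \<open>m\<close> does not see the interpolant of \<open>g\<close>
  at the first \<open>m\<close> nodes. What is left is the interpolation error, which is controlled by the
  \<open>m\<close>-th differences.\<close>

lemma annihilating_functional_bound:
  fixes w g :: "int \<Rightarrow> real"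
  assumes m: "m \<ge> 1" and ann: "\<And>p. degree p < m \<Longrightarrow> (\<Sum>e\<in>{c..<c + int N}. w e * poly p (of_int e)) = 0"
    and d: "\<And>j. j + m < N \<Longrightarrow> \<bar>(fdiff 1 ^^ m) g (c + int j)\<bar> \<le> \<delta>" and \<delta>: "0 \<le> \<delta>"
  shows "\<bar>\<Sum>e\<in>{c..<c + int N}. w e * g e\<bar> \<le> (\<Sum>e\<in>{c..<c + int N}. \<bar>w e\<bar>) * ((1 + 2 ^ m) ^ N * \<delta>)"
proof -
  define L where "L = pcompose (\<Sum>e<m. smult (g (c + int e)) (lagrange_poly m e)) [:- of_int c, 1:]"
  have "degree (\<Sum>e<m. smult (g (c + int e)) (lagrange_poly m e)) < m"
    using m by (intro degree_sum_less) (auto intro: le_less_trans[OF degree_smult_le] degree_lagrange_poly)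
  then have degL: "degree L < m" by (simp add: L_def degree_pcompose)
  have L: "poly L (of_int (c + int j)) = g (c + int j)" if "j < m" for j
  proof -
    have "poly L (of_int (c + int j)) = (\<Sum>e<m. g (c + int e) * poly (lagrange_poly m e) (real j))"
      by (simp add: L_def poly_pcompose poly_sum)
    also have "\<dots> = (\<Sum>e<m. if e = j then g (c + int e) else 0)"
      using that by (intro sum.cong) (auto simp: lagrange_poly_node)
    finally show ?thesis using that by simp
  qed
  define r where "r e = g e - poly L (of_int e)" for e
  have fr: "(fdiff 1 ^^ m) r = (fdiff 1 ^^ m) g"
    using fdiff_power_poly[OF degL] unfolding r_def by (intro ext) (simp add: fdiff_power_diff)
  have r: "\<bar>r e\<bar> \<le> (1 + 2 ^ m) ^ N * \<delta>" if e: "e \<in> {c..<c + int N}" for e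
  proof -
    define j where "j = nat (e - c)"
    have j: "e = c + int j" "j < N" using e by (auto simp: j_def)
    have "\<bar>r (c + int j)\<bar> \<le> \<delta> * (1 + 2 ^ m) ^ j"
    proof (rule vanishing_nodes_bound[OF _ \<delta> _ j(2)])
      show "r (c + int j) = 0" if "j < m" for j using L[OF that] by (simp add: r_def)
      show "\<bar>(fdiff 1 ^^ m) r (c + int j)\<bar> \<le> \<delta>" if "j + m < N" for j using d[OF that] by (simp only: fr)
    qed
    also have "\<dots> \<le> \<delta> * (1 + 2 ^ m) ^ N"
      using \<delta> j by (intro mult_left_mono power_increasing) auto
    finally show ?thesis by (simp add: j mult.commute)
  qed
  have "(\<Sum>e\<in>{c..<c + int N}. w e * g e) = (\<Sum>e\<in>{c..<c + int N}. w e * r e)"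
    using ann[OF degL] by (simp add: r_def right_diff_distrib sum_subtractf)
  then have "\<bar>\<Sum>e\<in>{c..<c + int N}. w e * g e\<bar> \<le> (\<Sum>e\<in>{c..<c + int N}. \<bar>w e\<bar> * \<bar>r e\<bar>)"
    by (simp add: sum_abs abs_mult[symmetric])
  also have "\<dots> \<le> (\<Sum>e\<in>{c..<c + int N}. \<bar>w e\<bar> * ((1 + 2 ^ m) ^ N * \<delta>))"
    by (intro sum_mono mult_left_mono r) auto
  finally show ?thesis by (simp add: sum_distrib_right)
qed

definition grid_point :: "nat \<Rightarrow> int \<Rightarrow> int \<Rightarrow> real^2" where
  "grid_point n i j = vector [of_int i / 2 ^ n, of_int j / 2 ^ n]"

lemma grid_point_refine: "grid_point (Suc n) (2 * i) (2 * j) = grid_point n i j"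
  by (simp add: grid_point_def)

context cardinal_function
begin

text \<open>The grid at level \<open>n\<close> has mesh \<open>2\<^sup>-\<^sup>n\<close>; the indices up to \<open>4\<^sup>n\<close> cover a square of
  half side \<open>2\<^sup>n\<close>. Thus every approximant is a finite sum on the whole plane, while on a fixed ball the truncation is
  invisible for large \<open>n\<close>.\<close>

definition grid_window :: "nat \<Rightarrow> int set" where
  "grid_window n = {- (4 ^ n)..4 ^ n}"

lemma in_grid_windowI:
  assumes "\<bar>real_of_int i\<bar> \<le> c * 2 ^ n" "c \<le> 2 ^ n"
  shows "i \<in> grid_window n"
proof -
  have "\<bar>real_of_int i\<bar> \<le> 2 ^ n * 2 ^ n"
    using order_trans[OF assms(1) mult_right_mono[OF assms(2)]] by simp
  also have "\<dots> = real_of_int (4 ^ n)" by (simp add: power_mult_distrib[symmetric])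
  finally have "\<bar>i\<bar> \<le> 4 ^ n" by (metis of_int_abs of_int_le_iff)
  then show ?thesis by (auto simp: grid_window_def)
qed

text \<open>For \<open>a = b = 0\<close> the quasi-interpolant of \<open>X\<close>; in general, up to the factor \<open>2 ^ (n * (a + b))\<close>,
  its partial derivative of order \<open>a\<close> in the first and \<open>b\<close> in the second variable.\<close>

definition approximant :: "nat \<Rightarrow> nat \<Rightarrow> (real^2 \<Rightarrow> real) \<Rightarrow> nat \<Rightarrow> real^2 \<Rightarrow> real" where
  "approximant a b X n u = (\<Sum>i\<in>grid_window n. \<Sum>j\<in>grid_window n.
     X (grid_point n i j) * (\<phi> a (2 ^ n * u $ 1 - of_int i) * \<phi> b (2 ^ n * u $ 2 - of_int j)))"

lemma approximant_has_derivative: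
  assumes a: "a < K" and b: "b < K"
  shows "(approximant a b X n has_derivative
    (\<lambda>h. 2 ^ n * (h $ 1 * approximant (Suc a) b X n u + h $ 2 * approximant a (Suc b) X n u))) (at u)"
proof -
  have comp: "((\<lambda>u. \<phi> a (2 ^ n * u $ k - of_int i)) has_derivative
      (\<lambda>h. 2 ^ n * h $ k * \<phi> (Suc a) (2 ^ n * u $ k - of_int i))) (at u)" if "a < K" for a i and k :: 2
  proof -
    have "((\<lambda>u. 2 ^ n * u $ k - of_int i) has_derivative (\<lambda>h. 2 ^ n * h $ k)) (at u)"
      by (auto intro!: derivative_eq_intros bounded_linear.has_derivative[OF bounded_linear_vec_nth])
    from DERIV_compose_FDERIV[OF deriv[OF that] this] show ?thesis by (simp add: mult_ac)
  qed
  have "((\<lambda>u. X (grid_point n i j) * (\<phi> a (2 ^ n * u $ 1 - of_int i) * \<phi> b (2 ^ n * u $ 2 - of_int j))) has_derivative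
     (\<lambda>h. X (grid_point n i j) * (\<phi> a (2 ^ n * u $ 1 - of_int i) * (2 ^ n * h $ 2 * \<phi> (Suc b) (2 ^ n * u $ 2 - of_int j))
       + (2 ^ n * h $ 1 * \<phi> (Suc a) (2 ^ n * u $ 1 - of_int i)) * \<phi> b (2 ^ n * u $ 2 - of_int j)))) (at u)" for i j
    by (intro has_derivative_mult_right has_derivative_mult comp a b)
  then have "(approximant a b X n has_derivative (\<lambda>h::real^2. \<Sum>i\<in>grid_window n. \<Sum>j\<in>grid_window n.
     X (grid_point n i j) * (\<phi> a (2 ^ n * u $ 1 - of_int i) * (2 ^ n * h $ 2 * \<phi> (Suc b) (2 ^ n * u $ 2 - of_int j))
       + (2 ^ n * h $ 1 * \<phi> (Suc a) (2 ^ n * u $ 1 - of_int i)) * \<phi> b (2 ^ n * u $ 2 - of_int j)))) (at u)"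
    unfolding approximant_def by (intro has_derivative_sum)
  moreover have "(\<lambda>h::real^2. \<Sum>i\<in>grid_window n. \<Sum>j\<in>grid_window n.
     X (grid_point n i j) * (\<phi> a (2 ^ n * u $ 1 - of_int i) * (2 ^ n * h $ 2 * \<phi> (Suc b) (2 ^ n * u $ 2 - of_int j))
       + (2 ^ n * h $ 1 * \<phi> (Suc a) (2 ^ n * u $ 1 - of_int i)) * \<phi> b (2 ^ n * u $ 2 - of_int j)))
    = (\<lambda>h. 2 ^ n * (h $ 1 * approximant (Suc a) b X n u + h $ 2 * approximant a (Suc b) X n u))"
    unfolding approximant_def
    by (intro ext) (simp add: sum_distrib_left sum.distrib[symmetric] algebra_simps)
  ultimately show ?thesis by simp
qed

lemma iter_partial_approximant:
  "length js \<le> K \<Longrightarrow> iter_partial js (approximant 0 0 X n)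
     = (\<lambda>u. 2 ^ (n * length js) * approximant (count_list js 1) (count_list js 2) X n u)"
proof (induction js)
  case (Cons i js)
  let ?a = "count_list js 1" and ?b = "count_list js 2"
  have ab: "?a < K" "?b < K"
    using Cons.prems count_le_length[of js 1] count_le_length[of js 2] by auto
  show ?case
  proof
    fix u
    have "iter_partial (i # js) (approximant 0 0 X n) u = iter_partial [i] (\<lambda>u. 2 ^ (n * length js) * approximant ?a ?b X n u) u"
      using Cons by simp
    also have "\<dots> = 2 ^ (n * length js) * (2 ^ n * ((axis i 1 :: real^2) $ 1 * approximant (Suc ?a) ?b X n u
        + (axis i 1 :: real^2) $ 2 * approximant ?a (Suc ?b) X n u))"
      by (intro has_derivative_imp_partial has_derivative_mult_right approximant_has_derivative ab)
    also have "\<dots> = 2 ^ (n * length (i # js)) * approximant (count_list (i # js) 1) (count_list (i # js) 2) X n u"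
      using exhaust_2[of i] by (auto simp: axis_def power_add)
    finally show "iter_partial (i # js) (approximant 0 0 X n) u
        = 2 ^ (n * length (i # js)) * approximant (count_list (i # js) 1) (count_list (i # js) 2) X n u" .
  qed
qed simp

lemma approximant_continuous:
  assumes "a \<le> K" "b \<le> K"
  shows "continuous_on S (approximant a b X n)"
proof -
  have "continuous_on S (\<lambda>u::real^2. \<phi> a (2 ^ n * u $ k - of_int i))" if "a \<le> K" for a i k
    by (rule continuous_on_compose2[OF cont[OF that]]) (auto intro!: continuous_intros)
  then show ?thesis
    unfolding approximant_def using assms by (intro continuous_intros)
qed

lemma approximant_Ck_plane: "Ck_plane K (approximant 0 0 X n)"
  unfolding Ck_plane_def
proof (intro conjI allI impI)
  fix js :: "2 list" and u assume len: "length js < K"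
  have "count_list js 1 < K" "count_list js 2 < K"
    using len count_le_length[of js 1] count_le_length[of js 2] by auto
  from approximant_has_derivative[OF this, of X n u]
  show "iter_partial js (approximant 0 0 X n) differentiable at u"
    using len by (auto simp: iter_partial_approximant differentiable_def intro!: has_derivative_mult_right exI)
next
  fix js :: "2 list" assume len: "length js \<le> K"
  have "count_list js 1 \<le> K" "count_list js 2 \<le> K"
    using len count_le_length[of js 1] count_le_length[of js 2] by auto
  then show "continuous_on UNIV (iter_partial js (approximant 0 0 X n))"
    using len by (auto simp: iter_partial_approximant intro!: continuous_intros approximant_continuous)
qed

end

section \<open>Increments of the quasi-interpolants\<close>

context cardinal_function
begin

text \<open>Both levels are compared on the grid of mesh \<open>1 / 2\<close> in the rescaled variable \<open>t\<close>: these are the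
  weights of the node \<open>e / 2\<close> in the derivative of order \<open>a\<close> at \<open>t\<close> of the finer and of the coarser
  quasi-interpolant. The coarse one only uses even \<open>e\<close>.\<close>

definition fine_weight :: "nat \<Rightarrow> real \<Rightarrow> int \<Rightarrow> real" where
  "fine_weight a t e = 2 ^ a * \<phi> a (2 * t - of_int e)"

definition coarse_weight :: "nat \<Rightarrow> real \<Rightarrow> int \<Rightarrow> real" where
  "coarse_weight a t e = (if even e then \<phi> a (t - of_int (e div 2)) else 0)"

text \<open>The \<open>4 D + 4\<close> consecutive indices contain every \<open>e\<close> with \<open>\<bar>2 t - e\<bar> < 2 D\<close>, which are the
  nodes that either weight can use.\<close>

definition window :: "real \<Rightarrow> int set" where
  "window t = {\<lfloor>2 * t\<rfloor> - int (2 * D + 1)..<\<lfloor>2 * t\<rfloor> - int (2 * D + 1) + int (4 * D + 4)}"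

lemma in_window: "\<bar>2 * t - of_int e\<bar> < 2 * real D \<Longrightarrow> e \<in> window t"
  unfolding window_def by (auto simp: abs_less_iff le_floor_iff) linarith+

lemma finite_window: "finite (window t)"
  by (simp add: window_def)

lemma fine_weight_outside: "a \<le> K \<Longrightarrow> e \<notin> window t \<Longrightarrow> fine_weight a t e = 0"
proof -
  assume a: "a \<le> K" and "e \<notin> window t"
  then have "\<not> \<bar>2 * t - of_int e\<bar> < 2 * real D" using in_window by blast
  then have "real D \<le> \<bar>2 * t - of_int e\<bar>" by linarith
  then show ?thesis by (simp add: fine_weight_def supp a)
qed

lemma coarse_weight_double: "coarse_weight a t (2 * i) = \<phi> a (t - of_int i)"
  by (simp add: coarse_weight_def)

lemma coarse_outside:
  assumes "a \<le> K" "2 * i \<notin> window t"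
  shows "\<phi> a (t - of_int i) = 0"
proof -
  have "\<not> \<bar>2 * t - of_int (2 * i)\<bar> < 2 * real D" using in_window assms by blast
  then have "real D \<le> \<bar>t - of_int i\<bar>" by simp
  then show ?thesis by (simp add: supp assms)
qed

lemma sum_coarse_weight:
  fixes g :: "int \<Rightarrow> real"
  assumes a: "a \<le> K" and J: "finite J" "\<And>i. 2 * i \<in> window t \<Longrightarrow> i \<in> J"
  shows "(\<Sum>e\<in>window t. g e * coarse_weight a t e) = (\<Sum>i\<in>J. g (2 * i) * \<phi> a (t - of_int i))"
proof -
  let ?I = "{i. 2 * i \<in> window t}"
  have inj: "inj_on (\<lambda>i::int. 2 * i) A" for A by (simp add: inj_on_def)
  have img: "(\<lambda>i. 2 * i) ` ?I = {e \<in> window t. even e}" by auto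
  have fin: "finite ?I"
    using finite_imageD[of "\<lambda>i::int. 2 * i" ?I] inj finite_window by (auto simp: img)
  have "(\<Sum>e\<in>window t. g e * coarse_weight a t e) = (\<Sum>e\<in>{e \<in> window t. even e}. g e * coarse_weight a t e)"
    using finite_window by (intro sum.mono_neutral_right) (auto simp: coarse_weight_def)
  also have "\<dots> = (\<Sum>i\<in>?I. g (2 * i) * \<phi> a (t - of_int i))"
    unfolding img[symmetric] by (subst sum.reindex[OF inj]) (simp add: coarse_weight_double)
  also have "\<dots> = (\<Sum>i\<in>J. g (2 * i) * \<phi> a (t - of_int i))"
    using J a coarse_outside by (intro sum.mono_neutral_left) auto
  finally show ?thesis .
qed

text \<open>Both levels reproduce \<open>p\<close>, so both sums are the derivative of order \<open>a\<close> of the polynomial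
  \<open>x \<mapsto> p (2 x)\<close> at \<open>t\<close>.\<close>

lemma weights_annihilate:
  assumes a: "a \<le> K" and p: "degree p < m"
  shows "(\<Sum>e\<in>window t. (fine_weight a t e - coarse_weight a t e) * poly p (of_int e)) = 0"
proof -
  have fine: "(\<Sum>e\<in>window t. poly p (of_int e) * fine_weight a t e) = 2 ^ a * poly ((pderiv ^^ a) p) (2 * t)"
  proof -
    have "(\<Sum>e\<in>window t. poly p (of_int e) * \<phi> a (2 * t - of_int e)) = poly ((pderiv ^^ a) p) (2 * t)"
      using in_window by (intro repro a p finite_window) auto
    then show ?thesis
      by (simp add: fine_weight_def mult.left_commute[of _ "2 ^ a"] flip: sum_distrib_left)
  qed
  define q where "q = pcompose p [:0, 2:]"
  have q: "degree q < m" using p by (simp add: q_def degree_pcompose)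
  have dq: "(pderiv ^^ r) q = smult (2 ^ r) (pcompose ((pderiv ^^ r) p) [:0, 2:])" for r
    by (induction r) (simp_all add: q_def pderiv_smult pderiv_pcompose pderiv_pCons mult.commute)
  define J where "J = {i::int. \<bar>t - of_int i\<bar> < real D} \<union> {i. 2 * i \<in> window t}"
  have "{i. 2 * i \<in> window t} \<subseteq> (\<lambda>e. e div 2) ` window t" by force
  then have J: "finite J" using finite_int_near[of t "real D"] finite_window
    by (auto simp: J_def intro: finite_subset)
  have "(\<Sum>e\<in>window t. poly p (of_int e) * coarse_weight a t e) = (\<Sum>i\<in>J. poly p (of_int (2 * i)) * \<phi> a (t - of_int i))"
    by (rule sum_coarse_weight[OF a J]) (simp add: J_def)
  also have "\<dots> = (\<Sum>i\<in>J. poly q (of_int i) * \<phi> a (t - of_int i))"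
    by (simp add: q_def poly_pcompose mult.commute)
  also have "\<dots> = poly ((pderiv ^^ a) q) t"
    by (intro repro a q J) (auto simp: J_def)
  also have "\<dots> = 2 ^ a * poly ((pderiv ^^ a) p) (2 * t)"
    by (simp add: dq poly_pcompose mult.commute)
  finally have "(\<Sum>e\<in>window t. poly p (of_int e) * coarse_weight a t e) = 2 ^ a * poly ((pderiv ^^ a) p) (2 * t)" .
  moreover have "(\<Sum>e\<in>window t. (fine_weight a t e - coarse_weight a t e) * poly p (of_int e))
     = (\<Sum>e\<in>window t. poly p (of_int e) * fine_weight a t e) - (\<Sum>e\<in>window t. poly p (of_int e) * coarse_weight a t e)"
    by (simp add: sum_subtractf[symmetric] algebra_simps)
  ultimately show ?thesis
    using fine by simp
qed

lemma B_nonneg: "0 \<le> B"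
  using bound[of 0 0] by linarith

lemma abs_fine_weight: "a \<le> K \<Longrightarrow> \<bar>fine_weight a t e\<bar> \<le> 2 ^ K * B"
  unfolding fine_weight_def abs_mult by (intro mult_mono bound) (auto intro: power_increasing)

lemma abs_coarse_weight: "a \<le> K \<Longrightarrow> \<bar>coarse_weight a t e\<bar> \<le> 2 ^ K * B"
proof -
  assume a: "a \<le> K"
  have "\<bar>coarse_weight a t e\<bar> \<le> 1 * B" using bound[OF a] B_nonneg by (auto simp: coarse_weight_def)
  also have "\<dots> \<le> 2 ^ K * B" by (intro mult_right_mono B_nonneg) simp
  finally show ?thesis .
qed

lemma card_window: "card (window t) = 4 * D + 4"
  by (simp add: window_def)

definition level_const :: real where
  "level_const = 2 * (real (4 * D + 4) * (2 ^ K * B)) * (real (4 * D + 4) * (2 * (2 ^ K * B)) * (1 + 2 ^ m) ^ (4 * D + 4))"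

lemma weight_difference_bound:
  assumes m: "m \<ge> 1" and a: "a \<le> K"
    and d: "\<And>e. e \<in> window t \<Longrightarrow> \<bar>(fdiff 1 ^^ m) g e\<bar> \<le> \<delta>" and \<delta>: "0 \<le> \<delta>"
  shows "\<bar>\<Sum>e\<in>window t. (fine_weight a t e - coarse_weight a t e) * g e\<bar>
    \<le> real (4 * D + 4) * (2 * (2 ^ K * B)) * ((1 + 2 ^ m) ^ (4 * D + 4) * \<delta>)"
proof -
  have "\<bar>\<Sum>e\<in>window t. (fine_weight a t e - coarse_weight a t e) * g e\<bar>
     \<le> (\<Sum>e\<in>window t. \<bar>fine_weight a t e - coarse_weight a t e\<bar>) * ((1 + 2 ^ m) ^ (4 * D + 4) * \<delta>)"
    unfolding window_def
  proof (rule annihilating_functional_bound[OF m _ _ \<delta>])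
    show "(\<Sum>e\<in>{\<lfloor>2 * t\<rfloor> - int (2 * D + 1)..<\<lfloor>2 * t\<rfloor> - int (2 * D + 1) + int (4 * D + 4)}.
        (fine_weight a t e - coarse_weight a t e) * poly p (of_int e)) = 0" if "degree p < m" for p
      using weights_annihilate[OF a that, of t] by (simp only: window_def)
    show "\<bar>(fdiff 1 ^^ m) g (\<lfloor>2 * t\<rfloor> - int (2 * D + 1) + int j)\<bar> \<le> \<delta>" if "j + m < 4 * D + 4" for j
      using that by (intro d) (simp add: window_def)
  qed
  also have "(\<Sum>e\<in>window t. \<bar>fine_weight a t e - coarse_weight a t e\<bar>) \<le> (\<Sum>e\<in>window t. 2 * (2 ^ K * B))"
    using abs_fine_weight[OF a, of t] abs_coarse_weight[OF a, of t]
    by (intro sum_mono) (smt (verit))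
  finally show ?thesis
    using \<delta> by (simp add: card_window mult_right_mono)
qed

text \<open>The difference of two tensor products is split as \<open>f f' - c c' = (f - c) f' + c (f' - c')\<close>. In each term one variable
  carries an annihilating functional, so only differences in the coordinate directions are needed.\<close>

lemma level_difference_bound:
  fixes G :: "int \<Rightarrow> int \<Rightarrow> real"
  assumes m: "m \<ge> 1" and ab: "a \<le> K" "b \<le> K" and \<delta>: "0 \<le> \<delta>"
    and d1: "\<And>e e'. e \<in> window t \<Longrightarrow> e' \<in> window t' \<Longrightarrow> \<bar>(fdiff 1 ^^ m) (\<lambda>e. G e e') e\<bar> \<le> \<delta>"
    and d2: "\<And>e e'. e \<in> window t \<Longrightarrow> e' \<in> window t' \<Longrightarrow> \<bar>(fdiff 1 ^^ m) (G e) e'\<bar> \<le> \<delta>"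
  shows "\<bar>(\<Sum>e\<in>window t. \<Sum>e'\<in>window t'. G e e' * (fine_weight a t e * fine_weight b t' e'))
     - (\<Sum>e\<in>window t. \<Sum>e'\<in>window t'. G e e' * (coarse_weight a t e * coarse_weight b t' e'))\<bar>
    \<le> level_const * \<delta>"
proof -
  let ?f = "fine_weight a t" and ?c = "coarse_weight a t" and ?f' = "fine_weight b t'" and ?c' = "coarse_weight b t'"
  let ?Q = "real (4 * D + 4) * (2 * (2 ^ K * B)) * ((1 + 2 ^ m) ^ (4 * D + 4) * \<delta>)"
  have Q: "0 \<le> ?Q" using B_nonneg \<delta> by simp
  have "(\<Sum>e\<in>window t. \<Sum>e'\<in>window t'. G e e' * (?f e * ?f' e'))
     - (\<Sum>e\<in>window t. \<Sum>e'\<in>window t'. G e e' * (?c e * ?c' e'))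
    = (\<Sum>e\<in>window t. \<Sum>e'\<in>window t'. ?f' e' * ((?f e - ?c e) * G e e'))
     + (\<Sum>e\<in>window t. \<Sum>e'\<in>window t'. ?c e * ((?f' e' - ?c' e') * G e e'))"
    by (simp add: sum_subtractf[symmetric] sum.distrib[symmetric] algebra_simps)
  also have "(\<Sum>e\<in>window t. \<Sum>e'\<in>window t'. ?f' e' * ((?f e - ?c e) * G e e'))
    = (\<Sum>e'\<in>window t'. ?f' e' * (\<Sum>e\<in>window t. (?f e - ?c e) * G e e'))"
    by (subst sum.swap) (simp add: sum_distrib_left)
  finally have eq: "(\<Sum>e\<in>window t. \<Sum>e'\<in>window t'. G e e' * (?f e * ?f' e'))
     - (\<Sum>e\<in>window t. \<Sum>e'\<in>window t'. G e e' * (?c e * ?c' e'))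
    = (\<Sum>e'\<in>window t'. ?f' e' * (\<Sum>e\<in>window t. (?f e - ?c e) * G e e'))
     + (\<Sum>e\<in>window t. ?c e * (\<Sum>e'\<in>window t'. (?f' e' - ?c' e') * G e e'))"
    by (simp add: sum_distrib_left)
  have 1: "\<bar>\<Sum>e'\<in>window t'. ?f' e' * (\<Sum>e\<in>window t. (?f e - ?c e) * G e e')\<bar>
      \<le> (\<Sum>e'\<in>window t'. (2 ^ K * B) * ?Q)"
  proof (intro order_trans[OF sum_abs] sum_mono)
    fix e' assume "e' \<in> window t'"
    then have "\<bar>\<Sum>e\<in>window t. (?f e - ?c e) * G e e'\<bar> \<le> ?Q"
      by (intro weight_difference_bound m ab \<delta> d1)
    then show "\<bar>?f' e' * (\<Sum>e\<in>window t. (?f e - ?c e) * G e e')\<bar> \<le> (2 ^ K * B) * ?Q"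
      unfolding abs_mult[of "?f' e'"] using B_nonneg by (intro mult_mono abs_fine_weight ab) auto
  qed
  have 2: "\<bar>\<Sum>e\<in>window t. ?c e * (\<Sum>e'\<in>window t'. (?f' e' - ?c' e') * G e e')\<bar>
      \<le> (\<Sum>e\<in>window t. (2 ^ K * B) * ?Q)"
  proof (intro order_trans[OF sum_abs] sum_mono)
    fix e assume "e \<in> window t"
    then have "\<bar>\<Sum>e'\<in>window t'. (?f' e' - ?c' e') * G e e'\<bar> \<le> ?Q"
      by (intro weight_difference_bound m ab \<delta> d2)
    then show "\<bar>?c e * (\<Sum>e'\<in>window t'. (?f' e' - ?c' e') * G e e')\<bar> \<le> (2 ^ K * B) * ?Q"
      unfolding abs_mult[of "?c e"] using B_nonneg by (intro mult_mono abs_coarse_weight ab) auto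
  qed
  have "(\<Sum>e'\<in>window t'. (2 ^ K * B) * ?Q) + (\<Sum>e\<in>window t. (2 ^ K * B) * ?Q) = level_const * \<delta>"
    by (simp add: card_window level_const_def algebra_simps)
  then show ?thesis
    unfolding eq using 1 2 by linarith
qed

text \<open>The hypotheses on \<open>R\<close> ensure that the windows around \<open>u\<close> lie inside the truncated grids.\<close>

lemma approximant_level_difference:
  fixes u :: "real^2"
  assumes m: "m \<ge> 1" and ab: "a \<le> K" "b \<le> K" and \<delta>: "0 \<le> \<delta>"
    and R: "\<bar>u $ 1\<bar> \<le> R" "\<bar>u $ 2\<bar> \<le> R" "R + 2 * real D + 3 \<le> 2 ^ n"
    and d: "\<And>i j. \<bar>of_int i\<bar> \<le> (R + 2 * real D + 3) * 2 ^ Suc n \<Longrightarrow> \<bar>of_int j\<bar> \<le> (R + 2 * real D + 3) * 2 ^ Suc n \<Longrightarrow>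
        \<bar>(fdiff 1 ^^ m) (\<lambda>e. X (grid_point (Suc n) e j)) i\<bar> \<le> \<delta> \<and>
        \<bar>(fdiff 1 ^^ m) (\<lambda>e. X (grid_point (Suc n) i e)) j\<bar> \<le> \<delta>"
  shows "\<bar>2 ^ (a + b) * approximant a b X (Suc n) u - approximant a b X n u\<bar> \<le> level_const * \<delta>"
proof -
  let ?G = "\<lambda>e e'. X (grid_point (Suc n) e e')"
  define t where "t k = 2 ^ n * u $ k" for k :: 2
  define c where "c = R + 2 * real D + 3"
  have win: "\<bar>of_int e\<bar> \<le> c * 2 ^ Suc n" if e: "e \<in> window (t k)" for e k
  proof -
    have "\<bar>u $ k\<bar> \<le> R" using R exhaust_2[of k] by auto
    then have "\<bar>t k\<bar> \<le> R * 2 ^ n" by (simp add: t_def abs_mult mult.commute)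
    then have "\<bar>2 * t k\<bar> \<le> R * 2 ^ Suc n" by simp
    moreover have "\<bar>of_int e - 2 * t k\<bar> \<le> 2 * real D + 3"
      using e unfolding window_def by (simp add: abs_le_iff) linarith
    moreover have "(2 * real D + 3) * 1 \<le> (2 * real D + 3) * 2 ^ Suc n"
      by (intro mult_left_mono one_le_power) auto
    moreover have "\<bar>x\<bar> \<le> p \<Longrightarrow> \<bar>y - x\<bar> \<le> q \<Longrightarrow> q * 1 \<le> s \<Longrightarrow> \<bar>y\<bar> \<le> p + s" for x y p q s :: real
      by linarith
    ultimately have "\<bar>of_int e\<bar> \<le> R * 2 ^ Suc n + (2 * real D + 3) * 2 ^ Suc n" by metis
    then show ?thesis by (simp add: c_def algebra_simps)
  qed
  have c: "c \<le> 2 ^ n" using R by (simp add: c_def)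
  have "c \<le> 2 ^ Suc n" using order_trans[OF c power_increasing[of n "Suc n" 2]] by simp
  then have grid_fine: "window (t k) \<subseteq> grid_window (Suc n)" for k
    using in_grid_windowI[OF win] by blast
  have grid_coarse: "i \<in> grid_window n" if "2 * i \<in> window (t k)" for i k
    using win[OF that] by (intro in_grid_windowI[OF _ c]) simp
  have fg: "finite (grid_window n)" for n by (simp add: grid_window_def)
  have fine: "2 ^ (a + b) * approximant a b X (Suc n) u
     = (\<Sum>e\<in>window (t 1). \<Sum>e'\<in>window (t 2). ?G e e' * (fine_weight a (t 1) e * fine_weight b (t 2) e'))"
  proof -
    have "2 ^ (a + b) * approximant a b X (Suc n) u
      = (\<Sum>e\<in>grid_window (Suc n). \<Sum>e'\<in>grid_window (Suc n). ?G e e' * (fine_weight a (t 1) e * fine_weight b (t 2) e'))"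
      unfolding approximant_def fine_weight_def t_def
      by (simp add: sum_distrib_left power_add mult_ac)
    also have "\<dots> = (\<Sum>e\<in>window (t 1). \<Sum>e'\<in>grid_window (Suc n). ?G e e' * (fine_weight a (t 1) e * fine_weight b (t 2) e'))"
      using grid_fine fg ab by (intro sum.mono_neutral_right) (auto simp: fine_weight_outside)
    also have "\<dots> = (\<Sum>e\<in>window (t 1). \<Sum>e'\<in>window (t 2). ?G e e' * (fine_weight a (t 1) e * fine_weight b (t 2) e'))"
      using grid_fine fg ab by (intro sum.cong refl sum.mono_neutral_right) (auto simp: fine_weight_outside)
    finally show ?thesis .
  qed
  have coarse: "approximant a b X n u
     = (\<Sum>e\<in>window (t 1). \<Sum>e'\<in>window (t 2). ?G e e' * (coarse_weight a (t 1) e * coarse_weight b (t 2) e'))"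
  proof -
    have "(\<Sum>e\<in>window (t 1). \<Sum>e'\<in>window (t 2). ?G e e' * (coarse_weight a (t 1) e * coarse_weight b (t 2) e'))
      = (\<Sum>e\<in>window (t 1). (\<Sum>e'\<in>window (t 2). ?G e e' * coarse_weight b (t 2) e') * coarse_weight a (t 1) e)"
      by (simp add: sum_distrib_right sum_distrib_left mult_ac)
    also have "\<dots> = (\<Sum>i\<in>grid_window n. (\<Sum>e'\<in>window (t 2). ?G (2 * i) e' * coarse_weight b (t 2) e') * \<phi> a (t 1 - of_int i))"
      by (intro sum_coarse_weight ab fg grid_coarse)
    also have "\<dots> = (\<Sum>i\<in>grid_window n. (\<Sum>j\<in>grid_window n. ?G (2 * i) (2 * j) * \<phi> b (t 2 - of_int j)) * \<phi> a (t 1 - of_int i))"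
      by (intro sum.cong refl arg_cong2[where f = "(*)"] sum_coarse_weight ab fg grid_coarse)
    finally show ?thesis
      unfolding grid_point_refine
      by (simp add: approximant_def t_def sum_distrib_right sum_distrib_left mult_ac)
  qed
  show ?thesis
    unfolding fine coarse
  proof (rule level_difference_bound[OF m ab \<delta>])
    fix e e' assume "e \<in> window (t 1)" "e' \<in> window (t 2)"
    then have "\<bar>(fdiff 1 ^^ m) (\<lambda>e. ?G e e') e\<bar> \<le> \<delta> \<and> \<bar>(fdiff 1 ^^ m) (\<lambda>e'. ?G e e') e'\<bar> \<le> \<delta>"
      using win unfolding c_def by (intro d)
    then show "\<bar>(fdiff 1 ^^ m) (\<lambda>e. ?G e e') e\<bar> \<le> \<delta>" "\<bar>(fdiff 1 ^^ m) (?G e) e'\<bar> \<le> \<delta>" by auto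
  qed
qed

text \<open>The deterministic core: decay of the coordinate differences on dyadic grids implies that the quasi-interpolants
  converge to a function of the corresponding Hoelder class.\<close>

theorem grid_differences_imp_hoelder:
  assumes m: "m \<ge> 1" and K: "Suc k \<le> K"
    and d: "\<And>r. \<exists>C. \<forall>n i j. \<bar>real_of_int i\<bar> \<le> r * 2 ^ n \<longrightarrow> \<bar>real_of_int j\<bar> \<le> r * 2 ^ n \<longrightarrow>
        \<bar>(fdiff 1 ^^ m) (\<lambda>e. X (grid_point n e j)) i\<bar> \<le> C * 2 powr (- (real n * \<gamma>)) \<and>
        \<bar>(fdiff 1 ^^ m) (\<lambda>e. X (grid_point n i e)) j\<bar> \<le> C * 2 powr (- (real n * \<gamma>))"
    and \<gamma>: "real k \<le> \<gamma>'" "\<gamma>' < \<gamma>" "\<gamma>' \<le> real k + 1"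
  shows "\<And>u. convergent (\<lambda>n. approximant 0 0 X n u)"
    and "holder_Ck k (\<gamma>' - real k) (\<lambda>u. lim (\<lambda>n. approximant 0 0 X n u))"
proof -
  have bnd: "\<exists>C N. \<forall>n\<ge>N. \<forall>js. length js \<le> Suc k \<longrightarrow> (\<forall>u\<in>ball 0 r.
       \<bar>iter_partial js (approximant 0 0 X (Suc n)) u - iter_partial js (approximant 0 0 X n) u\<bar>
        \<le> C * 2 powr (real n * (real (length js) - \<gamma>)))" for r
  proof -
    define c where "c = r + 2 * real D + 3"
    obtain C where C: "\<And>n i j. \<bar>real_of_int i\<bar> \<le> c * 2 ^ n \<Longrightarrow> \<bar>real_of_int j\<bar> \<le> c * 2 ^ n \<Longrightarrow>
        \<bar>(fdiff 1 ^^ m) (\<lambda>e. X (grid_point n e j)) i\<bar> \<le> C * 2 powr (- (real n * \<gamma>)) \<and>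
        \<bar>(fdiff 1 ^^ m) (\<lambda>e. X (grid_point n i e)) j\<bar> \<le> C * 2 powr (- (real n * \<gamma>))"
      using d[of c] by blast
    obtain N where N: "c \<le> 2 ^ N"
      using real_arch_pow[of 2 c] by (auto intro: less_imp_le)
    have "\<bar>iter_partial js (approximant 0 0 X (Suc n)) u - iter_partial js (approximant 0 0 X n) u\<bar>
        \<le> (level_const * \<bar>C\<bar>) * 2 powr (real n * (real (length js) - \<gamma>))"
      if n: "n \<ge> N" and js: "length js \<le> Suc k" and u: "u \<in> ball 0 r" for n js u
    proof -
      define a b where "a = count_list js 1" and "b = count_list js 2"
      have cnt: "a + b = length js"
      proof -
        have "count_list js 1 + count_list js 2 = length js" for js :: "2 list"
        proof (induction js)
          case (Cons i js)
          then show ?case using exhaust_2[of i] by auto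
        qed simp
        then show ?thesis by (simp add: a_def b_def)
      qed
      then have ab: "a \<le> K" "b \<le> K" using js K by auto
      define \<delta> where "\<delta> = \<bar>C\<bar> * 2 powr (- (real (Suc n) * \<gamma>))"
      have lev: "\<bar>2 ^ (a + b) * approximant a b X (Suc n) u - approximant a b X n u\<bar> \<le> level_const * \<delta>"
      proof (rule approximant_level_difference[OF m ab, where R = r])
        show "0 \<le> \<delta>" by (simp add: \<delta>_def)
        show "\<bar>u $ 1\<bar> \<le> r" "\<bar>u $ 2\<bar> \<le> r" using u component_le_norm_cart[of u] by (auto intro: order_trans less_imp_le)
        have "(2::real) ^ N \<le> 2 ^ n" using n by (intro power_increasing) auto
        then show "r + 2 * real D + 3 \<le> 2 ^ n" using N unfolding c_def by linarith
        fix i j :: int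
        assume ij: "\<bar>of_int i\<bar> \<le> (r + 2 * real D + 3) * 2 ^ Suc n" "\<bar>of_int j\<bar> \<le> (r + 2 * real D + 3) * 2 ^ Suc n"
        have "C * 2 powr (- (real (Suc n) * \<gamma>)) \<le> \<delta>"
          unfolding \<delta>_def by (intro mult_right_mono) auto
        then show "\<bar>(fdiff 1 ^^ m) (\<lambda>e. X (grid_point (Suc n) e j)) i\<bar> \<le> \<delta> \<and>
          \<bar>(fdiff 1 ^^ m) (\<lambda>e. X (grid_point (Suc n) i e)) j\<bar> \<le> \<delta>"
          using C[of i "Suc n" j] ij unfolding c_def by (meson order_trans)
      qed
      have lc: "0 \<le> level_const" using B_nonneg by (simp add: level_const_def)
      have \<delta>le: "\<delta> \<le> \<bar>C\<bar> * 2 powr (- (real n * \<gamma>))"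
        unfolding \<delta>_def using \<gamma> by (intro mult_left_mono powr_mono) (auto simp: algebra_simps)
      have "iter_partial js (approximant 0 0 X (Suc n)) u - iter_partial js (approximant 0 0 X n) u
          = 2 ^ (n * length js) * (2 ^ (a + b) * approximant a b X (Suc n) u - approximant a b X n u)"
        using js K by (simp add: iter_partial_approximant a_def[symmetric] b_def[symmetric] cnt power_add algebra_simps)
      then have "\<bar>iter_partial js (approximant 0 0 X (Suc n)) u - iter_partial js (approximant 0 0 X n) u\<bar>
          = 2 ^ (n * length js) * \<bar>2 ^ (a + b) * approximant a b X (Suc n) u - approximant a b X n u\<bar>"
        by (simp add: abs_mult)
      also have "\<dots> \<le> 2 ^ (n * length js) * (level_const * (\<bar>C\<bar> * 2 powr (- (real n * \<gamma>))))"
        using lev \<delta>le lc by (intro mult_left_mono order_trans[OF lev]) auto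
      also have "\<dots> = (level_const * \<bar>C\<bar>) * (2 powr real (n * length js) * 2 powr (- (real n * \<gamma>)))"
      proof -
        have "2 powr real (n * length js) = 2 ^ (n * length js)" by (rule powr_realpow) simp
        then show ?thesis by (simp only: mult_ac)
      qed
      also have "2 powr real (n * length js) * 2 powr (- (real n * \<gamma>)) = 2 powr (real n * (real (length js) - \<gamma>))"
        by (simp add: algebra_simps flip: powr_add)
      finally show ?thesis .
    qed
    then show ?thesis by blast
  qed
  have conv: "convergent (\<lambda>n. approximant 0 0 X n u)" for u
  proof -
    obtain C N where C: "\<forall>n\<ge>N. \<forall>js. length js \<le> Suc k \<longrightarrow> (\<forall>v\<in>ball 0 (norm u + 1).
       \<bar>iter_partial js (approximant 0 0 X (Suc n)) v - iter_partial js (approximant 0 0 X n) v\<bar>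
        \<le> C * 2 powr (real n * (real (length js) - \<gamma>)))"
      using bnd by blast
    have "\<bar>approximant 0 0 X (Suc n) u - approximant 0 0 X n u\<bar> \<le> C * (2 powr - \<gamma>) ^ n" if "n \<ge> N" for n
      using C[rule_format, OF that, of "[]" u] by (simp add: powr_power mult.commute)
    moreover have "2 powr - \<gamma> < 1" using \<gamma> powr_less_mono[of "- \<gamma>" 0 2] by simp
    ultimately show ?thesis
      by (intro geometric_increments_convergent[of N _ C "2 powr - \<gamma>"]) auto
  qed
  then show "\<And>u. convergent (\<lambda>n. approximant 0 0 X n u)" .
  have CkK: "Ck_plane (Suc k) g" if "Ck_plane K g" for g
    using that K by (auto simp: Ck_plane_def)
  show "holder_Ck k (\<gamma>' - real k) (\<lambda>u. lim (\<lambda>n. approximant 0 0 X n u))"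
  proof (rule multiscale_limit[OF _ bnd \<gamma>])
    show "Ck_plane (Suc k) (approximant 0 0 X n)" for n
      by (rule CkK[OF approximant_Ck_plane])
    show "(\<lambda>n. approximant 0 0 X n u) \<longlonglongrightarrow> lim (\<lambda>n. approximant 0 0 X n u)" for u
      using conv[of u] convergent_LIMSEQ_iff by blast
  qed
qed

end

section \<open>Gaussian variables and the variance of differences\<close>

text \<open>The point masses are included; for them a vanishing mean makes the variable vanish almost surely. The bound by the factorial is
  crude but uniform in the variance.\<close>

lemma (in prob_space) gaussian_rv_moments:
  assumes "gaussian_rv M Z"
  shows "integrable M Z" "integrable M (\<lambda>w. (Z w)\<^sup>2)"
    and "expectation Z = 0 \<Longrightarrow> integrable M (\<lambda>w. Z w ^ (2 * q))"
    and "expectation Z = 0 \<Longrightarrow>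
      expectation (\<lambda>w. Z w ^ (2 * q)) \<le> fact (2 * q) * expectation (\<lambda>w. (Z w)\<^sup>2) ^ q"
proof -
  have [measurable]: "Z \<in> borel_measurable M" using assms by (simp add: gaussian_rv_def)
  have D: "(\<exists>\<mu>. distr M borel Z = return borel \<mu>) \<or>
      (\<exists>\<mu> \<sigma>. 0 < \<sigma> \<and> distributed M lborel Z (\<lambda>t. ennreal (normal_density \<mu> \<sigma> t)))"
    using assms unfolding gaussian_rv_def by blast
  have *: "integrable M Z \<and> integrable M (\<lambda>w. (Z w)\<^sup>2) \<and> (expectation Z = 0 \<longrightarrow>
     integrable M (\<lambda>w. Z w ^ (2 * q)) \<and>
     expectation (\<lambda>w. Z w ^ (2 * q)) \<le> fact (2 * q) * expectation (\<lambda>w. (Z w)\<^sup>2) ^ q)"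
    using D
  proof (elim disjE exE conjE)
    fix \<mu> assume r: "distr M borel Z = return borel \<mu>"
    have i: "integrable M (\<lambda>w. f (Z w))" "expectation (\<lambda>w. f (Z w)) = f \<mu>"
      if [measurable]: "f \<in> borel_measurable borel" for f :: "real \<Rightarrow> real"
    proof -
      interpret r: prob_space "return borel \<mu>" by (rule prob_space_return) simp
      have "integrable (return borel \<mu>) (\<lambda>_. f \<mu>)" by simp
      then have "integrable (return borel \<mu>) f"
        by (rule integrable_cong_AE_imp) (auto simp: AE_return)
      then show "integrable M (\<lambda>w. f (Z w))" by (simp add: r[symmetric] integrable_distr_eq)
      have "expectation (\<lambda>w. f (Z w)) = (\<integral>x. f x \<partial>distr M borel Z)" by (simp add: integral_distr)
      then show "expectation (\<lambda>w. f (Z w)) = f \<mu>" by (simp add: r integral_return)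
    qed
    have "x \<le> fact (2 * q) * x" if "0 \<le> x" for x :: real
      using mult_right_mono[OF fact_ge_1 that, of "2 * q"] by simp
    then show ?thesis
      using i[of "\<lambda>x. x"] i[of "\<lambda>x. x\<^sup>2"] i[of "\<lambda>x. x ^ (2 * q)"] by (simp add: power_mult)
  next
    fix \<mu> \<sigma> :: real
    assume \<sigma>: "0 < \<sigma>" and d: "distributed M lborel Z (\<lambda>t. ennreal (normal_density \<mu> \<sigma> t))"
    have i1: "integrable M Z"
      using distributed_integrable[OF d, of "\<lambda>x. x"] integrable_normal_moment_nz_1[OF \<sigma>, of \<mu>] by simp
    have ic: "integrable M (\<lambda>w. (Z w - \<mu>) ^ (2 * j))" for j
      using distributed_integrable[OF d, of "\<lambda>x. (x - \<mu>) ^ (2 * j)"] integrable_normal_moment[OF \<sigma>, of \<mu> "2 * j"] by simp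
    have ec: "expectation (\<lambda>w. (Z w - \<mu>) ^ (2 * j)) = fact (2 * j) / ((2 / \<sigma>\<^sup>2) ^ j * fact j)" for j
      using distributed_integral[OF d, of "\<lambda>x. (x - \<mu>) ^ (2 * j)"] integral_normal_moment_even[OF \<sigma>, of \<mu> j] by simp
    have i2: "integrable M (\<lambda>w. (Z w)\<^sup>2)"
    proof -
      have "integrable M (\<lambda>w. (Z w - \<mu>) ^ (2 * 1) + 2 * \<mu> * Z w - \<mu>\<^sup>2)"
        using ic[of 1] i1 by simp
      then show ?thesis by (simp add: power2_eq_square algebra_simps)
    qed
    have e: "expectation Z = \<mu>" by (rule normal_distributed_expectation[OF \<sigma> d])
    have "expectation (\<lambda>w. Z w ^ (2 * q)) \<le> fact (2 * q) * expectation (\<lambda>w. (Z w)\<^sup>2) ^ q" if "\<mu> = 0"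
    proof -
      have v: "expectation (\<lambda>w. (Z w)\<^sup>2) = \<sigma>\<^sup>2" using ec[of 1] that \<sigma> by simp
      have "expectation (\<lambda>w. Z w ^ (2 * q)) = (\<sigma>\<^sup>2) ^ q * (fact (2 * q) / (2 ^ q * fact q))"
        using ec[of q] that \<sigma> by (simp add: power_divide field_simps)
      also have "\<dots> \<le> (\<sigma>\<^sup>2) ^ q * fact (2 * q)"
      proof (intro mult_left_mono)
        have "(1::real) * 1 \<le> 2 ^ q * fact q" by (intro mult_mono) (auto simp: fact_ge_1)
        then show "(fact (2 * q) :: real) / (2 ^ q * fact q) \<le> fact (2 * q)"
          by (simp add: divide_le_eq mult_left_mono[of 1 _ "fact (2 * q)", simplified])
      qed simp
      finally show ?thesis by (simp add: v mult.commute)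
    qed
    then show ?thesis using i1 i2 e ic[of q] by auto
  qed
  then show "integrable M Z" "integrable M (\<lambda>w. (Z w)\<^sup>2)"
    "expectation Z = 0 \<Longrightarrow> integrable M (\<lambda>w. Z w ^ (2 * q))"
    "expectation Z = 0 \<Longrightarrow> expectation (\<lambda>w. Z w ^ (2 * q)) \<le> fact (2 * q) * expectation (\<lambda>w. (Z w)\<^sup>2) ^ q"
    by blast+
qed

lemma (in prob_space) gaussian_rv_tail:
  assumes Z: "gaussian_rv M Z" "expectation Z = 0" and s: "expectation (\<lambda>w. (Z w)\<^sup>2) \<le> s" and t: "0 < t"
  shows "prob {w \<in> space M. t < \<bar>Z w\<bar>} \<le> fact (2 * q) * (s / t\<^sup>2) ^ q"
proof -
  have [measurable]: "Z \<in> borel_measurable M" using Z by (simp add: gaussian_rv_def)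
  have v0: "0 \<le> expectation (\<lambda>w. (Z w)\<^sup>2)" by simp
  have "prob {w \<in> space M. t < \<bar>Z w\<bar>} \<le> prob {w \<in> space M. t ^ (2 * q) \<le> Z w ^ (2 * q)}"
  proof (intro finite_measure_mono)
    show "{w \<in> space M. t < \<bar>Z w\<bar>} \<subseteq> {w \<in> space M. t ^ (2 * q) \<le> Z w ^ (2 * q)}"
    proof safe
      fix w assume "t < \<bar>Z w\<bar>"
      then have "t ^ (2 * q) \<le> \<bar>Z w\<bar> ^ (2 * q)" using t by (intro power_mono) auto
      then show "t ^ (2 * q) \<le> Z w ^ (2 * q)" by (simp add: power_mult)
    qed
  qed simp
  also have "\<dots> \<le> expectation (\<lambda>w. Z w ^ (2 * q)) / t ^ (2 * q)"
    by (rule integral_Markov_inequality_measure[where A = "{}"])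
      (use gaussian_rv_moments(3)[OF Z] t in \<open>auto simp: power_mult\<close>)
  also have "\<dots> \<le> fact (2 * q) * s ^ q / t ^ (2 * q)"
  proof (intro divide_right_mono order_trans[OF gaussian_rv_moments(4)[OF Z]] mult_left_mono power_mono s v0)
  qed (use t in auto)
  also have "\<dots> = fact (2 * q) * (s / t\<^sup>2) ^ q"
    by (simp add: power_divide power_mult)
  finally show ?thesis .
qed

text \<open>Fatou's lemma for the squares of the differences.\<close>

lemma AE_limit_unique_L2:
  fixes Y :: "nat \<Rightarrow> 'a \<Rightarrow> real"
  assumes [measurable]: "\<And>n. Y n \<in> borel_measurable M" "X \<in> borel_measurable M"
    and i: "\<And>n. integrable M (\<lambda>w. (Y n w - X w)\<^sup>2)"
    and lim: "(\<lambda>n. \<integral>w. (Y n w - X w)\<^sup>2 \<partial>M) \<longlonglongrightarrow> 0"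
    and conv: "AE w in M. (\<lambda>n. Y n w) \<longlonglongrightarrow> Z w"
  shows "AE w in M. Z w = X w"
proof -
  have "(\<integral>\<^sup>+ w. liminf (\<lambda>n. ennreal ((Y n w - X w)\<^sup>2)) \<partial>M) \<le> liminf (\<lambda>n. \<integral>\<^sup>+ w. ennreal ((Y n w - X w)\<^sup>2) \<partial>M)"
    by (rule nn_integral_liminf) simp
  also have "(\<lambda>n. \<integral>\<^sup>+ w. ennreal ((Y n w - X w)\<^sup>2) \<partial>M) = (\<lambda>n. ennreal (\<integral>w. (Y n w - X w)\<^sup>2 \<partial>M))"
    by (intro ext nn_integral_eq_integral i) simp
  also have "liminf \<dots> = ennreal 0"
    by (intro lim_imp_Liminf tendsto_ennrealI lim) simp
  finally have "(\<integral>\<^sup>+ w. liminf (\<lambda>n. ennreal ((Y n w - X w)\<^sup>2)) \<partial>M) = 0" by simp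
  then have "AE w in M. liminf (\<lambda>n. ennreal ((Y n w - X w)\<^sup>2)) = 0"
    by (subst (asm) nn_integral_0_iff_AE) simp_all
  with conv show ?thesis
  proof eventually_elim
    case (elim w)
    have "(\<lambda>n. ennreal ((Y n w - X w)\<^sup>2)) \<longlonglongrightarrow> ennreal ((Z w - X w)\<^sup>2)"
      by (intro tendsto_ennrealI tendsto_intros elim)
    then have "liminf (\<lambda>n. ennreal ((Y n w - X w)\<^sup>2)) = ennreal ((Z w - X w)\<^sup>2)"
      by (intro lim_imp_Liminf) simp
    then show ?case using elim(2) by (simp add: ennreal_eq_0_iff)
  qed
qed

text \<open>Centering makes the second moments in \<open>angular_power_spectrum\<close> the covariances.\<close>

locale gaussian_sphere_field = prob_space M for M :: "'w measure" +
  fixes T :: "'w \<Rightarrow> real^3 \<Rightarrow> real" and A :: "nat \<Rightarrow> real" and \<beta> :: real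
  assumes gauss: "gaussian_field M T" and cent: "centered M T" and spectrum: "angular_power_spectrum M T A"
    and \<beta>: "0 < \<beta>" and summable_spectrum: "summable (\<lambda>l. A l * real l powr (1 + \<beta>))"
begin

lemma A_nonneg: "0 \<le> A l"
  using spectrum by (simp add: angular_power_spectrum_def)

definition spectral_norm :: real where
  "spectral_norm = (\<Sum>l. A l * real l powr (1 + \<beta>))"

lemma spectral_norm_nonneg: "0 \<le> spectral_norm"
  unfolding spectral_norm_def by (intro suminf_nonneg summable_spectrum mult_nonneg_nonneg A_nonneg) auto

text \<open>Points may coincide for different indices \<open>k\<close>; their coefficients are added up.\<close>

lemma gaussian_linear_combination:
  assumes I: "finite I" and x: "\<And>k. k \<in> I \<Longrightarrow> x k \<in> sphere 0 1"
  shows "gaussian_rv M (\<lambda>w. \<Sum>k\<in>I. c k * T w (x k))"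
proof -
  have "multivariate_gaussian M (x ` I) (\<lambda>y w. T w y)"
    using gauss I x unfolding gaussian_field_def by (metis finite_imageI image_subsetI)
  then have "gaussian_rv M (\<lambda>w. \<Sum>y\<in>x ` I. (\<Sum>k\<in>{k \<in> I. x k = y}. c k) * T w y)"
    by (simp add: multivariate_gaussian_def)
  moreover have "(\<Sum>y\<in>x ` I. (\<Sum>k\<in>{k \<in> I. x k = y}. c k) * T w y) = (\<Sum>k\<in>I. c k * T w (x k))" for w
    unfolding sum.image_gen[OF I, of "\<lambda>k. c k * T w (x k)" x] by (simp add: sum_distrib_right)
  ultimately show ?thesis by simp
qed

lemma gaussian_T: "x \<in> sphere 0 1 \<Longrightarrow> gaussian_rv M (\<lambda>w. T w x)"
  using gaussian_linear_combination[of "{()}" "\<lambda>_. x" "\<lambda>_. 1"] by simp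

lemma measurable_T: "x \<in> sphere 0 1 \<Longrightarrow> (\<lambda>w. T w x) \<in> borel_measurable M"
  using gaussian_T by (simp add: gaussian_rv_def)

lemma integrable_T: "x \<in> sphere 0 1 \<Longrightarrow> integrable M (\<lambda>w. T w x)"
  using gaussian_rv_moments(1)[OF gaussian_T] .

lemma integrable_T_mult:
  assumes "x \<in> sphere 0 1" "y \<in> sphere 0 1"
  shows "integrable M (\<lambda>w. T w x * T w y)"
proof (rule Bochner_Integration.integrable_bound)
  show "integrable M (\<lambda>w. (T w x)\<^sup>2 + (T w y)\<^sup>2)"
    using assms by (intro Bochner_Integration.integrable_add gaussian_rv_moments(2) gaussian_T)
  show "(\<lambda>w. T w x * T w y) \<in> borel_measurable M" using measurable_T assms by simp
  have "\<bar>a * b\<bar> \<le> a\<^sup>2 + b\<^sup>2" for a b :: real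
  proof -
    have "0 \<le> (\<bar>a\<bar> - \<bar>b\<bar>)\<^sup>2" by simp
    then have "2 * \<bar>a * b\<bar> \<le> a\<^sup>2 + b\<^sup>2" by (simp add: power2_diff abs_mult)
    then show ?thesis by (smt (verit) abs_ge_zero)
  qed
  then show "AE w in M. norm (T w x * T w y) \<le> norm ((T w x)\<^sup>2 + (T w y)\<^sup>2)" by simp
qed

lemma expectation_linear_combination:
  assumes I: "finite I" and x: "\<And>k. k \<in> I \<Longrightarrow> x k \<in> sphere 0 1"
  shows "expectation (\<lambda>w. \<Sum>k\<in>I. c k * T w (x k)) = 0"
  using x cent integrable_T by (simp add: centered_def)

lemma square_linear_combination:
  assumes I: "finite I" and x: "\<And>k. k \<in> I \<Longrightarrow> x k \<in> sphere 0 1"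
  shows "(\<lambda>l. A l * ((2 * real l + 1) / (4 * pi)) *
       (\<Sum>k\<in>I. \<Sum>k'\<in>I. c k * c k' * poly (legendre_poly l) (x k \<bullet> x k')))
     sums expectation (\<lambda>w. (\<Sum>k\<in>I. c k * T w (x k))\<^sup>2)"
proof -
  have "expectation (\<lambda>w. (\<Sum>k\<in>I. c k * T w (x k))\<^sup>2)
     = expectation (\<lambda>w. \<Sum>k\<in>I. \<Sum>k'\<in>I. c k * c k' * (T w (x k) * T w (x k')))"
    by (simp add: power2_eq_square sum_product mult_ac)
  also have "\<dots> = (\<Sum>k\<in>I. \<Sum>k'\<in>I. c k * c k' * expectation (\<lambda>w. T w (x k) * T w (x k')))"
    using x integrable_T_mult by simp
  finally have e: "expectation (\<lambda>w. (\<Sum>k\<in>I. c k * T w (x k))\<^sup>2)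
    = (\<Sum>k\<in>I. \<Sum>k'\<in>I. c k * c k' * expectation (\<lambda>w. T w (x k) * T w (x k')))" .
  have "(\<lambda>l. \<Sum>k\<in>I. \<Sum>k'\<in>I. c k * c k' * (A l * ((2 * real l + 1) / (4 * pi)) * poly (legendre_poly l) (x k \<bullet> x k')))
    sums (\<Sum>k\<in>I. \<Sum>k'\<in>I. c k * c k' * expectation (\<lambda>w. T w (x k) * T w (x k')))"
    using spectrum x unfolding angular_power_spectrum_def by (intro sums_sum sums_mult) blast
  then show ?thesis
    unfolding e by (simp add: sum_distrib_left sum_divide_distrib mult_ac)
qed

definition difference_const :: "nat \<Rightarrow> real" where
  "difference_const m = (exp 9 * (6 * real (Suc m)) ^ (2 * m) + 4 ^ m) * spectral_norm"

lemma difference_const_nonneg: "0 \<le> difference_const m"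
  using spectral_norm_nonneg by (simp add: difference_const_def)

text \<open>Summation of \<open>spectral_difference_bound\<close> over \<open>l\<close>.\<close>

lemma difference_variance:
  fixes u :: "real^2" and i :: 2
  assumes s: "s \<in> {1, -1}" and h: "0 < h" and m: "m \<ge> 1" "\<beta> \<le> 2 * real m"
  shows "expectation (\<lambda>w. (\<Sum>k\<le>m. binom_sign m k * T w (stereo s (u + (real k * h) *\<^sub>R axis i 1)))\<^sup>2)
    \<le> difference_const m * h powr \<beta>"
proof -
  let ?C = "exp 9 * (6 * real (Suc m)) ^ (2 * m) + 4 ^ m"
  have "(\<lambda>l. ?C * h powr \<beta> * (A l * real l powr (1 + \<beta>))) sums (?C * h powr \<beta> * spectral_norm)"
    unfolding spectral_norm_def by (intro sums_mult summable_sums summable_spectrum)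
  moreover have "A l * ((2 * real l + 1) / (4 * pi)) * (\<Sum>k\<le>m. \<Sum>k'\<le>m. binom_sign m k * binom_sign m k' *
       poly (legendre_poly l) (stereo s (u + (real k * h) *\<^sub>R axis i 1) \<bullet> stereo s (u + (real k' * h) *\<^sub>R axis i 1)))
     \<le> ?C * h powr \<beta> * (A l * real l powr (1 + \<beta>))" for l
    by (rule order_trans[OF abs_ge_self spectral_difference_bound[OF s h m \<beta> A_nonneg]])
  ultimately have "expectation (\<lambda>w. (\<Sum>k\<le>m. binom_sign m k * T w (stereo s (u + (real k * h) *\<^sub>R axis i 1)))\<^sup>2)
     \<le> ?C * h powr \<beta> * spectral_norm"
    using stereo_in_sphere[OF s] by (intro sums_le[OF _ square_linear_combination]) auto
  then show ?thesis by (simp add: difference_const_def mult_ac)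
qed

end

section \<open>Quadratic mean convergence of the quasi-interpolants\<close>

text \<open>The order \<open>m\<close> of the differences has to match \<open>\<beta>\<close>, and \<open>\<phi>\<close> needs one derivative more than the
  order of differentiability that is claimed.\<close>

locale approximated_field = gaussian_sphere_field M T A \<beta> + cardinal_function K m \<phi> D B
  for M :: "'w measure" and T A \<beta> K m \<phi> D B +
  assumes m1: "m \<ge> 1" and m2: "\<beta> \<le> 2 * real m" and Kbig: "\<beta> / 2 < real K"
begin

definition chart_field :: "real \<Rightarrow> 'w \<Rightarrow> real^2 \<Rightarrow> real" where
  "chart_field s w u = T w (stereo s u)"

lemma chart_field_measurable: "s \<in> {1, -1} \<Longrightarrow> (\<lambda>w. chart_field s w u) \<in> borel_measurable M"
  unfolding chart_field_def by (intro measurable_T stereo_in_sphere)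

lemma summable_weights: "summable (\<lambda>l. A l * ((2 * real l + 1) / (4 * pi)))"
proof (rule summable_comparison_test'[OF summable_spectrum, of 1])
  fix l :: nat assume l: "1 \<le> l"
  have "2 * real l + 1 \<le> 3 * real l" using l by simp
  also have "\<dots> \<le> real l * (4 * pi)" using pi_gt3 l by (simp add: mult_mono)
  finally have "(2 * real l + 1) / (4 * pi) \<le> real l" by (simp add: divide_le_eq)
  also have "real l \<le> real l powr (1 + \<beta>)"
    using powr_mono[of 1 "1 + \<beta>" "real l"] \<beta> l by simp
  finally have "A l * ((2 * real l + 1) / (4 * pi)) \<le> A l * real l powr (1 + \<beta>)"
    by (intro mult_left_mono A_nonneg)
  moreover have "0 \<le> A l * ((2 * real l + 1) / (4 * pi))" using A_nonneg[of l] by simp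
  ultimately show "norm (A l * ((2 * real l + 1) / (4 * pi))) \<le> A l * real l powr (1 + \<beta>)"
    by (simp only: real_norm_def abs_of_nonneg)
qed

definition cov_kernel :: "real \<Rightarrow> real" where
  "cov_kernel t = (\<Sum>l. A l * ((2 * real l + 1) / (4 * pi)) * poly (legendre_poly l) t)"

text \<open>By \<open>\<bar>P\<^sub>l\<bar> \<le> 1\<close> the series converges uniformly on \<open>[-1, 1]\<close>.\<close>

lemma cov_kernel_continuous: "continuous_on {-1..1} cov_kernel"
proof (rule uniform_limit_theorem)
  have "uniform_limit {-1..1} (\<lambda>n t. \<Sum>l<n. A l * ((2 * real l + 1) / (4 * pi)) * poly (legendre_poly l) t)
     (\<lambda>t. \<Sum>l. A l * ((2 * real l + 1) / (4 * pi)) * poly (legendre_poly l) t) sequentially"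
  proof (rule Weierstrass_m_test[OF _ summable_weights])
    fix l and t :: real assume "t \<in> {-1..1}"
    then have "\<bar>poly (legendre_poly l) t\<bar> \<le> 1" by (intro abs_legendre_poly_le_1) auto
    moreover have "0 \<le> A l * ((2 * real l + 1) / (4 * pi))" using A_nonneg[of l] by simp
    moreover have "0 \<le> a \<Longrightarrow> \<bar>p\<bar> \<le> 1 \<Longrightarrow> norm (a * p) \<le> a" for a p :: real
      by (simp add: abs_mult mult_left_le)
    ultimately show "norm (A l * ((2 * real l + 1) / (4 * pi)) * poly (legendre_poly l) t) \<le> A l * ((2 * real l + 1) / (4 * pi))"
      by blast
  qed
  then show "uniform_limit {-1..1} (\<lambda>n t. \<Sum>l<n. A l * ((2 * real l + 1) / (4 * pi)) * poly (legendre_poly l) t) cov_kernel sequentially"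
    unfolding cov_kernel_def[abs_def] .
  show "\<forall>\<^sub>F n in sequentially. continuous_on {-1..1} (\<lambda>t. \<Sum>l<n. A l * ((2 * real l + 1) / (4 * pi)) * poly (legendre_poly l) t)"
    by (intro always_eventually allI continuous_intros)
qed simp

lemma covariance_eq_kernel:
  "x \<in> sphere 0 1 \<Longrightarrow> y \<in> sphere 0 1 \<Longrightarrow> expectation (\<lambda>w. T w x * T w y) = cov_kernel (x \<bullet> y)"
  using spectrum unfolding angular_power_spectrum_def cov_kernel_def by (simp add: sums_unique)

lemma increment_variance:
  assumes "x \<in> sphere 0 1" "y \<in> sphere 0 1"
  shows "integrable M (\<lambda>w. (T w x - T w y)\<^sup>2)"
    and "expectation (\<lambda>w. (T w x - T w y)\<^sup>2) = 2 * cov_kernel 1 - 2 * cov_kernel (x \<bullet> y)"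
proof -
  have eq: "(T w x - T w y)\<^sup>2 = T w x * T w x + T w y * T w y - 2 * (T w x * T w y)" for w
    by (simp add: power2_eq_square algebra_simps)
  have "x \<bullet> x = 1" "y \<bullet> y = 1" using assms by (simp_all add: norm_eq_1)
  then show "integrable M (\<lambda>w. (T w x - T w y)\<^sup>2)"
    "expectation (\<lambda>w. (T w x - T w y)\<^sup>2) = 2 * cov_kernel 1 - 2 * cov_kernel (x \<bullet> y)"
    unfolding eq using assms integrable_T_mult covariance_eq_kernel by simp_all
qed

lemma chart_field_L2_continuous:
  assumes s: "s \<in> {1, -1}" and e: "0 < e"
  shows "\<exists>d>0. \<forall>v. dist v u < d \<longrightarrow> expectation (\<lambda>w. (chart_field s w v - chart_field s w u)\<^sup>2) < e"
proof -
  define g where "g v = 2 * cov_kernel 1 - 2 * cov_kernel (stereo s v \<bullet> stereo s u)" for v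
  have ev: "expectation (\<lambda>w. (chart_field s w v - chart_field s w u)\<^sup>2) = g v" for v
    unfolding chart_field_def g_def by (intro increment_variance stereo_in_sphere s)
  have in1: "stereo s v \<bullet> stereo s u \<in> {-1..1}" for v
    using Cauchy_Schwarz_ineq2[of "stereo s v" "stereo s u"] stereo_in_sphere[OF s] by (auto simp: abs_le_iff)
  have "continuous_on UNIV (\<lambda>v. stereo s v \<bullet> stereo s u)"
    unfolding inner_stereo[OF s]
    by (intro continuous_intros) (auto simp: add_nonneg_eq_0_iff)
  then have "continuous_on UNIV (\<lambda>v. cov_kernel (stereo s v \<bullet> stereo s u))"
    by (rule continuous_on_compose2[OF cov_kernel_continuous]) (use in1 in auto)
  then have "continuous_on UNIV g" unfolding g_def by (intro continuous_intros)
  moreover have "g u = 0" using stereo_in_sphere[OF s, of u] by (simp add: g_def norm_eq_1)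
  ultimately obtain d where "d > 0" "\<And>v. dist v u < d \<Longrightarrow> dist (g v) 0 < e"
    using e unfolding continuous_on_iff by (metis UNIV_I)
  then show ?thesis unfolding ev by (force simp: dist_real_def)
qed

abbreviation approx_error :: "real \<Rightarrow> nat \<Rightarrow> real^2 \<Rightarrow> 'w \<Rightarrow> real" where
  "approx_error s n u w \<equiv> approximant 0 0 (chart_field s w) n u - chart_field s w u"

lemma approximant_error_gaussian:
  assumes s: "s \<in> {1, -1}"
  shows "gaussian_rv M (approx_error s n u)"
proof -
  define J where "J = grid_window n \<times> grid_window n"
  define c where "c p = (case p of None \<Rightarrow> -1 | Some (i, j) \<Rightarrow> \<phi> 0 (2 ^ n * u $ 1 - of_int i) * \<phi> 0 (2 ^ n * u $ 2 - of_int j))" for p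
  define x where "x p = stereo s (case p of None \<Rightarrow> u | Some (i, j) \<Rightarrow> grid_point n i j)" for p
  have J: "finite J" by (simp add: J_def grid_window_def)
  have "gaussian_rv M (\<lambda>w. \<Sum>p\<in>insert None (Some ` J). c p * T w (x p))"
  proof (rule gaussian_linear_combination)
    show "x p \<in> sphere 0 1" for p unfolding x_def by (rule stereo_in_sphere[OF s])
  qed (use J in simp)
  moreover have "(\<Sum>p\<in>insert None (Some ` J). c p * T w (x p)) = approx_error s n u w" for w
  proof -
    have "(\<Sum>p\<in>insert None (Some ` J). c p * T w (x p)) = c None * T w (x None) + (\<Sum>p\<in>J. c (Some p) * T w (x (Some p)))"
      using J by (subst sum.insert) (auto simp: sum.reindex)
    also have "(\<Sum>p\<in>J. c (Some p) * T w (x (Some p))) = approximant 0 0 (chart_field s w) n u"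
      unfolding J_def approximant_def sum.cartesian_product
      by (intro sum.cong) (auto simp: c_def x_def chart_field_def)
    finally show ?thesis by (simp add: c_def x_def chart_field_def)
  qed
  ultimately show ?thesis by simp
qed

lemma card_int_near: "card {i::int. \<bar>t - of_int i\<bar> < real D} \<le> 2 * D + 2"
proof -
  have "{i::int. \<bar>t - of_int i\<bar> < real D} \<subseteq> {\<lfloor>t\<rfloor> - int D..<\<lfloor>t\<rfloor> - int D + int (2 * D + 2)}"
    by (auto simp: abs_less_iff) linarith+
  then have "card {i::int. \<bar>t - of_int i\<bar> < real D} \<le> card {\<lfloor>t\<rfloor> - int D..<\<lfloor>t\<rfloor> - int D + int (2 * D + 2)}"
    by (intro card_mono) auto
  then show ?thesis by simp
qed

text \<open>Since \<open>\<phi> 0\<close> reproduces constants, the error at \<open>u\<close> is a combination of the increments of the field between \<open>u\<close> and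
  nearby grid points, with a bounded number of bounded coefficients.\<close>

lemma approximant_error_variance:
  assumes s: "s \<in> {1, -1}" and n: "norm u + real D \<le> 2 ^ n" and d: "2 * real D < d * 2 ^ n"
    and e: "\<And>v. dist v u < d \<Longrightarrow> expectation (\<lambda>w. (chart_field s w v - chart_field s w u)\<^sup>2) \<le> e"
  shows "expectation (\<lambda>w. (approx_error s n u w)\<^sup>2)
    \<le> (real (2 * D + 2) ^ 2) ^ 2 * (B ^ 2) ^ 2 * e"
proof -
  define t where "t k = 2 ^ n * u $ k" for k :: 2
  define W where "W k = {i::int. \<bar>t k - of_int i\<bar> < real D}" for k
  define J where "J = W 1 \<times> W 2"
  have fW: "finite (W k)" for k unfolding W_def by (rule finite_int_near)
  have J: "finite J" by (simp add: J_def fW)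
  have "card J \<le> (2 * D + 2) * (2 * D + 2)"
    unfolding J_def card_cartesian_product W_def by (intro mult_mono card_int_near) auto
  then have cardJ: "real (card J) \<le> real (2 * D + 2) ^ 2"
    by (metis of_nat_le_iff of_nat_mult power2_eq_square)
  have Wgrid: "W k \<subseteq> grid_window n" for k
  proof
    fix i assume "i \<in> W k"
    then have "\<bar>of_int i\<bar> \<le> \<bar>t k\<bar> + real D" by (simp add: W_def)
    also have "\<bar>t k\<bar> = 2 ^ n * \<bar>u $ k\<bar>" by (simp add: t_def abs_mult)
    also have "2 ^ n * \<bar>u $ k\<bar> \<le> 2 ^ n * norm u" by (intro mult_left_mono component_le_norm_cart) auto
    also have "real D \<le> 2 ^ n * real D"
      using mult_right_mono[of 1 "2 ^ n" "real D"] by simp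
    finally have "\<bar>real_of_int i\<bar> \<le> (norm u + real D) * 2 ^ n" by (simp add: algebra_simps)
    then show "i \<in> grid_window n" by (rule in_grid_windowI[OF _ n])
  qed
  have outside: "\<phi> 0 (t k - of_int i) = 0" if "i \<notin> W k" for i k
    using that by (intro supp) (auto simp: W_def)
  define c where "c p = \<phi> 0 (t 1 - of_int (fst p)) * \<phi> 0 (t 2 - of_int (snd p))" for p
  define y where "y w p = chart_field s w (grid_point n (fst p) (snd p)) - chart_field s w u" for w p
  have one: "(\<Sum>i\<in>W k. \<phi> 0 (t k - of_int i)) = 1" for k
    using repro[of 0 "[:1:]" "W k" "t k"] m1 fW by (simp add: W_def)
  have c1: "(\<Sum>p\<in>J. c p) = 1"
  proof -
    have "(\<Sum>p\<in>J. c p) = (\<Sum>i\<in>W 1. \<phi> 0 (t 1 - of_int i)) * (\<Sum>j\<in>W 2. \<phi> 0 (t 2 - of_int j))"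
      unfolding J_def c_def by (simp add: sum_product sum.cartesian_product split_def)
    then show ?thesis by (simp add: one)
  qed
  have err: "approx_error s n u w = (\<Sum>p\<in>J. c p * y w p)" for w
  proof -
    have "approximant 0 0 (chart_field s w) n u = (\<Sum>i\<in>W 1. \<Sum>j\<in>grid_window n.
       chart_field s w (grid_point n i j) * (\<phi> 0 (t 1 - of_int i) * \<phi> 0 (t 2 - of_int j)))"
      unfolding approximant_def t_def[symmetric] using Wgrid outside
      by (intro sum.mono_neutral_right) (auto simp: grid_window_def)
    also have "\<dots> = (\<Sum>i\<in>W 1. \<Sum>j\<in>W 2.
       chart_field s w (grid_point n i j) * (\<phi> 0 (t 1 - of_int i) * \<phi> 0 (t 2 - of_int j)))"
      using Wgrid outside by (intro sum.cong refl sum.mono_neutral_right) (auto simp: grid_window_def)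
    also have "\<dots> = (\<Sum>p\<in>J. c p * chart_field s w (grid_point n (fst p) (snd p)))"
      unfolding sum.cartesian_product J_def c_def by (intro sum.cong) (auto simp: mult_ac)
    finally have ap: "approximant 0 0 (chart_field s w) n u = (\<Sum>p\<in>J. c p * chart_field s w (grid_point n (fst p) (snd p)))" .
    have "(\<Sum>p\<in>J. c p * y w p) = (\<Sum>p\<in>J. c p * chart_field s w (grid_point n (fst p) (snd p))) - (\<Sum>p\<in>J. c p) * chart_field s w u"
      by (simp add: y_def right_diff_distrib sum_subtractf sum_distrib_right)
    then show ?thesis by (simp add: ap c1)
  qed
  have near: "expectation (\<lambda>w. (y w p)\<^sup>2) \<le> e" if p: "p \<in> J" for p
    unfolding y_def
  proof (rule e)
    let ?v = "grid_point n (fst p) (snd p)"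
    have "(?v - u) $ 1 * 2 ^ n = of_int (fst p) - t 1" "(?v - u) $ 2 * 2 ^ n = of_int (snd p) - t 2"
      by (simp_all add: grid_point_def t_def field_simps)
    then have "\<bar>(?v - u) $ 1 * 2 ^ n\<bar> = \<bar>t 1 - of_int (fst p)\<bar>" "\<bar>(?v - u) $ 2 * 2 ^ n\<bar> = \<bar>t 2 - of_int (snd p)\<bar>"
      by simp_all
    then have "\<bar>(?v - u) $ 1\<bar> * 2 ^ n = \<bar>t 1 - of_int (fst p)\<bar>" "\<bar>(?v - u) $ 2\<bar> * 2 ^ n = \<bar>t 2 - of_int (snd p)\<bar>"
      by (simp_all only: abs_mult power_abs abs_numeral)
    then have "(\<bar>(?v - u) $ 1\<bar> + \<bar>(?v - u) $ 2\<bar>) * 2 ^ n \<le> 2 * real D"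
      using p by (auto simp: J_def W_def distrib_right)
    also have "\<dots> < d * 2 ^ n" by (rule d)
    finally have "\<bar>(?v - u) $ 1\<bar> + \<bar>(?v - u) $ 2\<bar> < d" by simp
    moreover have "norm (?v - u) \<le> \<bar>(?v - u) $ 1\<bar> + \<bar>(?v - u) $ 2\<bar>"
      using norm_le_l1_cart[of "?v - u"] by (simp only: sum_2)
    ultimately show "dist ?v u < d" by (simp add: dist_norm)
  qed
  have iy: "integrable M (\<lambda>w. (y w p)\<^sup>2)" for p
    unfolding y_def chart_field_def by (intro increment_variance stereo_in_sphere s)
  have c2: "(c p)\<^sup>2 \<le> (B\<^sup>2)\<^sup>2" for p
  proof -
    have "\<bar>c p\<bar> \<le> B * B" unfolding c_def abs_mult by (intro mult_mono bound B_nonneg) auto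
    then have "\<bar>c p\<bar>\<^sup>2 \<le> (B * B)\<^sup>2" by (intro power_mono) auto
    then show ?thesis by (simp add: power2_eq_square)
  qed
  have "0 < d * 2 ^ n" using d by (rule le_less_trans[rotated]) simp
  then have "0 < d" by (simp add: zero_less_mult_iff)
  then have e0: "0 \<le> e" using e[of u] by simp
  have "expectation (\<lambda>w. (approx_error s n u w)\<^sup>2)
     \<le> expectation (\<lambda>w. (real (2 * D + 2) ^ 2 * (B\<^sup>2)\<^sup>2) * (\<Sum>p\<in>J. (y w p)\<^sup>2))"
  proof (intro integral_mono)
    show "integrable M (\<lambda>w. (approx_error s n u w)\<^sup>2)"
      by (intro gaussian_rv_moments(2) approximant_error_gaussian s)
    show "integrable M (\<lambda>w. real (2 * D + 2) ^ 2 * (B\<^sup>2)\<^sup>2 * (\<Sum>p\<in>J. (y w p)\<^sup>2))"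
      by (intro integrable_mult_right Bochner_Integration.integrable_sum iy)
    fix w
    have "(\<Sum>p\<in>J. c p * y w p)\<^sup>2 \<le> (\<Sum>p\<in>J. (c p)\<^sup>2) * (\<Sum>p\<in>J. (y w p)\<^sup>2)"
      by (rule Cauchy_Schwarz_ineq_sum)
    also have "(\<Sum>p\<in>J. (c p)\<^sup>2) \<le> (\<Sum>p\<in>J. (B\<^sup>2)\<^sup>2)" by (intro sum_mono c2)
    also have "\<dots> \<le> real (2 * D + 2) ^ 2 * (B\<^sup>2)\<^sup>2" using cardJ by (simp add: mult_right_mono)
    finally show "(approx_error s n u w)\<^sup>2 \<le> real (2 * D + 2) ^ 2 * (B\<^sup>2)\<^sup>2 * (\<Sum>p\<in>J. (y w p)\<^sup>2)"
      unfolding err by (simp add: mult_right_mono sum_nonneg)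
  qed
  also have "\<dots> = (real (2 * D + 2) ^ 2 * (B\<^sup>2)\<^sup>2) * (\<Sum>p\<in>J. expectation (\<lambda>w. (y w p)\<^sup>2))"
    using iy by (simp add: Bochner_Integration.integral_sum)
  also have "\<dots> \<le> (real (2 * D + 2) ^ 2 * (B\<^sup>2)\<^sup>2) * (\<Sum>p\<in>J. e)"
    by (intro mult_left_mono sum_mono near) auto
  also have "\<dots> \<le> (real (2 * D + 2) ^ 2 * (B\<^sup>2)\<^sup>2) * (real (2 * D + 2) ^ 2 * e)"
    using cardJ e0 by (intro mult_left_mono) (auto intro: mult_right_mono)
  finally show ?thesis by (simp add: power2_eq_square mult_ac)
qed

lemma approximant_L2_limit:
  assumes s: "s \<in> {1, -1}"
  shows "(\<lambda>n. expectation (\<lambda>w. (approx_error s n u w)\<^sup>2)) \<longlonglongrightarrow> 0"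
proof (rule LIMSEQ_I)
  fix r :: real assume r: "0 < r"
  define c where "c = (real (2 * D + 2) ^ 2) ^ 2 * (B ^ 2) ^ 2"
  have c: "0 \<le> c" by (simp add: c_def)
  obtain d where d: "d > 0" "\<And>v. dist v u < d \<Longrightarrow> expectation (\<lambda>w. (chart_field s w v - chart_field s w u)\<^sup>2) < r / (c + 1)"
    using chart_field_L2_continuous[OF s, of "r / (c + 1)" u] r c by auto
  obtain N1 N2 where N1: "norm u + real D < 2 ^ N1" and N2: "2 * real D / d < 2 ^ N2"
    using real_arch_pow[of 2] by (metis one_less_numeral_iff semiring_norm(76))
  have "norm (expectation (\<lambda>w. (approx_error s n u w)\<^sup>2) - 0) < r"
    if n: "n \<ge> max N1 N2" for n
  proof -
    have p: "(2::real) ^ N1 \<le> 2 ^ n" "(2::real) ^ N2 \<le> 2 ^ n" using n by (auto intro: power_increasing)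
    have "2 * real D / d < 2 ^ n" using p N2 by linarith
    then have "2 * real D < d * 2 ^ n" using d(1) by (simp add: divide_less_eq mult.commute)
    then have "expectation (\<lambda>w. (approx_error s n u w)\<^sup>2) \<le> c * (r / (c + 1))"
    proof (unfold c_def, intro approximant_error_variance[OF s])
      show "norm u + real D \<le> 2 ^ n" using p N1 by linarith
      show "expectation (\<lambda>w. (chart_field s w v - chart_field s w u)\<^sup>2)
          \<le> r / ((real (2 * D + 2) ^ 2) ^ 2 * (B ^ 2) ^ 2 + 1)" if "dist v u < d" for v
        using d(2)[OF that] unfolding c_def by linarith
    qed
    also have "\<dots> < r" using r c by (simp add: field_simps)
    finally show ?thesis by simp
  qed
  then show "\<exists>no. \<forall>n\<ge>no. norm (expectation (\<lambda>w. (approx_error s n u w)\<^sup>2) - 0) < r"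
    by blast
qed

lemma chart_limit_AE_eq:
  assumes s: "s \<in> {1, -1}" and conv: "AE w in M. convergent (\<lambda>n. approximant 0 0 (chart_field s w) n u)"
  shows "AE w in M. lim (\<lambda>n. approximant 0 0 (chart_field s w) n u) = chart_field s w u"
proof (rule AE_limit_unique_L2[where Y = "\<lambda>n w. approximant 0 0 (chart_field s w) n u"])
  show "(\<lambda>w. approximant 0 0 (chart_field s w) n u) \<in> borel_measurable M" for n
    unfolding approximant_def using chart_field_measurable[OF s] by measurable
  show "(\<lambda>w. chart_field s w u) \<in> borel_measurable M" by (rule chart_field_measurable[OF s])
  show "integrable M (\<lambda>w. (approx_error s n u w)\<^sup>2)" for n
    by (intro gaussian_rv_moments(2) approximant_error_gaussian s)
  show "(\<lambda>n. expectation (\<lambda>w. (approx_error s n u w)\<^sup>2)) \<longlonglongrightarrow> 0"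
    by (rule approximant_L2_limit[OF s])
  show "AE w in M. (\<lambda>n. approximant 0 0 (chart_field s w) n u) \<longlonglongrightarrow> lim (\<lambda>n. approximant 0 0 (chart_field s w) n u)"
    using conv by (simp add: convergent_LIMSEQ_iff)
qed

end

section \<open>Almost sure regularity in each chart\<close>

context approximated_field
begin

definition grid_difference :: "real \<Rightarrow> nat \<Rightarrow> int \<times> int \<times> 2 \<Rightarrow> 'w \<Rightarrow> real" where
  "grid_difference s n = (\<lambda>(i, j, a) w. \<Sum>k\<le>m. binom_sign m k *
     T w (stereo s (grid_point n i j + (real k * (1 / 2 ^ n)) *\<^sub>R axis a 1)))"

lemma grid_point_shift:
  "grid_point n (i + int k) j = grid_point n i j + (real k * (1 / 2 ^ n)) *\<^sub>R axis 1 1"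
  "grid_point n i (j + int k) = grid_point n i j + (real k * (1 / 2 ^ n)) *\<^sub>R axis 2 1"
  by (simp_all add: grid_point_def vec_eq_iff forall_2 axis_def add_divide_distrib)

lemma fdiff_chart_field:
  "(fdiff 1 ^^ m) (\<lambda>e. chart_field s w (grid_point n e j)) i = grid_difference s n (i, j, 1) w"
  "(fdiff 1 ^^ m) (\<lambda>e. chart_field s w (grid_point n i e)) j = grid_difference s n (i, j, 2) w"
  by (simp_all add: fdiff_power_binom_sign chart_field_def grid_difference_def grid_point_shift)

lemma grid_difference_measurable:
  assumes s: "s \<in> {1, -1}"
  shows "grid_difference s n p \<in> borel_measurable M"
  unfolding grid_difference_def using measurable_T[OF stereo_in_sphere[OF s]] by (cases p) simp

text \<open>Markov's inequality for the moment of order \<open>2 q\<close>: the variance is of order \<open>2 powr - n \<beta>\<close>, so the probability to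
  exceed \<open>2 powr - n \<gamma>\<close> decays like \<open>2 powr - n q (\<beta> - 2 \<gamma>)\<close>, arbitrarily fast as \<open>q\<close> grows.\<close>

lemma grid_difference_tail:
  assumes s: "s \<in> {1, -1}"
  shows "prob {w \<in> space M. 2 powr (- (real n * \<gamma>)) < \<bar>grid_difference s n p w\<bar>}
    \<le> fact (2 * q) * difference_const m ^ q * 2 powr (- (real n * (real q * (\<beta> - 2 * \<gamma>))))"
proof -
  obtain i j a where p: "p = (i, j, a)" by (cases p) auto
  let ?x = "\<lambda>k. stereo s (grid_point n i j + (real k * (1 / 2 ^ n)) *\<^sub>R axis a 1)"
  let ?Z = "\<lambda>w. \<Sum>k\<le>m. binom_sign m k * T w (?x k)"
  have x: "?x k \<in> sphere 0 1" for k by (rule stereo_in_sphere[OF s])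
  have "prob {w \<in> space M. 2 powr (- (real n * \<gamma>)) < \<bar>?Z w\<bar>}
     \<le> fact (2 * q) * (difference_const m * (1 / 2 ^ n) powr \<beta> / (2 powr (- (real n * \<gamma>)))\<^sup>2) ^ q"
    by (intro gaussian_rv_tail gaussian_linear_combination expectation_linear_combination x difference_variance s m1 m2) auto
  also have "(1 / 2 ^ n :: real) powr \<beta> = 2 powr (- (real n * \<beta>))"
    by (simp add: powr_divide powr_minus_divide powr_powr flip: powr_realpow)
  also have "(2 powr (- (real n * \<gamma>)))\<^sup>2 = 2 powr (- (real n * (2 * \<gamma>)))"
    by (simp add: powr_power mult_ac)
  also have "difference_const m * 2 powr (- (real n * \<beta>)) / 2 powr (- (real n * (2 * \<gamma>)))
     = difference_const m * 2 powr (- (real n * (\<beta> - 2 * \<gamma>)))"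
  proof -
    have "2 powr (- (real n * \<beta>)) / 2 powr (- (real n * (2 * \<gamma>))) = 2 powr (- (real n * (\<beta> - 2 * \<gamma>)))"
      by (simp add: right_diff_distrib flip: powr_diff)
    then show ?thesis by (simp only: times_divide_eq_right[symmetric])
  qed
  also have "fact (2 * q) * (difference_const m * 2 powr (- (real n * (\<beta> - 2 * \<gamma>)))) ^ q
    = fact (2 * q) * difference_const m ^ q * 2 powr (- (real n * (real q * (\<beta> - 2 * \<gamma>))))"
    by (simp add: power_mult_distrib powr_power mult_ac)
  finally show ?thesis by (simp add: grid_difference_def p)
qed

definition grid_index :: "nat \<Rightarrow> nat \<Rightarrow> (int \<times> int \<times> 2) set" where
  "grid_index r n = {- (int r * 2 ^ n)..int r * 2 ^ n} \<times> {- (int r * 2 ^ n)..int r * 2 ^ n} \<times> UNIV"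

lemma finite_grid_index: "finite (grid_index r n)"
  by (simp add: grid_index_def)

lemma card_grid_index: "real (card (grid_index r n)) \<le> 2 * (2 * real r + 1)\<^sup>2 * 4 ^ n"
proof -
  have c: "card {- (int r * 2 ^ n)..int r * 2 ^ n} = 2 * r * 2 ^ n + 1"
    by (simp add: nat_add_distrib nat_mult_distrib nat_power_eq)
  have "real (card (grid_index r n)) = 2 * (2 * real r * 2 ^ n + 1)\<^sup>2"
    unfolding grid_index_def card_cartesian_product c by (simp add: power2_eq_square algebra_simps)
  also have "\<dots> \<le> 2 * ((2 * real r + 1) * 2 ^ n)\<^sup>2"
    by (intro mult_left_mono power_mono) (auto simp: distrib_right)
  also have "\<dots> = 2 * (2 * real r + 1)\<^sup>2 * 4 ^ n"
    by (simp add: power_mult_distrib power2_eq_square flip: power_mult_distrib[of 2 2])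
  finally show ?thesis .
qed

text \<open>Union bound over the \<open>O(4\<^sup>n)\<close> grid points in a fixed square, and the Borel-Cantelli lemma.\<close>

lemma AE_eventually_grid_difference:
  assumes s: "s \<in> {1, -1}" and \<gamma>: "\<gamma> < \<beta> / 2"
  shows "AE w in M. \<forall>\<^sub>F n in sequentially. \<forall>p\<in>grid_index r n. \<bar>grid_difference s n p w\<bar> \<le> 2 powr (- (real n * \<gamma>))"
proof -
  define bad where "bad n p = {w \<in> space M. 2 powr (- (real n * \<gamma>)) < \<bar>grid_difference s n p w\<bar>}" for n p
  define Bad where "Bad n = (\<Union>p\<in>grid_index r n. bad n p)" for n
  have meas: "bad n p \<in> sets M" for n p
    unfolding bad_def using grid_difference_measurable[OF s, of n p] by measurable
  then have Meas: "Bad n \<in> sets M" for n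
    unfolding Bad_def using finite_grid_index by blast
  \<comment> \<open>the exponent 3 beats the number of grid points: \<open>4\<^sup>n 8\<^sup>-\<^sup>n = 2\<^sup>-\<^sup>n\<close>\<close>
  obtain q where q: "3 \<le> real q * (\<beta> - 2 * \<gamma>)"
    using reals_Archimedean3[of "\<beta> - 2 * \<gamma>"] \<gamma> by (auto intro: less_imp_le)
  define c where "c = 2 * (2 * real r + 1)\<^sup>2 * (fact (2 * q) * difference_const m ^ q)"
  have c: "0 \<le> c" using difference_const_nonneg by (simp add: c_def)
  have bound: "prob (Bad n) \<le> c * (1 / 2) ^ n" for n
  proof -
    have "prob (Bad n) \<le> (\<Sum>p\<in>grid_index r n. prob (bad n p))"
      unfolding Bad_def using meas by (intro finite_measure_subadditive_finite finite_grid_index) auto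
    also have "\<dots> \<le> (\<Sum>p\<in>grid_index r n. fact (2 * q) * difference_const m ^ q * 2 powr (- (real n * 3)))"
    proof (rule sum_mono)
      fix p
      have "prob (bad n p) \<le> fact (2 * q) * difference_const m ^ q * 2 powr (- (real n * (real q * (\<beta> - 2 * \<gamma>))))"
        unfolding bad_def by (rule grid_difference_tail[OF s])
      also have "\<dots> \<le> fact (2 * q) * difference_const m ^ q * 2 powr (- (real n * 3))"
        using q difference_const_nonneg by (intro mult_left_mono powr_mono) (auto intro: mult_left_mono)
      finally show "prob (bad n p) \<le> fact (2 * q) * difference_const m ^ q * 2 powr (- (real n * 3))" .
    qed
    also have "\<dots> = real (card (grid_index r n)) * (fact (2 * q) * difference_const m ^ q * 2 powr (- (real n * 3)))"
      by simp
    also have "\<dots> \<le> (2 * (2 * real r + 1)\<^sup>2 * 4 ^ n) * (fact (2 * q) * difference_const m ^ q * 2 powr (- (real n * 3)))"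
      using difference_const_nonneg by (intro mult_right_mono card_grid_index) auto
    also have "2 powr (- (real n * 3)) = (1 / 8) ^ n"
    proof -
      have "2 powr (- (real n * 3)) = (2 powr (- 3)) ^ n" by (simp add: powr_power)
      also have "2 powr (- 3) = (1 / 8 :: real)" by (simp add: powr_minus_divide powr_numeral)
      finally show ?thesis .
    qed
    also have "(2 * (2 * real r + 1)\<^sup>2 * 4 ^ n) * (fact (2 * q) * difference_const m ^ q * (1 / 8) ^ n) = c * (4 ^ n * (1 / 8) ^ n)"
      by (simp add: c_def mult_ac)
    also have "4 ^ n * (1 / 8) ^ n = (1 / 2 :: real) ^ n"
      unfolding power_mult_distrib[symmetric] by simp
    finally show ?thesis .
  qed
  have "summable (\<lambda>n. prob (Bad n))"
  proof (rule summable_comparison_test')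
    show "summable (\<lambda>n. c * (1 / 2) ^ n)" by (intro summable_mult summable_geometric) simp
    show "norm (prob (Bad n)) \<le> c * (1 / 2) ^ n" for n using bound[of n] by simp
  qed
  then have "AE w in M. \<forall>\<^sub>F n in sequentially. w \<in> space M - Bad n"
    by (intro borel_cantelli_AE1 Meas) (auto simp: emeasure_eq_measure)
  then show ?thesis
  proof eventually_elim
    case (elim w)
    then show ?case
      by eventually_elim (auto simp: Bad_def bad_def not_less)
  qed
qed

lemma AE_grid_difference_bound:
  assumes s: "s \<in> {1, -1}" and \<gamma>: "\<gamma> < \<beta> / 2"
  shows "AE w in M. \<exists>C. \<forall>n. \<forall>p\<in>grid_index r n. \<bar>grid_difference s n p w\<bar> \<le> C * 2 powr (- (real n * \<gamma>))"
  using AE_eventually_grid_difference[OF assms, of r]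
proof eventually_elim
  case (elim w)
  then obtain N where N: "\<And>n p. n \<ge> N \<Longrightarrow> p \<in> grid_index r n \<Longrightarrow> \<bar>grid_difference s n p w\<bar> \<le> 2 powr (- (real n * \<gamma>))"
    unfolding eventually_sequentially by blast
  define F where "F n = (\<Sum>p\<in>grid_index r n. \<bar>grid_difference s n p w\<bar> * 2 powr (real n * \<gamma>))" for n
  \<comment> \<open>the finitely many early levels are absorbed into the constant\<close>
  define C where "C = 1 + (\<Sum>n<N. F n)"
  have F: "0 \<le> F n" for n unfolding F_def by (intro sum_nonneg) simp
  have C1: "1 \<le> C" using F by (simp add: C_def sum_nonneg)
  have "\<bar>grid_difference s n p w\<bar> \<le> C * 2 powr (- (real n * \<gamma>))" if p: "p \<in> grid_index r n" for n p
  proof (cases "n < N")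
    case True
    have "\<bar>grid_difference s n p w\<bar> * 2 powr (real n * \<gamma>) \<le> F n"
      unfolding F_def using p finite_grid_index by (intro member_le_sum) auto
    also have "F n \<le> (\<Sum>n<N. F n)" using True F by (intro member_le_sum) auto
    also have "\<dots> \<le> C" by (simp add: C_def)
    finally show ?thesis by (simp add: powr_minus_divide le_divide_eq)
  next
    case False
    then have "\<bar>grid_difference s n p w\<bar> \<le> 1 * 2 powr (- (real n * \<gamma>))" using N p by simp
    also have "\<dots> \<le> C * 2 powr (- (real n * \<gamma>))" using C1 by (intro mult_right_mono) auto
    finally show ?thesis .
  qed
  then show ?case by blast
qed

text \<open>Only countably many exponents below \<open>\<beta> / 2\<close> and radii are used, so that the exceptional sets remain null.\<close>

definition regular_path :: "real \<Rightarrow> 'w \<Rightarrow> bool" where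
  "regular_path s w \<longleftrightarrow> (\<forall>l r. \<exists>C. \<forall>n. \<forall>p\<in>grid_index r n.
     \<bar>grid_difference s n p w\<bar> \<le> C * 2 powr (- (real n * (\<beta> / 2 - 1 / real (Suc l)))))"

lemma AE_regular_path: "s \<in> {1, -1} \<Longrightarrow> AE w in M. regular_path s w"
  unfolding regular_path_def AE_all_countable by (intro allI AE_grid_difference_bound) auto

definition chart_version :: "real \<Rightarrow> 'w \<Rightarrow> real^2 \<Rightarrow> real" where
  "chart_version s w u = lim (\<lambda>n. approximant 0 0 (chart_field s w) n u)"

lemma regular_path_hoelder:
  assumes w: "regular_path s w" and \<gamma>: "0 < \<gamma>'" "\<gamma>' < \<beta> / 2"
  shows "convergent (\<lambda>n. approximant 0 0 (chart_field s w) n u)"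
    and "holder_Ck (nat \<lfloor>\<gamma>'\<rfloor>) (\<gamma>' - real (nat \<lfloor>\<gamma>'\<rfloor>)) (chart_version s w)"
proof -
  obtain l where l: "inverse (real (Suc l)) < \<beta> / 2 - \<gamma>'"
    using reals_Archimedean[of "\<beta> / 2 - \<gamma>'"] \<gamma> by auto
  define \<gamma> where "\<gamma> = \<beta> / 2 - 1 / real (Suc l)"
  have g: "\<gamma>' < \<gamma>" using l by (simp add: \<gamma>_def inverse_eq_divide)
  define k where "k = nat \<lfloor>\<gamma>'\<rfloor>"
  have k: "real k \<le> \<gamma>'" "\<gamma>' \<le> real k + 1"
    using \<gamma> by (auto simp: k_def)
  have "real k < real K" using k \<gamma> Kbig by linarith
  then have K: "Suc k \<le> K" by simp
  have d: "\<exists>C. \<forall>n i j. \<bar>real_of_int i\<bar> \<le> r * 2 ^ n \<longrightarrow> \<bar>real_of_int j\<bar> \<le> r * 2 ^ n \<longrightarrow>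
        \<bar>(fdiff 1 ^^ m) (\<lambda>e. chart_field s w (grid_point n e j)) i\<bar> \<le> C * 2 powr (- (real n * \<gamma>)) \<and>
        \<bar>(fdiff 1 ^^ m) (\<lambda>e. chart_field s w (grid_point n i e)) j\<bar> \<le> C * 2 powr (- (real n * \<gamma>))" for r :: real
  proof -
    define R where "R = nat \<lceil>r\<rceil>"
    have R: "r \<le> real R" unfolding R_def by linarith
    obtain C where C: "\<And>n p. p \<in> grid_index R n \<Longrightarrow> \<bar>grid_difference s n p w\<bar> \<le> C * 2 powr (- (real n * \<gamma>))"
      using w unfolding regular_path_def \<gamma>_def by blast
    have idx: "(i, j, a) \<in> grid_index R n" if "\<bar>real_of_int i\<bar> \<le> r * 2 ^ n" "\<bar>real_of_int j\<bar> \<le> r * 2 ^ n" for i j a n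
    proof -
      have "\<bar>i\<bar> \<le> int R * 2 ^ n" if "\<bar>real_of_int i\<bar> \<le> r * 2 ^ n" for i
      proof -
        have "\<bar>real_of_int i\<bar> \<le> real R * 2 ^ n" using order_trans[OF that mult_right_mono[OF R]] by simp
        then have "real_of_int \<bar>i\<bar> \<le> real_of_int (int R * 2 ^ n)" by simp
        then show ?thesis by (simp only: of_int_le_iff)
      qed
      from this[OF that(1)] this[OF that(2)] show ?thesis by (auto simp: grid_index_def abs_le_iff)
    qed
    show ?thesis
      unfolding fdiff_chart_field using C idx by blast
  qed
  show "convergent (\<lambda>n. approximant 0 0 (chart_field s w) n u)"
    by (rule grid_differences_imp_hoelder(1)[OF m1 K d k(1) g k(2)])
  show "holder_Ck (nat \<lfloor>\<gamma>'\<rfloor>) (\<gamma>' - real (nat \<lfloor>\<gamma>'\<rfloor>)) (chart_version s w)"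
    using grid_differences_imp_hoelder(2)[OF m1 K d k(1) g k(2)]
    unfolding k_def[symmetric] chart_version_def[abs_def] .
qed

lemma regular_path_continuous: "regular_path s w \<Longrightarrow> continuous_on UNIV (chart_version s w)"
  using regular_path_hoelder(2)[of s w "\<beta> / 4"] \<beta> Ck_plane_imp_continuous by (auto simp: holder_Ck_def)

lemma chart_version_AE_eq:
  assumes s: "s \<in> {1, -1}"
  shows "AE w in M. chart_version s w u = T w (stereo s u)"
proof -
  have "AE w in M. convergent (\<lambda>n. approximant 0 0 (chart_field s w) n u)"
    using AE_regular_path[OF s]
  proof eventually_elim
    case (elim w)
    then show ?case using regular_path_hoelder(1)[of s w "\<beta> / 4"] \<beta> by simp
  qed
  then show ?thesis
    using chart_limit_AE_eq[OF s] by (simp add: chart_version_def chart_field_def)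
qed

text \<open>The change of charts between the two stereographic projections.\<close>

definition plane_inversion :: "real^2 \<Rightarrow> real^2" where
  "plane_inversion u = inverse ((norm u)\<^sup>2) *\<^sub>R u"

lemma norm_plane_inversion:
  assumes "u \<noteq> 0"
  shows "(norm (plane_inversion u))\<^sup>2 = inverse ((norm u)\<^sup>2)"
proof -
  define q where "q = (norm u)\<^sup>2"
  have q: "q > 0" using assms by (simp add: q_def)
  have "(norm (plane_inversion u))\<^sup>2 = (inverse q)\<^sup>2 * q"
    unfolding plane_inversion_def q_def[symmetric] norm_scaleR power_mult_distrib using q by simp
  also have "\<dots> = inverse q" using q by (simp add: power2_eq_square)
  finally show ?thesis by (simp only: q_def)
qed

lemma stereo_inversion:
  assumes "u \<noteq> 0"
  shows "stereo (-1) (plane_inversion u) = stereo 1 u"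
proof -
  define q where "q = (norm u)\<^sup>2"
  have q: "q > 0" using assms by (simp add: q_def)
  have n: "(norm (plane_inversion u))\<^sup>2 = inverse q"
    using norm_plane_inversion[OF assms] by (simp add: q_def)
  have c: "plane_inversion u $ i = u $ i / q" for i by (simp add: plane_inversion_def q_def divide_inverse mult.commute)
  have i: "inverse (1 + inverse q) = q * inverse (1 + q)"
    using q by (simp add: field_simps)
  have 1: "inverse (1 + inverse q) * (2 * (x / q)) = inverse (1 + q) * (2 * x)" for x
    unfolding i using q by simp
  have "q * (- 1 * (inverse q - 1)) = q - 1"
    using q by (simp add: right_diff_distrib)
  then have 2: "inverse (1 + inverse q) * (- 1 * (inverse q - 1)) = inverse (1 + q) * (1 * (q - 1))"
    unfolding i by (metis (no_types) mult.assoc mult.commute mult_1)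
  show ?thesis
    unfolding stereo_def n c q_def[symmetric] using 1 2 by (simp add: vec_eq_iff forall_3)
qed

text \<open>Both sides are almost surely equal to the field at each point of a countable dense set, and both are continuous
  away from the origin.\<close>

lemma AE_charts_agree:
  "AE w in M. \<forall>u. u \<noteq> 0 \<longrightarrow> chart_version 1 w u = chart_version (-1) w (plane_inversion u)"
proof -
  obtain Q :: "(real^2) set" where Q: "countable Q" "\<And>X. open X \<Longrightarrow> X \<noteq> {} \<Longrightarrow> \<exists>d\<in>Q. d \<in> X"
    using countable_dense_setE by blast
  have "AE w in M. \<forall>u\<in>Q. u \<noteq> 0 \<longrightarrow> chart_version 1 w u = chart_version (-1) w (plane_inversion u)"
  proof (intro AE_ball_countable' Q(1))
    fix u
    have "AE w in M. chart_version 1 w u = T w (stereo 1 u)" "AE w in M. chart_version (-1) w (plane_inversion u) = T w (stereo (-1) (plane_inversion u))"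
      by (intro chart_version_AE_eq; simp)+
    then show "AE w in M. u \<noteq> 0 \<longrightarrow> chart_version 1 w u = chart_version (-1) w (plane_inversion u)"
      by eventually_elim (simp add: stereo_inversion)
  qed
  moreover have "AE w in M. regular_path 1 w" "AE w in M. regular_path (-1) w" by (intro AE_regular_path; simp)+
  ultimately show ?thesis
  proof eventually_elim
    case (elim w)
    define g where "g u = chart_version 1 w u - chart_version (-1) w (plane_inversion u)" for u
    have inv: "continuous_on (- {0}) plane_inversion"
      unfolding plane_inversion_def by (intro continuous_intros) auto
    have "continuous_on (- {0}) g"
      unfolding g_def
      by (intro continuous_on_diff continuous_on_compose2[OF regular_path_continuous[OF elim(3)] inv]
          continuous_on_subset[OF regular_path_continuous[OF elim(2)]]) auto
    then have "open (- {0} \<inter> g -` (- {0}))"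
      by (intro continuous_open_preimage) auto
    moreover have "- {0} \<inter> g -` (- {0}) \<inter> Q = {}" using elim(1) by (auto simp: g_def)
    ultimately have "- {0} \<inter> g -` (- {0}) = {}" using Q(2) by blast
    then show ?case by (auto simp: g_def)
  qed
qed

end

section \<open>Gluing the two charts\<close>

lemma hoelder_space_sphereI:
  assumes "\<And>s. s \<in> {1, -1} \<Longrightarrow> holder_Ck (nat \<lfloor>\<gamma>\<rfloor>) (\<gamma> - real (nat \<lfloor>\<gamma>\<rfloor>)) (f \<circ> stereo s)"
  shows "f \<in> hoelder_space_sphere \<gamma>"
  using assms unfolding hoelder_space_sphere_def Ck_sphere_def hoelder_derivs_sphere_def holder_Ck_def by auto

text \<open>The stereographic projection from the pole with third coordinate \<open>s\<close>, inverse to \<open>stereo s\<close>.\<close>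

definition stereo_coord :: "real \<Rightarrow> real^3 \<Rightarrow> real^2" where
  "stereo_coord s x = inverse (1 - s * (x $ 3)) *\<^sub>R ((x $ 1) *\<^sub>R axis 1 1 + (x $ 2) *\<^sub>R axis 2 1)"

lemma stereo_coord_nth:
  "stereo_coord s x $ 1 = x $ 1 / (1 - s * (x $ 3))" "stereo_coord s x $ 2 = x $ 2 / (1 - s * (x $ 3))"
  by (simp_all add: stereo_coord_def axis_def divide_inverse mult.commute)

lemma stereo_nth:
  "stereo s u $ 1 = 2 * u $ 1 / (1 + (norm u)\<^sup>2)" "stereo s u $ 2 = 2 * u $ 2 / (1 + (norm u)\<^sup>2)"
  "stereo s u $ 3 = s * ((norm u)\<^sup>2 - 1) / (1 + (norm u)\<^sup>2)"
  by (simp_all add: stereo_def divide_inverse mult_ac)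

lemma stereo_coord_stereo:
  assumes s: "s \<in> {1, -1}"
  shows "stereo_coord s (stereo s u) = u"
proof -
  have ss: "s * s = 1" using s by auto
  define q where "q = 1 + (norm u)\<^sup>2"
  have q: "q > 0" by (simp add: q_def add_pos_nonneg)
  have "1 - s * (stereo s u $ 3) = 1 - (s * s) * (q - 2) / q"
    by (simp add: stereo_nth q_def)
  also have "\<dots> = 2 / q" using q unfolding ss by (simp add: field_simps)
  finally show ?thesis
    using q by (simp add: vec_eq_iff forall_2 stereo_coord_nth stereo_nth(1,2) q_def[symmetric])
qed

lemma stereo_coord_other_chart:
  assumes s: "s \<in> {1, -1}" and u: "u \<noteq> 0"
  shows "stereo_coord (- s) (stereo s u) = inverse ((norm u)\<^sup>2) *\<^sub>R u"
proof -
  have ss: "s * s = 1" using s by auto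
  define p where "p = (norm u)\<^sup>2"
  have p: "p > 0" using u by (simp add: p_def)
  have "1 - (- s) * (stereo s u $ 3) = 1 + (s * s) * (p - 1) / (1 + p)"
    by (simp add: stereo_nth p_def)
  also have "\<dots> = 2 * p / (1 + p)" using p unfolding ss by (simp add: field_simps)
  finally have d: "1 - (- s) * (stereo s u $ 3) = 2 * p / (1 + p)" .
  have c: "(2 * y / (1 + p)) / (2 * p / (1 + p)) = inverse p * y" for y
  proof -
    define v where "v = 1 + p"
    have "v \<noteq> 0" "p \<noteq> 0" using p by (auto simp: v_def)
    then show ?thesis unfolding v_def[symmetric] by (simp add: field_simps)
  qed
  have "stereo_coord (- s) (stereo s u) $ 1 = inverse p * u $ 1" "stereo_coord (- s) (stereo s u) $ 2 = inverse p * u $ 2"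
    using c[of "u $ 1"] c[of "u $ 2"] by (simp_all only: stereo_coord_nth d stereo_nth(1,2) p_def[symmetric])
  then show ?thesis by (simp add: vec_eq_iff forall_2 p_def)
qed

lemma norm_square_space: "(norm (x :: real^3))\<^sup>2 = (x $ 1)\<^sup>2 + (x $ 2)\<^sup>2 + (x $ 3)\<^sup>2"
  unfolding power2_norm_eq_inner by (simp add: inner_vec_def sum_3 power2_eq_square)

lemma stereo_stereo_coord:
  fixes x :: "real^3"
  assumes s: "s \<in> {1, -1}" and x: "x \<in> sphere 0 1" and c: "s * (x $ 3) \<noteq> 1"
  shows "stereo s (stereo_coord s x) = x"
proof -
  have ss: "s * s = 1" using s by auto
  define z where "z = s * (x $ 3)"
  have z: "z \<noteq> 1" "z\<^sup>2 = (x $ 3)\<^sup>2" "x $ 3 = s * z"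
    using c ss by (auto simp: z_def power_mult_distrib power2_eq_square mult.assoc[symmetric])
  have "(norm x)\<^sup>2 = 1" using x by simp
  then have xx: "(x $ 1)\<^sup>2 + (x $ 2)\<^sup>2 = (1 - z) * (1 + z)"
    unfolding norm_square_space z(2)[symmetric] by (simp add: power2_eq_square algebra_simps)
  have "(norm (stereo_coord s x))\<^sup>2 = ((x $ 1)\<^sup>2 + (x $ 2)\<^sup>2) / (1 - z)\<^sup>2"
    by (simp add: norm_square_plane[of 1 2] stereo_coord_nth z_def power_divide add_divide_distrib)
  also have "\<dots> = (1 + z) / (1 - z)"
    unfolding xx using z(1) by (simp add: power2_eq_square)
  finally have n: "(norm (stereo_coord s x))\<^sup>2 = (1 + z) / (1 - z)" .
  have q: "1 + (norm (stereo_coord s x))\<^sup>2 = 2 / (1 - z)"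
    unfolding n using z(1) by (simp add: field_simps)
  have m: "(norm (stereo_coord s x))\<^sup>2 - 1 = 2 * z / (1 - z)"
    unfolding n using z(1) by (simp add: field_simps)
  have c: "2 * (y / (1 - z)) / (2 / (1 - z)) = y" "s * (2 * z / (1 - z)) / (2 / (1 - z)) = s * z" for y
    using z(1) by simp_all
  have "stereo s (stereo_coord s x) $ 1 = x $ 1" "stereo s (stereo_coord s x) $ 2 = x $ 2"
    unfolding stereo_nth q stereo_coord_nth z_def[symmetric] by (rule c(1))+
  moreover have "stereo s (stereo_coord s x) $ 3 = x $ 3"
    unfolding stereo_nth q m z(3) by (rule c(2))
  ultimately show ?thesis by (simp add: vec_eq_iff forall_3)
qed

context approximated_field
begin

text \<open>Each hemisphere is read in the chart in which it lies in the closed unit disc, away from the centre of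
  projection.\<close>

definition glued_version :: "'w \<Rightarrow> real^3 \<Rightarrow> real" where
  "glued_version w x = (if x $ 3 \<le> 0 then chart_version 1 w (stereo_coord 1 x)
     else chart_version (-1) w (stereo_coord (-1) x))"

text \<open>Where the chart \<open>s\<close> meets the other hemisphere, the definition uses the other chart at the inverted point,
  which has the same value by agreement of the charts.\<close>

lemma glued_version_stereo:
  assumes agree: "\<And>u::real^2. u \<noteq> 0 \<Longrightarrow> chart_version 1 w u = chart_version (-1) w (plane_inversion u)"
    and s: "s \<in> {1, -1}"
  shows "glued_version w \<circ> stereo s = chart_version s w"
proof
  fix u :: "real^2"
  have inv: "plane_inversion (plane_inversion u) = u" if "u \<noteq> 0"
  proof -
    have "plane_inversion (plane_inversion u) = inverse (inverse ((norm u)\<^sup>2)) *\<^sub>R (inverse ((norm u)\<^sup>2) *\<^sub>R u)"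
      unfolding plane_inversion_def[of "plane_inversion u"] norm_plane_inversion[OF that]
      by (simp add: plane_inversion_def)
    then show ?thesis using that by simp
  qed
  have inv0: "plane_inversion u \<noteq> 0" if "u \<noteq> 0" using that by (simp add: plane_inversion_def)
  consider "s = 1" | "s = -1" using s by auto
  then show "(glued_version w \<circ> stereo s) u = chart_version s w u"
  proof cases
    case 1
    show ?thesis
    proof (cases "stereo s u $ 3 \<le> 0")
      case True
      then show ?thesis using 1 stereo_coord_stereo[of 1 u] by (simp add: glued_version_def)
    next
      case False
      then have "u \<noteq> 0" using 1 by (auto simp: stereo_nth)
      then show ?thesis
        using 1 False stereo_coord_other_chart[of 1 u] agree by (simp add: glued_version_def plane_inversion_def)
    qed
  next
    case 2
    show ?thesis
    proof (cases "stereo s u $ 3 \<le> 0")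
      case True
      then have u: "u \<noteq> 0" using 2 by (auto simp: stereo_nth)
      have "chart_version 1 w (plane_inversion u) = chart_version (-1) w u"
        using agree[OF inv0[OF u]] inv[OF u] by simp
      then show ?thesis
        using 2 True stereo_coord_other_chart[of "-1" u] u by (simp add: glued_version_def plane_inversion_def)
    next
      case False
      then show ?thesis using 2 stereo_coord_stereo[of "-1" u] by (simp add: glued_version_def)
    qed
  qed
qed

lemma glued_version_AE_eq:
  fixes x :: "real^3"
  assumes x: "x \<in> sphere 0 1"
  shows "AE w in M. glued_version w x = T w x"
proof (cases "x $ 3 \<le> 0")
  case True
  then have "stereo 1 (stereo_coord 1 x) = x" using x by (intro stereo_stereo_coord; simp)
  then show ?thesis
    using chart_version_AE_eq[of 1 "stereo_coord 1 x"] True by (simp add: glued_version_def)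
next
  case False
  then have "stereo (-1) (stereo_coord (-1) x) = x" using x by (intro stereo_stereo_coord; simp)
  then show ?thesis
    using chart_version_AE_eq[of "-1" "stereo_coord (-1) x"] False by (simp add: glued_version_def)
qed

lemma chart_version_measurable:
  assumes s: "s \<in> {1, -1}"
  shows "(\<lambda>(w, u). chart_version s w u) \<in> borel_measurable (M \<Otimes>\<^sub>M borel)"
proof -
  have phi [measurable]: "\<phi> 0 \<in> borel_measurable borel"
    using cont[of 0] by (intro borel_measurable_continuous_onI) simp
  have X [measurable]: "(\<lambda>w. chart_field s w v) \<in> borel_measurable M" for v
    by (rule chart_field_measurable[OF s])
  have nth [measurable]: "(\<lambda>u::real^2. u $ i) \<in> borel_measurable borel" for i
    by (intro borel_measurable_continuous_onI continuous_intros)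
  have "(\<lambda>z. approximant 0 0 (chart_field s (fst z)) n (snd z)) \<in> borel_measurable (M \<Otimes>\<^sub>M borel)" for n
    unfolding approximant_def by measurable
  then show ?thesis
    unfolding chart_version_def split_def by (rule borel_measurable_lim_metric)
qed

lemma glued_version_measurable:
  "(\<lambda>(w, x). glued_version w x) \<in> borel_measurable (M \<Otimes>\<^sub>M restrict_space borel (sphere 0 1))"
proof -
  let ?N = "M \<Otimes>\<^sub>M restrict_space borel (sphere (0::real^3) 1)"
  have nth: "(\<lambda>x::real^3. x $ i) \<in> borel_measurable (restrict_space borel (sphere 0 1))" for i
    by (intro measurable_restrict_space1 borel_measurable_continuous_onI continuous_intros)
  have n [measurable]: "(\<lambda>z. snd z $ i) \<in> borel_measurable ?N" for i
    by (rule measurable_compose[OF measurable_snd nth])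
  have c [measurable]: "(\<lambda>z. stereo_coord s (snd z)) \<in> borel_measurable ?N" for s
    unfolding stereo_coord_def by measurable
  have v: "(\<lambda>z. chart_version s (fst z) (stereo_coord s (snd z))) \<in> borel_measurable ?N" if "s \<in> {1, -1}" for s
  proof -
    have "(\<lambda>z. (fst z, stereo_coord s (snd z))) \<in> measurable ?N (M \<Otimes>\<^sub>M borel)" by measurable
    from measurable_compose[OF this chart_version_measurable[OF that]] show ?thesis by simp
  qed
  have [measurable]: "(\<lambda>z. chart_version 1 (fst z) (stereo_coord 1 (snd z))) \<in> borel_measurable ?N"
    "(\<lambda>z. chart_version (-1) (fst z) (stereo_coord (-1) (snd z))) \<in> borel_measurable ?N"
    by (intro v; simp)+
  show ?thesis
    unfolding glued_version_def split_def by measurable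
qed

theorem lognormal_hoelder_modification:
  "\<exists>S. is_modification M S (\<lambda>w x. exp (T w x)) \<and>
    (\<forall>w\<in>space M. \<forall>\<gamma>. 0 < \<gamma> \<and> \<gamma> < \<beta> / 2 \<longrightarrow> S w \<in> hoelder_space_sphere \<gamma>)"
proof -
  have "AE w in M. regular_path 1 w \<and> regular_path (-1) w \<and>
      (\<forall>u. u \<noteq> 0 \<longrightarrow> chart_version 1 w u = chart_version (-1) w (plane_inversion u))"
    using AE_regular_path[of 1] AE_regular_path[of "-1"] AE_charts_agree by auto
  then obtain N where N: "N \<in> null_sets M" and good: "\<And>w. w \<in> space M - N \<Longrightarrow>
      regular_path 1 w \<and> regular_path (-1) w \<and>
      (\<forall>u. u \<noteq> 0 \<longrightarrow> chart_version 1 w u = chart_version (-1) w (plane_inversion u))"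
    by (elim AE_E3) blast
  \<comment> \<open>on the exceptional null set a constant path keeps every path regular and the field jointly measurable\<close>
  define S where "S w x = (if w \<in> N then 1 else exp (glued_version w x))" for w x
  have rf: "random_field M S"
  proof -
    have [measurable]: "N \<in> sets M" using N by auto
    have [measurable]: "(\<lambda>z. glued_version (fst z) (snd z)) \<in> borel_measurable (M \<Otimes>\<^sub>M restrict_space borel (sphere 0 1))"
      using glued_version_measurable by (simp add: split_def)
    show ?thesis unfolding random_field_def S_def split_def by measurable
  qed
  have "measure M {w \<in> space M. S w x = exp (T w x)} = 1" if x: "x \<in> sphere 0 1" for x
  proof -
    have [measurable]: "(\<lambda>w. T w x) \<in> borel_measurable M" by (rule measurable_T[OF x])
    have "x \<in> space (restrict_space borel (sphere 0 1))" using x by (simp add: space_restrict_space)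
    from measurable_Pair1[OF rf[unfolded random_field_def] this]
    have [measurable]: "(\<lambda>w. S w x) \<in> borel_measurable M" by simp
    have "AE w in M. S w x = exp (T w x)"
      using AE_not_in[OF N] glued_version_AE_eq[OF x]
      by eventually_elim (simp add: S_def)
    then show ?thesis by (subst prob_Collect_eq_1) auto
  qed
  then have "is_modification M S (\<lambda>w x. exp (T w x))"
    using rf by (simp add: is_modification_def)
  moreover have "S w \<in> hoelder_space_sphere \<gamma>" if w: "w \<in> space M" and \<gamma>: "0 < \<gamma>" "\<gamma> < \<beta> / 2" for w \<gamma>
  proof (rule hoelder_space_sphereI)
    fix s :: real assume s: "s \<in> {1, -1}"
    show "holder_Ck (nat \<lfloor>\<gamma>\<rfloor>) (\<gamma> - real (nat \<lfloor>\<gamma>\<rfloor>)) (S w \<circ> stereo s)"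
    proof (cases "w \<in> N")
      case True
      then have "S w \<circ> stereo s = (\<lambda>_. 1)" by (auto simp: S_def)
      then show ?thesis by (simp add: holder_Ck_const)
    next
      case False
      have g: "regular_path s w" "glued_version w \<circ> stereo s = chart_version s w"
        using good[of w] w False s glued_version_stereo[OF _ s, of w] by auto
      have "S w \<circ> stereo s = (\<lambda>u. exp ((glued_version w \<circ> stereo s) u))" using False by (auto simp: S_def)
      also have "\<dots> = (\<lambda>u. exp (chart_version s w u))" by (simp only: g(2))
      finally have eq: "S w \<circ> stereo s = (\<lambda>u. exp (chart_version s w u))" .
      have "0 \<le> \<gamma> - real (nat \<lfloor>\<gamma>\<rfloor>)" "\<gamma> - real (nat \<lfloor>\<gamma>\<rfloor>) \<le> 1" using \<gamma> by linarith+
      then show ?thesis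
        unfolding eq by (intro holder_Ck_exp regular_path_hoelder(2)[OF g(1) \<gamma>])
    qed
  qed
  ultimately show ?thesis by blast
qed

end

theorem corollary6p3:
  fixes M :: "'w measure" and T :: "'w \<Rightarrow> real^3 \<Rightarrow> real"
    and A :: "nat \<Rightarrow> real" and \<beta> :: real and k :: nat
  assumes "prob_space M"
    and "gaussian_field M T" and "centered M T" and "isotropic M T"
    and "angular_power_spectrum M T A"
    and "\<beta> > 0"
    and "summable (\<lambda>l. A l * real l powr (1 + \<beta>))"
    and k: "k = nat (\<lceil>\<beta> / 2\<rceil> - 1)"
  shows "\<exists>S. is_modification M S (\<lambda>w x. exp (T w x)) \<and>
    (\<forall>w\<in>space M.
       (\<forall>\<gamma>. 0 < \<gamma> \<and> \<gamma> < \<beta> / 2 \<longrightarrow> S w \<in> hoelder_space_sphere \<gamma>) \<and>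
       Ck_sphere k (S w) \<and>
       (\<forall>\<gamma>. real k < \<gamma> \<and> \<gamma> < \<beta> / 2 \<longrightarrow> hoelder_derivs_sphere k (\<gamma> - real k) (S w)))"
proof -
  define m where "m = Suc (nat \<lceil>\<beta>\<rceil>)"
  have m: "\<beta> \<le> real m" unfolding m_def using \<open>\<beta> > 0\<close> by linarith
  obtain \<phi> D B where card: "cardinal_function m m \<phi> D B" using cardinal_function_exists by blast
  have field: "gaussian_sphere_field M T A \<beta>"
    by (intro gaussian_sphere_field.intro gaussian_sphere_field_axioms.intro) fact+
  interpret approximated_field M T A \<beta> m m \<phi> D B
  proof (intro approximated_field.intro approximated_field_axioms.intro field card)
    show "1 \<le> m" by (simp add: m_def)
    show "\<beta> \<le> 2 * real m" "\<beta> / 2 < real m" using m \<open>\<beta> > 0\<close> by linarith+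
  qed
  obtain S where S: "is_modification M S (\<lambda>w x. exp (T w x))"
    and hol: "\<And>w \<gamma>. w \<in> space M \<Longrightarrow> 0 < \<gamma> \<Longrightarrow> \<gamma> < \<beta> / 2 \<Longrightarrow> S w \<in> hoelder_space_sphere \<gamma>"
    using lognormal_hoelder_modification by blast
  have k_lt: "real k < \<beta> / 2" "\<beta> / 2 \<le> real k + 1"
    unfolding k using \<open>\<beta> > 0\<close> by linarith+
  have top: "Ck_sphere k (S w) \<and> hoelder_derivs_sphere k (\<gamma> - real k) (S w)"
    if w: "w \<in> space M" and \<gamma>: "real k < \<gamma>" "\<gamma> < \<beta> / 2" for w \<gamma>
  proof -
    have "nat \<lfloor>\<gamma>\<rfloor> = k" using \<gamma> k_lt by linarith
    moreover have "S w \<in> hoelder_space_sphere \<gamma>" using \<gamma> by (intro hol[OF w]) auto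
    ultimately show ?thesis by (simp add: hoelder_space_sphere_def)
  qed
  \<comment> \<open>an admissible exponent above \<open>k\<close>, which is positive even when \<open>k = 0\<close>\<close>
  have mid: "real k < (real k + \<beta> / 2) / 2" "(real k + \<beta> / 2) / 2 < \<beta> / 2"
    using k_lt by auto
  show ?thesis
  proof (intro exI[of _ S] conjI ballI S)
    fix w assume w: "w \<in> space M"
    show "\<forall>\<gamma>. 0 < \<gamma> \<and> \<gamma> < \<beta> / 2 \<longrightarrow> S w \<in> hoelder_space_sphere \<gamma>" using hol[OF w] by blast
    show "Ck_sphere k (S w)" using top[OF w mid] by blast
    show "\<forall>\<gamma>. real k < \<gamma> \<and> \<gamma> < \<beta> / 2 \<longrightarrow> hoelder_derivs_sphere k (\<gamma> - real k) (S w)"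
      using top[OF w] by blast
  qed
qed

end
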